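(* Let $w_1,w_2,w_3\in\mathbb{Z}^3$, let $e^{w_i}=\exp\big(\sum_j w_i^j x^*_j\big)\in L^2(Y)$ be the corresponding vacuum states, and let $e^{w_i}(z)$ be the associated vertex operators on the module $\mathcal H$ (all defined in the context). Let $\Delta_E$ be the Euclidean tetrahedron in $\mathbb{R}^3$ with vertices $0,w_1,w_2,w_3$ and let $\Delta_H$ be the ideal hyperbolic tetrahedron with vertices $\infty,z,w,0\in\mathbb{CP}^1\cong\partial\mathbb{H}_3$, with the conventions $\mathrm{vol}(\Delta_E):=\det(w_1,w_2,w_3)$ and $\mathrm{vol}(\Delta_H):=L(w/z)$, where $L$ is Rogers' dilogarithm. Then for every $\psi\in L^2(Y)$, $$\langle \psi\,|\, e^{w_1}(z)\, e^{w_2}(w)\,|\, e^{w_3}\rangle \;=\; i_{z,w}\exp\big(\mathrm{vol}(\Delta_E)\,\mathrm{vol}(\Delta_H)\big)\;\langle \psi\,|\,e^{w_1}e^{w_2}e^{w_3}\rangle ,$$ that is, $$\langle \psi| e^{w_1}(z) e^{w_2}(w) | e^{w_3}\rangle = i_{z,w}\exp\Big(\det(w_1,w_2,w_3)\,L\big(\tfrac{w}{z}\big)\Big)\langle\psi|e^{w_1}e^{w_2}e^{w_3}\rangle ,$$ as an identity of formal series, where $i_{z,w}$ denotes expansion in the domain $|z|\gg|w|$.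
   Context: Throughout, $i,j,k\in\{1,2,3\}$, repeated indices are summed, and $\varepsilon_{ijk}$ is the totally antisymmetric tensor with $\varepsilon_{123}=1$. Factors of $\sqrt{-1}$ and unitarity issues are systematically ignored; all computations are formal. **Double twisted torus.** $G=\mathbb{R}^6$ with coordinates $(x^i,x^*_i)$ and group law $(x^i,x^*_i)\cdot(y^i,y^*_i)=(x^i+y^i,\;x^*_i+y^*_i+\tfrac12\varepsilon_{ijk}x^jy^k)$; $\Gamma\subset G$ is the cocompact lattice generated by the standard basis vectors; $Y=\Gamma\backslash G$. The coordinates $x^i,x^*_i$ are regarded as functions on a fixed bounded fundamental domain $D$ for $\Gamma\backslash G$, so $L^2(Y)=L^2(D)$, and for $w\in\mathbb{Z}^3$ the function $e^w=\exp(\sum_j w^jx^*_j)$ on $D$ is an element of $L^2(Y)$ (it need not be continuous on $Y$). Differential operators act on such functions formally, by differentiating the expression on the interior of $D$. **Lie algebra.** $\mathfrak L$ is the Lie algebra with generators $\hbar$ (central), $W^i,P_i,x^i_n,x^*_{i,n}$ ($n\in\mathbb{Z}$) and nonzero brackets - $[P_i,x^j_0]=[W^j,x^*_{i,0}]=\delta_i^j\hbar$; - $[x^*_{i,n},x^j_m]=\tfrac1m\delta_i^j\delta_{m,-n}\hbar$ for $m\ne0$; - $[P_i,P_j]=-\varepsilon_{ijk}W^k$; - $[P_i,x^*_{j,n}]=-\tfrac12\varepsilon_{ijk}x^k_n$ for all $n$; - $[x^*_{i,m},x^*_{j,n}]=\tfrac{m+n}{2mn}\varepsilon_{ijk}x^k_{m+n}+\tfrac1{m^2}\varepsilon_{ijk}W^k\delta_{m,-n}$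 for $m,n\neq0$; - $[x^*_{i,m},x^*_{j,0}]=\tfrac1{2m}\varepsilon_{ijk}x^k_m$ for $m\ne0$; all other brackets of generators vanish. It is $\mathbb{Z}$-graded with $x^i_n,x^*_{i,n}$ in degree $n$ and $\hbar,P_i,W^i$ in degree $0$, so $\mathfrak L=\mathfrak L_-\oplus\mathfrak L_0\oplus\mathfrak L_+$. **Module.** $\mathfrak L_0$ acts on functions on $D$ by $\hbar=1$, multiplication by $x^i_0=x^i$ and $x^*_{i,0}=x^*_i$, and $P_i=\partial_{x^i}+\tfrac12\varepsilon_{ijk}x^j\partial_{x^*_k}$, $W^i=\partial_{x^*_i}$. Let $\mathfrak L_+$ act by $0$ on functions and let $\mathcal H$ be the $\mathfrak L$-module induced from $\mathfrak L_0\oplus\mathfrak L_+$ (suitably completed). Functions are the degree-zero (vacuum) vectors $|f\rangle$. For $\psi\in L^2(Y)$, $\langle\psi|$ is the functional on $\mathcal H$ given by projecting to the degree-zero subspace of functions (so it annihilates the image of creation operators, i.e. negative modes) followed by the $L^2$ pairing with $\psi$; in particular $\langle\psi|f\rangle$ is the $L^2$ pairing. **Vertex operators.** Put $Q_i=P_i-\tfrac12\varepsilon_{ijk}x^j_0W^k$ (acting on functions as $\partial_{x^i}$), $$x^i(z)_\pm=\sum_{n\gtrless0}x^i_nz^{-n},\qquad x^*_i(z)_\pm=\sum_{n\gtrless0}x^*_{i,n}z^{-n}+\tfrac{\log z}{2}\varepsilon_{ijk}W^jx^k(z)_\pm .$$ For $w=(w^1,w^2,w^3)$ set $\alpha(z)_\pm=w^ix^*_i(z)_\pm$,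 $\alpha_0=w^ix^*_{i,0}$, $\alpha_l=w^iQ_i$, and $$e^{w}(z)=e^{\alpha_0}\,z^{\alpha_l}\,\exp(\alpha(z)_-)\,\exp(\alpha(z)_+),\qquad z^{\alpha_l}=\exp(\log(z)\,\alpha_l).$$ Here $z,w$ (as arguments) are formal variables, and correlators are formal series in them and their logarithms. **Dilogarithm and volumes.** $\mathrm{Li}_2(x)=\sum_{n>0}x^n/n^2$ and $L(x)=\mathrm{Li}_2(x)+\tfrac12\log(x)\log(1-x)$. In the expansion $i_{z,w}$ one uses $\log(w/z)=\log w-\log z$ and power series in $w/z$. $\mathbb{H}_3$ is hyperbolic 3-space with boundary $\mathbb{CP}^1$; an ideal tetrahedron is a geodesic tetrahedron with vertices on the boundary. "Volume" of an ideal tetrahedron is used for the full complex dilogarithm (whose imaginary part is the geometric source of the name), and "volume" of a Euclidean tetrahedron is the oriented one, normalized as $\det(w_1,w_2,w_3)=\varepsilon_{ijk}w_1^iw_2^jw_3^k$. *)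

theory Defs
  imports
    "HOL-Analysis.Analysis"
    "HOL-Computational_Algebra.Formal_Power_Series"
    "HOL-Library.Poly_Mapping"
    "HOL-Library.Function_Algebras"
    "HOL-Library.Groups_Big_Fun"
begin

definition eps :: "3 \<Rightarrow> 3 \<Rightarrow> 3 \<Rightarrow> 'a::ring_1" where
  "eps i j k =
     (if (i, j, k) \<in> {(1, 2, 3), (2, 3, 1), (3, 1, 2)} then 1
      else if (i, j, k) \<in> {(2, 1, 3), (1, 3, 2), (3, 2, 1)} then - 1
      else 0)"


section \<open>The double twisted torus\<close>

text \<open>A point of \<open>G\<close> is the pair of its coordinate vectors \<open>(x\<^sup>i)\<close> and \<open>(x\<^sup>*\<^sub>i)\<close>.\<close>

type_synonym pt = "(real ^ 3) \<times> (real ^ 3)"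

definition gmult :: "pt \<Rightarrow> pt \<Rightarrow> pt" where
  "gmult p q = (fst p + fst q,
     snd p + snd q + (\<chi> i. (1/2) * (\<Sum>j\<in>UNIV. \<Sum>k\<in>UNIV. eps i j k * fst p $ j * fst q $ k)))"

text \<open>The unit of \<open>G\<close> is \<open>0\<close>, and the inverse of \<open>p\<close> is \<open>- p\<close> because \<open>eps\<close> is antisymmetric.\<close>

inductive_set Gam :: "pt set" where
  unit: "0 \<in> Gam"
| basis: "b \<in> Basis \<Longrightarrow> b \<in> Gam"
| mult: "p \<in> Gam \<Longrightarrow> q \<in> Gam \<Longrightarrow> gmult p q \<in> Gam"
| inv: "p \<in> Gam \<Longrightarrow> - p \<in> Gam"

text \<open>
  Open, half-open and closed fundamental domains are all admitted, so the covering and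
  disjointness conditions are imposed up to null sets. The null boundary ensures that a function
  given on the interior determines an element of \<open>L\<^sup>2(D)\<close>.
\<close>

definition fundamental_domain :: "pt set \<Rightarrow> bool" where
  "fundamental_domain D \<longleftrightarrow>
     bounded D \<and> D \<in> sets lebesgue \<and> negligible (frontier D) \<and>
     negligible (- (\<Union>\<gamma>\<in>Gam. gmult \<gamma> ` D)) \<and>
     (\<forall>\<gamma>\<in>Gam. \<gamma> \<noteq> 0 \<longrightarrow> negligible (D \<inter> gmult \<gamma> ` D))"

definition L2 :: "pt set \<Rightarrow> (pt \<Rightarrow> complex) set" where
  "L2 D = {\<psi>. set_borel_measurable lebesgue D \<psi> \<and>
               set_integrable lebesgue D (\<lambda>p. (norm (\<psi> p))\<^sup>2)}"

definition l2_pairing :: "pt set \<Rightarrow> (pt \<Rightarrow> complex) \<Rightarrow> (pt \<Rightarrow> complex) \<Rightarrow> complex" where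
  "l2_pairing D \<psi> f = (LINT p:D|lebesgue. cnj (\<psi> p) * f p)"


section \<open>Functions on the fundamental domain\<close>

text \<open>
  A function on \<open>D\<close> is represented by its values on the interior of \<open>D\<close>, extended by \<open>0\<close>.
\<close>

definition pderiv_on :: "pt set \<Rightarrow> pt \<Rightarrow> (pt \<Rightarrow> complex) \<Rightarrow> pt \<Rightarrow> complex" where
  "pderiv_on D b f p = (if p \<in> interior D then frechet_derivative f (at p) b else 0)"

primrec bounded_Ck :: "pt set \<Rightarrow> nat \<Rightarrow> (pt \<Rightarrow> complex) \<Rightarrow> bool" where
  "bounded_Ck D 0 f \<longleftrightarrow> bounded (f ` interior D) \<and> continuous_on (interior D) f"
| "bounded_Ck D (Suc n) f \<longleftrightarrow> bounded (f ` interior D) \<and> f differentiable_on interior D \<and>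
     (\<forall>b\<in>Basis. bounded_Ck D n (pderiv_on D b f))"

text \<open>
  Smooth functions with bounded derivatives of every order: since \<open>D\<close> is bounded they lie
  in \<open>L\<^sup>2(D)\<close>, and they are stable under the coordinates, the partial derivatives and the
  exponentials \<open>e\<^sup>w\<close>.
\<close>

definition Fun :: "pt set \<Rightarrow> (pt \<Rightarrow> complex) set" where
  "Fun D = {f. (\<forall>p. p \<notin> interior D \<longrightarrow> f p = 0) \<and> (\<forall>n. bounded_Ck D n f)}"

definition exp_fun :: "pt set \<Rightarrow> int ^ 3 \<Rightarrow> pt \<Rightarrow> complex" where
  "exp_fun D w p =
     (if p \<in> interior D then exp (of_real (\<Sum>j\<in>UNIV. of_int (w $ j) * snd p $ j)) else 0)"


section \<open>The Lie algebra\<close>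

text \<open>\<open>X n i\<close> stands for \<open>x\<^sup>i\<^sub>n\<close> and \<open>Xs n i\<close> for \<open>x\<^sup>*\<^sub>i\<^sub>,\<^sub>n\<close>.\<close>

datatype gen = Hbar | W 3 | P 3 | X int 3 | Xs int 3

text \<open>
  The Lie algebra has underlying space \<open>gen \<Rightarrow>\<^sub>0 complex\<close>; \<open>bracket\<close> is its bracket on basis
  elements, with the antisymmetric counterparts of the brackets written out.
\<close>

fun bracket :: "gen \<Rightarrow> gen \<Rightarrow> gen \<Rightarrow>\<^sub>0 complex" where
  "bracket (P i) (X n j) = (if n = 0 \<and> i = j then Poly_Mapping.single Hbar 1 else 0)"
| "bracket (X n j) (P i) = (if n = 0 \<and> i = j then Poly_Mapping.single Hbar (- 1) else 0)"
| "bracket (W j) (Xs n i) = (if n = 0 \<and> i = j then Poly_Mapping.single Hbar 1 else 0)"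
| "bracket (Xs n i) (W j) = (if n = 0 \<and> i = j then Poly_Mapping.single Hbar (- 1) else 0)"
| "bracket (Xs n i) (X m j) =
     (if m \<noteq> 0 \<and> m = - n \<and> i = j then Poly_Mapping.single Hbar (1 / of_int m) else 0)"
| "bracket (X m j) (Xs n i) =
     (if m \<noteq> 0 \<and> m = - n \<and> i = j then Poly_Mapping.single Hbar (- (1 / of_int m)) else 0)"
| "bracket (P i) (P j) = (\<Sum>k\<in>UNIV. Poly_Mapping.single (W k) (- eps i j k))"
| "bracket (P i) (Xs n j) = (\<Sum>k\<in>UNIV. Poly_Mapping.single (X n k) (- (1/2) * eps i j k))"
| "bracket (Xs n j) (P i) = (\<Sum>k\<in>UNIV. Poly_Mapping.single (X n k) ((1/2) * eps i j k))"
| "bracket (Xs m i) (Xs n j) =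
     (if m \<noteq> 0 \<and> n \<noteq> 0 then
        (\<Sum>k\<in>UNIV. Poly_Mapping.single (X (m + n) k)
           (of_int (m + n) / (2 * of_int m * of_int n) * eps i j k)) +
        (if m = - n then \<Sum>k\<in>UNIV. Poly_Mapping.single (W k) (1 / (of_int m)\<^sup>2 * eps i j k) else 0)
      else if m \<noteq> 0 then
        (\<Sum>k\<in>UNIV. Poly_Mapping.single (X m k) (1 / (2 * of_int m) * eps i j k))
      else if n \<noteq> 0 then
        (\<Sum>k\<in>UNIV. Poly_Mapping.single (X n k) (- (1 / (2 * of_int n)) * eps j i k))
      else 0)"
| "bracket _ _ = 0"

fun deg :: "gen \<Rightarrow> int" where
  "deg (X n i) = n"
| "deg (Xs n i) = n"
| "deg _ = 0"

text \<open>Action of the generators of degree \<open>\<ge> 0\<close> on functions; the clauses with \<open>n < 0\<close> are unused.\<close>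

fun fun_act :: "pt set \<Rightarrow> gen \<Rightarrow> (pt \<Rightarrow> complex) \<Rightarrow> pt \<Rightarrow> complex" where
  "fun_act D Hbar f = f"
| "fun_act D (W i) f = pderiv_on D (0, axis i 1) f"
| "fun_act D (P i) f = (\<lambda>p. pderiv_on D (axis i 1, 0) f p +
     (1/2) * (\<Sum>j\<in>UNIV. \<Sum>k\<in>UNIV. eps i j k * of_real (fst p $ j) * pderiv_on D (0, axis k 1) f p))"
| "fun_act D (X n i) f = (if n = 0 then (\<lambda>p. of_real (fst p $ i) * f p) else 0)"
| "fun_act D (Xs n i) f = (if n = 0 then (\<lambda>p. of_real (snd p $ i) * f p) else 0)"


section \<open>The induced module\<close>

text \<open>
  \<open>Tens D\<close> is the tensor product of the tensor algebra of the Lie algebra with \<open>Fun D\<close>, where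
  \<open>Poly_Mapping.single u f\<close> is the word \<open>u\<close> tensored with \<open>f\<close>. The first family of relations
  passes to the enveloping algebra, the second one tensors over the enveloping algebra of the
  part of degree \<open>\<ge> 0\<close>. Both families are stable under scalars, so that the additive
  subgroup they generate is a complex subspace.
\<close>

definition Tens :: "pt set \<Rightarrow> (gen list \<Rightarrow>\<^sub>0 (pt \<Rightarrow> complex)) set" where
  "Tens D = {t. \<forall>u. Poly_Mapping.lookup t u \<in> Fun D}"

inductive_set Rels :: "pt set \<Rightarrow> (gen list \<Rightarrow>\<^sub>0 (pt \<Rightarrow> complex)) set" for D :: "pt set" where
  comm: "f \<in> Fun D \<Longrightarrow>
     Poly_Mapping.single (u @ [g, h] @ v) f - Poly_Mapping.single (u @ [h, g] @ v) f
     - (\<Sum>k\<in>Poly_Mapping.keys (bracket g h).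
          Poly_Mapping.single (u @ [k] @ v) (\<lambda>p. Poly_Mapping.lookup (bracket g h) k * f p))
     \<in> Rels D"
| induce: "f \<in> Fun D \<Longrightarrow> deg g \<ge> 0 \<Longrightarrow>
     Poly_Mapping.single (u @ [g]) f - Poly_Mapping.single u (fun_act D g f) \<in> Rels D"
| zero: "0 \<in> Rels D"
| diff: "s \<in> Rels D \<Longrightarrow> t \<in> Rels D \<Longrightarrow> s - t \<in> Rels D"

definition mod_rel ::
  "pt set \<Rightarrow> ((gen list \<Rightarrow>\<^sub>0 (pt \<Rightarrow> complex)) \<times> (gen list \<Rightarrow>\<^sub>0 (pt \<Rightarrow> complex))) set" where
  "mod_rel D = {(s, t). s \<in> Tens D \<and> t \<in> Tens D \<and> s - t \<in> Rels D}"

type_synonym hvec = "(gen list \<Rightarrow>\<^sub>0 (pt \<Rightarrow> complex)) set"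

definition Hmod :: "pt set \<Rightarrow> hvec set" where
  "Hmod D = Tens D // mod_rel D"

definition vac :: "pt set \<Rightarrow> (pt \<Rightarrow> complex) \<Rightarrow> hvec" where
  "vac D f = mod_rel D `` {Poly_Mapping.single [] f}"

definition prepend ::
  "gen \<Rightarrow> (gen list \<Rightarrow>\<^sub>0 (pt \<Rightarrow> complex)) \<Rightarrow> (gen list \<Rightarrow>\<^sub>0 (pt \<Rightarrow> complex))" where
  "prepend g t =
     (\<Sum>u\<in>Poly_Mapping.keys t. Poly_Mapping.single (g # u) (Poly_Mapping.lookup t u))"

definition act :: "pt set \<Rightarrow> gen \<Rightarrow> hvec \<Rightarrow> hvec" where
  "act D g v = (\<Union>t\<in>v. mod_rel D `` {prepend g t})"

definition degree_zero_part ::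
  "(gen list \<Rightarrow>\<^sub>0 (pt \<Rightarrow> complex)) \<Rightarrow> (gen list \<Rightarrow>\<^sub>0 (pt \<Rightarrow> complex))" where
  "degree_zero_part t =
     (\<Sum>u\<in>{u \<in> Poly_Mapping.keys t. sum_list (map deg u) = 0}.
        Poly_Mapping.single u (Poly_Mapping.lookup t u))"

text \<open>
  The degree-zero subspace of the module is the space of vacuum vectors \<open>vac D f\<close>; the projection
  returns the function \<open>f\<close>.
\<close>

definition vac_proj :: "pt set \<Rightarrow> hvec \<Rightarrow> pt \<Rightarrow> complex" where
  "vac_proj D v =
     (THE f. f \<in> Fun D \<and> vac D f = (\<Union>t\<in>v. mod_rel D `` {degree_zero_part t}))"

definition bra :: "pt set \<Rightarrow> (pt \<Rightarrow> complex) \<Rightarrow> hvec \<Rightarrow> complex" where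
  "bra D \<psi> v = l2_pairing D \<psi> (vac_proj D v)"


section \<open>Operator-valued formal series\<close>

text \<open>
  Exponents \<open>(a, b, c, d)\<close> stand for \<open>z\<^sup>a (log z)\<^sup>b w\<^sup>c (log w)\<^sup>d\<close>. The scalars are the Laurent
  polynomials in \<open>z\<close>, \<open>w\<close> with polynomial dependence on the logarithms.
\<close>

type_synonym expo = "int \<times> nat \<times> int \<times> nat"
type_synonym scal = "expo \<Rightarrow>\<^sub>0 complex"

definition const :: "complex \<Rightarrow> scal" where "const c = Poly_Mapping.single 0 c"
definition z_pow :: "int \<Rightarrow> scal" where "z_pow n = Poly_Mapping.single (n, 0, 0, 0) 1"
definition log_z :: scal where "log_z = Poly_Mapping.single (0, 1, 0, 0) 1"
definition w_pow :: "int \<Rightarrow> scal" where "w_pow n = Poly_Mapping.single (0, 0, n, 0) 1"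
definition log_w :: scal where "log_w = Poly_Mapping.single (0, 0, 0, 1) 1"

text \<open>
  Operators on the module are possibly infinite combinations of words in the generators, with
  coefficients in \<open>scal\<close>. Addition is pointwise, multiplication is concatenation of words.
\<close>

type_synonym ops = "gen list \<Rightarrow> scal"

definition op_gen :: "gen \<Rightarrow> ops" where
  "op_gen g = (\<lambda>u. if u = [g] then 1 else 0)"

definition op_scale :: "scal \<Rightarrow> ops \<Rightarrow> ops" (infixr "\<cdot>\<^sub>o" 75) where
  "c \<cdot>\<^sub>o A = (\<lambda>u. c * A u)"

definition op_mult :: "ops \<Rightarrow> ops \<Rightarrow> ops" (infixl "\<star>" 70) where
  "A \<star> B = (\<lambda>u. \<Sum>k\<le>length u. A (take k u) * B (drop k u))"

primrec op_power :: "ops \<Rightarrow> nat \<Rightarrow> ops" where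
  "op_power A 0 = (\<lambda>u. if u = [] then 1 else 0)"
| "op_power A (Suc n) = A \<star> op_power A n"

text \<open>Partial sum of the exponential series; the limit is taken in \<open>correlator\<close> below.\<close>

definition op_exp :: "nat \<Rightarrow> ops \<Rightarrow> ops" where
  "op_exp N A = (\<Sum>n\<le>N. const (1 / fact n) \<cdot>\<^sub>o op_power A n)"

text \<open>
  The mode sums run over a set \<open>S\<close> of mode numbers. The argument \<open>zp\<close> sends \<open>n\<close> to the \<open>n\<close>-th power
  of the formal variable and \<open>lg\<close> is the logarithm of that variable. For each word at most one
  summand of a mode sum is nonzero.
\<close>

definition x_modes :: "int set \<Rightarrow> (int \<Rightarrow> scal) \<Rightarrow> 3 \<Rightarrow> ops" where
  "x_modes S zp k = (\<lambda>u. Sum_any (\<lambda>n. if n \<in> S then zp (- n) * op_gen (X n k) u else 0))"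

definition xs_modes :: "int set \<Rightarrow> (int \<Rightarrow> scal) \<Rightarrow> scal \<Rightarrow> 3 \<Rightarrow> ops" where
  "xs_modes S zp lg i =
     (\<lambda>u. Sum_any (\<lambda>n. if n \<in> S then zp (- n) * op_gen (Xs n i) u else 0)) +
     (const (1/2) * lg) \<cdot>\<^sub>o
       (\<Sum>j\<in>UNIV. \<Sum>k\<in>UNIV. const (eps i j k) \<cdot>\<^sub>o (op_gen (W j) \<star> x_modes S zp k))"

definition Q_op :: "3 \<Rightarrow> ops" where
  "Q_op i = op_gen (P i) -
     const (1/2) \<cdot>\<^sub>o
       (\<Sum>j\<in>UNIV. \<Sum>k\<in>UNIV. const (eps i j k) \<cdot>\<^sub>o (op_gen (X 0 j) \<star> op_gen (W k)))"

definition lin_comb :: "int ^ 3 \<Rightarrow> (3 \<Rightarrow> ops) \<Rightarrow> ops" where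
  "lin_comb w A = (\<Sum>i\<in>UNIV. const (of_int (w $ i)) \<cdot>\<^sub>o A i)"

definition vertex_op :: "nat \<Rightarrow> int ^ 3 \<Rightarrow> (int \<Rightarrow> scal) \<Rightarrow> scal \<Rightarrow> ops" where
  "vertex_op N w zp lg =
     op_exp N (lin_comb w (\<lambda>i. op_gen (Xs 0 i))) \<star>
     op_exp N (lg \<cdot>\<^sub>o lin_comb w Q_op) \<star>
     op_exp N (lin_comb w (xs_modes {..<0} zp lg)) \<star>
     op_exp N (lin_comb w (xs_modes {0<..} zp lg))"

text \<open>
  For a sequence \<open>A\<close> of truncated operators, \<open>correlator D \<psi> A f e\<close> is the coefficient at \<open>e\<close> of
  \<open>\<langle>\<psi>|A|f\<rangle>\<close>: at each truncation order a sum over words with finitely many nonzero terms, then the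
  limit in the order. The limit is a genuine one because of the factors \<open>exp(\<alpha>\<^sub>0)\<close>, which
  carry no formal variable.
\<close>

definition word_elem ::
  "pt set \<Rightarrow> (pt \<Rightarrow> complex) \<Rightarrow> gen list \<Rightarrow> (pt \<Rightarrow> complex) \<Rightarrow> complex" where
  "word_elem D \<psi> u f = bra D \<psi> (foldr (act D) u (vac D f))"

definition matrix_elem ::
  "pt set \<Rightarrow> (pt \<Rightarrow> complex) \<Rightarrow> ops \<Rightarrow> (pt \<Rightarrow> complex) \<Rightarrow> expo \<Rightarrow> complex" where
  "matrix_elem D \<psi> A f e = Sum_any (\<lambda>u. Poly_Mapping.lookup (A u) e * word_elem D \<psi> u f)"

definition correlator_converges ::
  "pt set \<Rightarrow> (pt \<Rightarrow> complex) \<Rightarrow> (nat \<Rightarrow> ops) \<Rightarrow> (pt \<Rightarrow> complex) \<Rightarrow> bool" where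
  "correlator_converges D \<psi> A f \<longleftrightarrow>
     (\<forall>N e. finite {u. Poly_Mapping.lookup (A N u) e * word_elem D \<psi> u f \<noteq> 0}) \<and>
     (\<forall>e. convergent (\<lambda>N. matrix_elem D \<psi> (A N) f e))"

definition correlator ::
  "pt set \<Rightarrow> (pt \<Rightarrow> complex) \<Rightarrow> (nat \<Rightarrow> ops) \<Rightarrow> (pt \<Rightarrow> complex) \<Rightarrow> expo \<Rightarrow> complex" where
  "correlator D \<psi> A f e = lim (\<lambda>N. matrix_elem D \<psi> (A N) f e)"


section \<open>Volumes\<close>

definition vol_E :: "int ^ 3 \<Rightarrow> int ^ 3 \<Rightarrow> int ^ 3 \<Rightarrow> int" where
  "vol_E w1 w2 w3 = det (vector [w1, w2, w3] :: int ^ 3 ^ 3)"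

text \<open>
  Formal power series in \<open>w/z\<close> whose coefficients are polynomials in \<open>log z\<close> and \<open>log w\<close>, with
  exponents in this order.
\<close>

type_synonym log_poly = "(nat \<times> nat) \<Rightarrow>\<^sub>0 complex"

definition log_const :: "complex \<Rightarrow> log_poly" where "log_const c = Poly_Mapping.single 0 c"

definition lift_fps :: "complex fps \<Rightarrow> log_poly fps" where
  "lift_fps F = Abs_fps (\<lambda>n. log_const (fps_nth F n))"

text \<open>The coefficients at \<open>0\<close> of the next two series vanish since \<open>1 / 0 = 0\<close>.\<close>

definition Li2 :: "complex fps" where
  "Li2 = Abs_fps (\<lambda>n. 1 / (of_nat n)\<^sup>2)"

definition log_one_minus :: "complex fps" where
  "log_one_minus = Abs_fps (\<lambda>n. - (1 / of_nat n))"

definition log_ratio :: log_poly where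
  "log_ratio = Poly_Mapping.single (0, 1) 1 - Poly_Mapping.single (1, 0) 1"

text \<open>Rogers' dilogarithm \<open>L(w/z)\<close>, with \<open>log_ratio\<close> for \<open>log (w/z)\<close>.\<close>

definition vol_H :: "log_poly fps" where
  "vol_H = lift_fps Li2 + fps_const (log_const (1/2) * log_ratio) * lift_fps log_one_minus"

text \<open>Exponential of a power series without constant term.\<close>

definition series_exp :: "log_poly fps \<Rightarrow> log_poly fps" where
  "series_exp G = Abs_fps (\<lambda>n. \<Sum>k\<le>n. log_const (1 / fact k) * fps_nth (G ^ k) n)"

definition i_zw :: "log_poly fps \<Rightarrow> expo \<Rightarrow> complex" where
  "i_zw G = (\<lambda>(a, b, c, d).
     if 0 \<le> c \<and> a = - c then Poly_Mapping.lookup (fps_nth G (nat c)) (b, d) else 0)"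

end

theory Submission
  imports Defs
begin

text \<open>
  The vacuum component of a word of generators applied to \<open>|f\<rangle>\<close> obeys a recursion: it vanishes if the word
  starts with a creation operator, a leading zero mode acts on functions, and a leading annihilation
  operator can be replaced by its adjoint action on the rest of the word. By the Jacobi identity the
  solution of this recursion is compatible with the relations of the induced module, so that no
  Poincare-Birkhoff-Witt theorem is needed to compute the projection to the vacuum vectors.

  Let \<open>c = w\<^sub>1 \<times> w\<^sub>2\<close>. Modulo the relations, the commutator of the annihilation part of \<open>e\<^sup>w\<^sup>1(z)\<close> with the
  creation part of \<open>e\<^sup>w\<^sup>2(w)\<close> is a combination of \<open>c \<cdot> W\<close> and of the modes \<open>c \<cdot> x\<^sub>n\<close>. As \<open>c\<close> is orthogonal
  to \<open>w\<^sub>1\<close> and \<open>w\<^sub>2\<close>, these modes commute with both vertex operators and drop out, while \<open>c \<cdot> W\<close> acts on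
  \<open>e\<^sup>w\<^sup>3\<close> by the determinant; its coefficient is the expansion of \<open>L(w/z)\<close>. The zero modes only
  contribute the factors \<open>e\<^sup>w\<^sup>1\<close> and \<open>e\<^sup>w\<^sup>2\<close>, because the result does not depend on the \<open>x\<close> coordinates.
  The coefficient of a fixed monomial involves finitely many modes and, up to the powers of
  \<open>\<alpha>\<^sub>0\<close>, finitely many terms of the exponential series.
\<close>

section \<open>Functions on the fundamental domain\<close>

text \<open>\<open>vac_proj\<close> is defined by \<open>THE\<close>, so the projection needs both
  existence and uniqueness of the vacuum component. Existence is rewriting: letters of positive
  degree are moved to the end of a word, at the cost of shorter words. Uniqueness needs a map that
  vanishes on \<open>Rels\<close>; \<open>phi\<close> extends linearly to such a map, and checking
  the relations consumes the Jacobi identity and the representation property of the zero modes, the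
  latter through the symmetry of second derivatives.

  After that no quotient is formed: identities of operators are statements in the tensor algebra
  modulo the largest ideal on which the vacuum expectation vanishes.

  The dilogarithm is the diagonal of a double mode sum. The modes \<open>m\<close> and
  \<open>- m\<close> contribute \<open>1/m^2\<close> from the bracket of the \<open>x^*\<close>
  modes, which sums to \<open>Li2\<close>, and \<open>(log z - log w) / (2 m)\<close> from the
  logarithmic terms of the two fields, which sums to \<open>1/2 log (w/z) log (1 - w/z)\<close>. Off
  the diagonal only modes of \<open>x\<close> of nonzero degree occur, so each can be moved to one
  end of the product, where it vanishes.\<close>

lemma second_difference_eq_mixed_partial:
  fixes f :: "'a::real_normed_vector \<Rightarrow> real"
  assumes h: "h > 0"
    and sub: "\<And>s t. 0 \<le> s \<Longrightarrow> s \<le> h \<Longrightarrow> 0 \<le> t \<Longrightarrow> t \<le> h \<Longrightarrow> p + s *\<^sub>R a + t *\<^sub>R b \<in> S"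
    and f: "\<And>x. x \<in> S \<Longrightarrow> (f has_derivative f' x) (at x)"
    and fa: "\<And>x. x \<in> S \<Longrightarrow> ((\<lambda>x. f' x a) has_derivative fa x) (at x)"
  obtains s t where "0 \<le> s" "s \<le> h" "0 \<le> t" "t \<le> h"
    "f (p + h *\<^sub>R a + h *\<^sub>R b) - f (p + h *\<^sub>R a) - f (p + h *\<^sub>R b) + f p =
     h * h * fa (p + s *\<^sub>R a + t *\<^sub>R b) b"
proof -
  define g where "g s = f (p + s *\<^sub>R a + h *\<^sub>R b) - f (p + s *\<^sub>R a)" for s
  have der: "((\<lambda>s. f (p + s *\<^sub>R a + t *\<^sub>R b)) has_real_derivative
      f' (p + s *\<^sub>R a + t *\<^sub>R b) a) (at s)" if "0 \<le> s" "s \<le> h" "0 \<le> t" "t \<le> h" for s t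
  proof -
    have "((\<lambda>s. p + s *\<^sub>R a + t *\<^sub>R b) has_derivative (\<lambda>x. x *\<^sub>R a)) (at s)"
      by (auto intro!: derivative_eq_intros)
    from has_derivative_compose[OF this f[OF sub[OF that]]]
    have "((\<lambda>s. f (p + s *\<^sub>R a + t *\<^sub>R b)) has_derivative
      (\<lambda>x. f' (p + s *\<^sub>R a + t *\<^sub>R b) (x *\<^sub>R a))) (at s)" .
    moreover have "linear (f' (p + s *\<^sub>R a + t *\<^sub>R b))"
      using f[OF sub[OF that]] has_derivative_linear by blast
    ultimately show ?thesis
      unfolding has_field_derivative_def
      by (auto elim!: has_derivative_eq_rhs simp: linear_cmul mult.commute)
  qed
  have "\<exists>z>0. z < h \<and> g h - g 0 = (h - 0) *
      (f' (p + z *\<^sub>R a + h *\<^sub>R b) a - f' (p + z *\<^sub>R a) a)"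
  proof (rule MVT2)
    show "(g has_real_derivative (f' (p + x *\<^sub>R a + h *\<^sub>R b) a - f' (p + x *\<^sub>R a) a)) (at x)"
      if "0 \<le> x" "x \<le> h" for x
      unfolding g_def using der[OF that, of h] der[OF that, of 0] h
      by (auto intro!: derivative_eq_intros)
  qed (use h in auto)
  then obtain s where s: "0 < s" "s < h"
    and gs: "g h - g 0 = h * (f' (p + s *\<^sub>R a + h *\<^sub>R b) a - f' (p + s *\<^sub>R a) a)" by auto
  have "\<exists>z>0. z < h \<and> f' (p + s *\<^sub>R a + h *\<^sub>R b) a - f' (p + s *\<^sub>R a + 0 *\<^sub>R b) a = (h - 0) *
      fa (p + s *\<^sub>R a + z *\<^sub>R b) b"
  proof (rule MVT2)
    fix t assume t: "0 \<le> t" "t \<le> h"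
    have "((\<lambda>t. p + s *\<^sub>R a + t *\<^sub>R b) has_derivative (\<lambda>x. x *\<^sub>R b)) (at t)"
      by (auto intro!: derivative_eq_intros)
    from has_derivative_compose[OF this fa[OF sub]] s t
    have "((\<lambda>t. f' (p + s *\<^sub>R a + t *\<^sub>R b) a) has_derivative
      (\<lambda>x. fa (p + s *\<^sub>R a + t *\<^sub>R b) (x *\<^sub>R b))) (at t)" by auto
    moreover have "linear (fa (p + s *\<^sub>R a + t *\<^sub>R b))"
      using has_derivative_linear[OF fa[OF sub]] s t by simp
    ultimately show "((\<lambda>t. f' (p + s *\<^sub>R a + t *\<^sub>R b) a) has_real_derivative
      fa (p + s *\<^sub>R a + t *\<^sub>R b) b) (at t)"
      unfolding has_field_derivative_def
      by (auto elim!: has_derivative_eq_rhs simp: linear_cmul mult.commute)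
  qed (use h in auto)
  then obtain t where t: "0 < t" "t < h" and "f' (p + s *\<^sub>R a + h *\<^sub>R b) a - f' (p + s *\<^sub>R a) a
     = h * fa (p + s *\<^sub>R a + t *\<^sub>R b) b" by auto
  with gs have "g h - g 0 = h * h * fa (p + s *\<^sub>R a + t *\<^sub>R b) b" by simp
  then show thesis using that[of s t] s t by (simp add: g_def)
qed

text \<open>The second difference over a small parallelogram with sides \<open>h a\<close> and
  \<open>h b\<close> is symmetric in \<open>a\<close> and \<open>b\<close>, and two applications of
  the mean value theorem evaluate it in either order. So both mixed partials take a common value
  near \<open>p\<close>, at possibly different points, and continuity carries this to
  \<open>p\<close>.\<close>

lemma mixed_partials_commute_real:
  fixes f :: "'a::real_normed_vector \<Rightarrow> real"
  assumes S: "open S" "p \<in> S"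
    and f: "\<And>x. x \<in> S \<Longrightarrow> (f has_derivative f' x) (at x)"
    and fa: "\<And>x. x \<in> S \<Longrightarrow> ((\<lambda>x. f' x a) has_derivative fa x) (at x)"
    and fb: "\<And>x. x \<in> S \<Longrightarrow> ((\<lambda>x. f' x b) has_derivative fb x) (at x)"
    and cont: "continuous_on S (\<lambda>x. fa x b)" "continuous_on S (\<lambda>x. fb x a)"
  shows "fa p b = fb p a"
proof (rule ccontr)
  assume "fa p b \<noteq> fb p a"
  define e where "e = \<bar>fa p b - fb p a\<bar> / 2"
  have e: "e > 0" using \<open>fa p b \<noteq> fb p a\<close> by (simp add: e_def)
  have "isCont (\<lambda>x. fa x b) p" "isCont (\<lambda>x. fb x a) p"
    using cont S by (auto simp: continuous_on_eq_continuous_at)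
  then have "\<exists>d>0. \<forall>x. dist x p < d \<longrightarrow> dist (fa x b) (fa p b) < e"
    "\<exists>d>0. \<forall>x. dist x p < d \<longrightarrow> dist (fb x a) (fb p a) < e"
    using e unfolding continuous_at_eps_delta by blast+
  then obtain d1 d2 where d1: "d1 > 0" "\<And>x. dist x p < d1 \<Longrightarrow> dist (fa x b) (fa p b) < e"
    and d2: "d2 > 0" "\<And>x. dist x p < d2 \<Longrightarrow> dist (fb x a) (fb p a) < e"
    by blast
  obtain d3 where d3: "d3 > 0" "ball p d3 \<subseteq> S" using S openE by blast
  define d where "d = min d1 (min d2 d3)"
  have d: "d > 0" using d1 d2 d3 by (simp add: d_def)
  have m: "norm a + norm b + 1 > 0" by (intro add_nonneg_pos add_nonneg_nonneg) auto
  \<comment> \<open>With this \<open>h\<close> the whole parallelogram lies within distance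
    \<open>d\<close> of \<open>p\<close>.\<close>
  define h where "h = d / (norm a + norm b + 1)"
  have h: "h > 0" using d m by (simp add: h_def)
  have hd: "dist (p + s *\<^sub>R a + t *\<^sub>R b) p < d"
    if "0 \<le> s" "s \<le> h" "0 \<le> t" "t \<le> h" for s t
  proof -
    have "dist (p + s *\<^sub>R a + t *\<^sub>R b) p = norm (s *\<^sub>R a + t *\<^sub>R b)" by (simp add: dist_norm)
    also have "\<dots> \<le> s * norm a + t * norm b"
      by (rule norm_triangle_le) (use that in simp)
    also have "\<dots> \<le> h * norm a + h * norm b"
      using that by (intro add_mono mult_right_mono) auto
    also have "\<dots> < h * (norm a + norm b + 1)" using h by (simp add: algebra_simps)
    also have "\<dots> = d" using m by (simp add: h_def)
    finally show ?thesis .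
  qed
  have sub: "p + s *\<^sub>R a + t *\<^sub>R b \<in> S" if "0 \<le> s" "s \<le> h" "0 \<le> t" "t \<le> h" for s t
  proof -
    have "p + s *\<^sub>R a + t *\<^sub>R b \<in> ball p d3"
      using hd[OF that] by (simp add: d_def dist_commute)
    then show ?thesis using d3 by blast
  qed
  have sub': "p + s *\<^sub>R b + t *\<^sub>R a \<in> S" if "0 \<le> s" "s \<le> h" "0 \<le> t" "t \<le> h" for s t
    using sub[OF that(3,4,1,2)] by (simp add: algebra_simps)
  obtain s t where st: "0 \<le> s" "s \<le> h" "0 \<le> t" "t \<le> h"
    "f (p + h *\<^sub>R a + h *\<^sub>R b) - f (p + h *\<^sub>R a) - f (p + h *\<^sub>R b) + f p =
     h * h * fa (p + s *\<^sub>R a + t *\<^sub>R b) b"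
    by (rule second_difference_eq_mixed_partial[of h p a b S f f' fa]) (use h sub f fa in blast)+
  obtain s' t' where st': "0 \<le> s'" "s' \<le> h" "0 \<le> t'" "t' \<le> h"
    "f (p + h *\<^sub>R b + h *\<^sub>R a) - f (p + h *\<^sub>R b) - f (p + h *\<^sub>R a) + f p =
     h * h * fb (p + s' *\<^sub>R b + t' *\<^sub>R a) a"
    by (rule second_difference_eq_mixed_partial[of h p b a S f f' fb]) (use h sub' f fb in blast)+
  have "h * h * fa (p + s *\<^sub>R a + t *\<^sub>R b) b = h * h * fb (p + s' *\<^sub>R b + t' *\<^sub>R a) a"
    using st(5) st'(5) by (simp add: algebra_simps)
  then have eq: "fa (p + s *\<^sub>R a + t *\<^sub>R b) b = fb (p + s' *\<^sub>R b + t' *\<^sub>R a) a" using h by simp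
  have "dist (fa (p + s *\<^sub>R a + t *\<^sub>R b) b) (fa p b) < e"
    using d1(2) hd[OF st(1-4)] by (simp add: d_def)
  moreover have "dist (fb (p + s' *\<^sub>R b + t' *\<^sub>R a) a) (fb p a) < e"
    using d2(2) hd[OF st'(3,4,1,2)] by (simp add: d_def algebra_simps)
  ultimately have "\<bar>fa p b - fb p a\<bar> < 2 * e" using eq by (simp add: dist_real_def)
  then show False by (simp add: e_def)
qed

lemma mixed_partials_commute:
  fixes f :: "'a::real_normed_vector \<Rightarrow> complex"
  assumes S: "open S" "p \<in> S"
    and f: "\<And>x. x \<in> S \<Longrightarrow> (f has_derivative f' x) (at x)"
    and fa: "\<And>x. x \<in> S \<Longrightarrow> ((\<lambda>x. f' x a) has_derivative fa x) (at x)"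
    and fb: "\<And>x. x \<in> S \<Longrightarrow> ((\<lambda>x. f' x b) has_derivative fb x) (at x)"
    and cont: "continuous_on S (\<lambda>x. fa x b)" "continuous_on S (\<lambda>x. fb x a)"
  shows "fa p b = fb p a"
proof (rule complex_eqI)
  show "Re (fa p b) = Re (fb p a)"
    by (rule mixed_partials_commute_real[of S p "\<lambda>x. Re (f x)" "\<lambda>x v. Re (f' x v)" a
          "\<lambda>x v. Re (fa x v)" b "\<lambda>x v. Re (fb x v)", OF S])
      (intro has_derivative_Re continuous_on_Re f fa fb cont; assumption)+
  show "Im (fa p b) = Im (fb p a)"
    by (rule mixed_partials_commute_real[of S p "\<lambda>x. Im (f x)" "\<lambda>x v. Im (f' x v)" a
          "\<lambda>x v. Im (fa x v)" b "\<lambda>x v. Im (fb x v)", OF S])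
      (intro has_derivative_Im continuous_on_Im f fa fb cont; assumption)+
qed

section \<open>Stability properties of the function space \<open>Fun\<close>\<close>

lemma Fun_outside: "f \<in> Fun D \<Longrightarrow> p \<notin> interior D \<Longrightarrow> f p = 0"
  unfolding Fun_def by blast

lemma Fun_bounded: "f \<in> Fun D \<Longrightarrow> bounded (f ` interior D)"
  unfolding Fun_def using bounded_Ck.simps(1) by blast

lemma Fun_continuous: "f \<in> Fun D \<Longrightarrow> continuous_on (interior D) f"
  unfolding Fun_def using bounded_Ck.simps(1) by blast

lemma Fun_has_derivative:
  assumes "f \<in> Fun D" "p \<in> interior D"
  shows "(f has_derivative frechet_derivative f (at p)) (at p)"
proof -
  have "bounded_Ck D (Suc 0) f" using assms(1) unfolding Fun_def by blast
  then have "f differentiable (at p within interior D)"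
    using assms(2) by (simp add: differentiable_on_def)
  then have "f differentiable (at p)" using assms(2) by (metis at_within_open open_interior)
  then show ?thesis by (simp add: frechet_derivative_works)
qed

lemma Fun_pderiv: "f \<in> Fun D \<Longrightarrow> b \<in> Basis \<Longrightarrow> pderiv_on D b f \<in> Fun D"
  unfolding Fun_def by (auto simp: pderiv_on_def) (use bounded_Ck.simps(2) in blast)

text \<open>\<open>Fun\<close> is the largest set of functions that vanish outside the interior, are
  bounded and differentiable inside, and are stable under the partial derivatives. Membership thus
  needs only a suitable stable set and no formula for higher derivatives.\<close>

lemma Fun_coinduct:
  assumes f: "f \<in> S"
    and out: "\<And>f p. f \<in> S \<Longrightarrow> p \<notin> interior D \<Longrightarrow> f p = 0"
    and bd: "\<And>f. f \<in> S \<Longrightarrow> bounded (f ` interior D)"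
    and diff: "\<And>f p. f \<in> S \<Longrightarrow> p \<in> interior D \<Longrightarrow> f differentiable (at p)"
    and step: "\<And>f b. f \<in> S \<Longrightarrow> b \<in> Basis \<Longrightarrow> pderiv_on D b f \<in> S"
  shows "f \<in> Fun D"
proof -
  have don: "f differentiable_on interior D" if "f \<in> S" for f
    using diff[OF that] by (meson differentiable_at_withinI differentiable_on_def)
  have "bounded_Ck D n f" if "f \<in> S" for n f
    using that
  proof (induction n arbitrary: f)
    case 0 then show ?case using bd don differentiable_imp_continuous_on by auto
  next
    case (Suc n) then show ?case using bd don step by auto
  qed
  then show ?thesis using f out by (auto simp: Fun_def)
qed

lemma pderiv_onI:
  assumes "\<And>p. p \<in> interior D \<Longrightarrow> (f has_derivative f' p) (at p)"
    and "\<And>p. p \<in> interior D \<Longrightarrow> g p = f' p b" "\<And>p. p \<notin> interior D \<Longrightarrow> g p = 0"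
  shows "pderiv_on D b f = g"
  using assms frechet_derivative_at[OF assms(1)] by (fastforce simp: pderiv_on_def)

lemma has_derivative_coord_mult:
  fixes c :: "pt \<Rightarrow> real" and f g :: "pt \<Rightarrow> complex"
  assumes "bounded_linear c" "f \<in> Fun D" "g \<in> Fun D" "p \<in> interior D"
  shows "((\<lambda>p. of_real (c p) * f p + k * g p) has_derivative
     (\<lambda>v. of_real (c p) * frechet_derivative f (at p) v + of_real (c v) * f p
         + k * frechet_derivative g (at p) v)) (at p)"
  by (rule derivative_eq_intros bounded_linear_imp_has_derivative assms Fun_has_derivative[OF assms(2,4)]
      Fun_has_derivative[OF assms(3,4)] refl)+ (simp add: algebra_simps)

lemma bounded_coord_mult:
  fixes c :: "pt \<Rightarrow> real"
  assumes "bounded D" "bounded_linear c" "f \<in> Fun D" "g \<in> Fun D"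
  shows "bounded ((\<lambda>p. of_real (c p) * f p + k * g p) ` interior D)"
proof -
  have "bounded (c ` interior D)"
    by (rule bounded_linear_image) (use assms bounded_interior in auto)
  then obtain B where B: "\<And>p. p \<in> interior D \<Longrightarrow> norm (c p) \<le> B" by (auto simp: bounded_iff)
  obtain F where F: "\<And>p. p \<in> interior D \<Longrightarrow> norm (f p) \<le> F"
    using Fun_bounded[OF assms(3)] by (auto simp: bounded_iff)
  obtain G where G: "\<And>p. p \<in> interior D \<Longrightarrow> norm (g p) \<le> G"
    using Fun_bounded[OF assms(4)] by (auto simp: bounded_iff)
  have "norm (of_real (c p) * f p + k * g p) \<le> B * F + norm k * G" if p: "p \<in> interior D" for p
  proof (rule norm_triangle_le)
    have "norm (of_real (c p) * f p) \<le> B * F"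
      unfolding norm_mult using B[OF p] F[OF p]
      by (intro mult_mono) (auto intro: order_trans[OF norm_ge_zero] order_trans[OF abs_ge_zero])
    moreover have "norm (k * g p) \<le> norm k * G"
      unfolding norm_mult using G[OF p] by (intro mult_left_mono) auto
    ultimately show "norm (of_real (c p) * f p) + norm (k * g p) \<le> B * F + norm k * G" by simp
  qed
  then show ?thesis by (intro boundedI) blast
qed

lemma Fun_zero: "(\<lambda>p. 0) \<in> Fun D"
proof (rule Fun_coinduct[of _ "{\<lambda>p. 0}"])
  show "pderiv_on D b f \<in> {\<lambda>p. 0}" if "f \<in> {\<lambda>p. 0}" for f b
    using that by (auto intro!: pderiv_onI[where f' = "\<lambda>p v. 0"])
qed (auto simp: bounded_iff)

lemma bounded_linear_fst_component: "bounded_linear (\<lambda>p :: pt. fst p $ i)"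
  by (rule bounded_linear_compose[OF bounded_linear_vec_nth bounded_linear_fst])

lemma bounded_linear_snd_component: "bounded_linear (\<lambda>p :: pt. snd p $ i)"
  by (rule bounded_linear_compose[OF bounded_linear_vec_nth bounded_linear_snd])

lemma pderiv_coord_mult:
  fixes c :: "pt \<Rightarrow> real"
  assumes "bounded_linear c" "f \<in> Fun D" "g \<in> Fun D"
  shows "pderiv_on D b (\<lambda>p. of_real (c p) * f p + k * g p) =
    (\<lambda>p. of_real (c p) * pderiv_on D b f p + of_real (c b) * f p + k * pderiv_on D b g p)"
proof (rule pderiv_onI[OF has_derivative_coord_mult[OF assms]])
  fix p assume "p \<notin> interior D"
  then show "of_real (c p) * pderiv_on D b f p + of_real (c b) * f p + k * pderiv_on D b g p = 0"
    using assms(2) by (simp add: pderiv_on_def Fun_outside)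
qed (simp_all add: pderiv_on_def)

lemma pderiv_lincomb:
  assumes "f \<in> Fun D" "g \<in> Fun D"
  shows "pderiv_on D b (\<lambda>p. f p + k * g p) = (\<lambda>p. pderiv_on D b f p + k * pderiv_on D b g p)"
  by (rule pderiv_onI[where f' = "\<lambda>p v. frechet_derivative f (at p) v + k * frechet_derivative g (at p) v"])
    (auto simp: pderiv_on_def intro!: derivative_eq_intros
      Fun_has_derivative[OF assms(1)] Fun_has_derivative[OF assms(2)])

lemma Fun_lincomb:
  assumes f: "f \<in> Fun D" and g: "g \<in> Fun D"
  shows "(\<lambda>p. f p + k * g p) \<in> Fun D"
proof (rule Fun_coinduct[of _ "{\<lambda>p. f p + k * g p | f g. f \<in> Fun D \<and> g \<in> Fun D}"])
  fix h assume "h \<in> {\<lambda>p. f p + k * g p | f g. f \<in> Fun D \<and> g \<in> Fun D}"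
  then obtain f g where h: "h = (\<lambda>p. f p + k * g p)" and fg: "f \<in> Fun D" "g \<in> Fun D" by auto
  show "h p = 0" if "p \<notin> interior D" for p
    using that fg by (simp add: h Fun_outside)
  show "h differentiable (at p)" if p: "p \<in> interior D" for p
    unfolding h using Fun_has_derivative[OF fg(1) p] Fun_has_derivative[OF fg(2) p]
    by (intro derivative_intros) (auto simp: differentiable_def)
  show "pderiv_on D b h \<in> {\<lambda>p. f p + k * g p | f g. f \<in> Fun D \<and> g \<in> Fun D}" if "b \<in> Basis" for b
    using pderiv_lincomb[OF fg] Fun_pderiv[OF fg(1) that] Fun_pderiv[OF fg(2) that]
    by (auto simp: h)
  obtain F where F: "\<And>p. p \<in> interior D \<Longrightarrow> norm (f p) \<le> F"
    using Fun_bounded[OF fg(1)] by (auto simp: bounded_iff)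
  obtain G where G: "\<And>p. p \<in> interior D \<Longrightarrow> norm (g p) \<le> G"
    using Fun_bounded[OF fg(2)] by (auto simp: bounded_iff)
  have "norm (h p) \<le> F + norm k * G" if "p \<in> interior D" for p
    unfolding h by (rule norm_triangle_le)
      (simp add: norm_mult add_mono mult_left_mono F[OF that] G[OF that])
  then show "bounded (h ` interior D)" by (intro boundedI) blast
qed (use f g in auto)

text \<open>Products of \<open>c\<close> and \<open>f\<close> alone are not stable under partial
  derivatives, because the Leibniz rule adds \<open>c b\<close> times \<open>f\<close>. A second
  summand from \<open>Fun\<close> absorbs this term, so the enlarged family is stable.\<close>

lemma Fun_coord_mult_lincomb:
  fixes c :: "pt \<Rightarrow> real"
  assumes D: "bounded D" and c: "bounded_linear c" and f: "f \<in> Fun D" and g: "g \<in> Fun D"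
  shows "(\<lambda>p. of_real (c p) * f p + k * g p) \<in> Fun D"
proof (rule Fun_coinduct[of _ "{\<lambda>p. of_real (c p) * f p + k * g p | f g k. f \<in> Fun D \<and> g \<in> Fun D}"])
  fix h assume "h \<in> {\<lambda>p. of_real (c p) * f p + k * g p | f g k. f \<in> Fun D \<and> g \<in> Fun D}"
  then obtain f g k where h: "h = (\<lambda>p. of_real (c p) * f p + k * g p)" and fg: "f \<in> Fun D" "g \<in> Fun D" by auto
  show "h p = 0" if "p \<notin> interior D" for p
    using that fg by (simp add: h Fun_outside)
  show "h differentiable (at p)" if p: "p \<in> interior D" for p
    unfolding h using has_derivative_coord_mult[OF c fg p] by (auto simp: differentiable_def)
  show "bounded (h ` interior D)" unfolding h by (rule bounded_coord_mult[OF D c fg])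
  show "pderiv_on D b h \<in> {\<lambda>p. of_real (c p) * f p + k * g p | f g k. f \<in> Fun D \<and> g \<in> Fun D}"
    if "b \<in> Basis" for b
  proof -
    have "(\<lambda>p. k * pderiv_on D b g p + of_real (c b) * f p) \<in> Fun D"
      using Fun_lincomb[OF Fun_lincomb[OF Fun_zero Fun_pderiv[OF fg(2) that], of k] fg(1), of "of_real (c b)"]
      by simp
    moreover have "pderiv_on D b h = (\<lambda>p. of_real (c p) * pderiv_on D b f p
        + 1 * (k * pderiv_on D b g p + of_real (c b) * f p))"
      unfolding h pderiv_coord_mult[OF c fg] by (simp add: algebra_simps)
    ultimately show ?thesis using Fun_pderiv[OF fg(1) that]
      by (intro CollectI exI[of _ "pderiv_on D b f"]
          exI[of _ "\<lambda>p. k * pderiv_on D b g p + of_real (c b) * f p"] exI[of _ 1]) simp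
  qed
qed (use f g in auto)

lemma Fun_coord_mult:
  fixes c :: "pt \<Rightarrow> real"
  assumes "bounded D" "bounded_linear c" "f \<in> Fun D"
  shows "(\<lambda>p. of_real (c p) * f p) \<in> Fun D"
  using Fun_coord_mult_lincomb[OF assms assms(3), of 0] by simp

lemma Fun_scale: "f \<in> Fun D \<Longrightarrow> (\<lambda>p. k * f p) \<in> Fun D"
  using Fun_lincomb[OF Fun_zero, of f D k] by simp

lemma Fun_add: "f \<in> Fun D \<Longrightarrow> g \<in> Fun D \<Longrightarrow> (\<lambda>p. f p + g p) \<in> Fun D"
  using Fun_lincomb[of f D g 1] by simp

lemma Fun_diff: "f \<in> Fun D \<Longrightarrow> g \<in> Fun D \<Longrightarrow> (\<lambda>p. f p - g p) \<in> Fun D"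
  using Fun_lincomb[of f D g "-1"] by simp

lemma Fun_sum: "(\<And>i. i \<in> I \<Longrightarrow> f i \<in> Fun D) \<Longrightarrow> (\<lambda>p. \<Sum>i\<in>I. f i p) \<in> Fun D"
  by (induction I rule: infinite_finite_induct) (auto intro: Fun_zero Fun_add)

lemma pderiv_add:
  "f \<in> Fun D \<Longrightarrow> g \<in> Fun D \<Longrightarrow>
    pderiv_on D b (\<lambda>p. f p + g p) = (\<lambda>p. pderiv_on D b f p + pderiv_on D b g p)"
  using pderiv_lincomb[of f D g b 1] by simp

lemma pderiv_zero: "pderiv_on D b (\<lambda>p. 0) = (\<lambda>p. 0)"
  by (rule pderiv_onI[where f' = "\<lambda>p v. 0"]) auto

lemma pderiv_scale:
  "f \<in> Fun D \<Longrightarrow> pderiv_on D b (\<lambda>p. k * f p) = (\<lambda>p. k * pderiv_on D b f p)"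
  using pderiv_lincomb[OF Fun_zero, of f D b k] by (simp add: pderiv_zero)

lemma pderiv_sum:
  "(\<And>i. i \<in> I \<Longrightarrow> f i \<in> Fun D) \<Longrightarrow>
    pderiv_on D b (\<lambda>p. \<Sum>i\<in>I. f i p) = (\<lambda>p. \<Sum>i\<in>I. pderiv_on D b (f i) p)"
  by (induction I rule: infinite_finite_induct) (auto simp: pderiv_zero pderiv_add Fun_sum)

lemma pderiv_coord:
  fixes c :: "pt \<Rightarrow> real"
  assumes "bounded_linear c" "f \<in> Fun D"
  shows "pderiv_on D b (\<lambda>p. of_real (c p) * f p) =
    (\<lambda>p. of_real (c p) * pderiv_on D b f p + of_real (c b) * f p)"
  using pderiv_coord_mult[OF assms assms(2), of b 0] by simp

text \<open>Outside the interior both sides are \<open>0\<close> by definition. Inside,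
  \<open>pderiv_on\<close> agrees with the Frechet derivative on a whole neighbourhood, so the
  iterated derivatives are those of \<open>mixed_partials_commute\<close>.\<close>

lemma pderiv_commute:
  assumes f: "f \<in> Fun D" and ab: "a \<in> Basis" "b \<in> Basis"
  shows "pderiv_on D a (pderiv_on D b f) = pderiv_on D b (pderiv_on D a f)"
proof
  fix p
  show "pderiv_on D a (pderiv_on D b f) p = pderiv_on D b (pderiv_on D a f) p"
  proof (cases "p \<in> interior D")
    case True
    have der: "((\<lambda>x. frechet_derivative f (at x) v) has_derivative
        frechet_derivative (pderiv_on D v f) (at x)) (at x)"
      if "x \<in> interior D" "v \<in> Basis" for x v
      using Fun_has_derivative[OF Fun_pderiv[OF f that(2)] that(1)]
      by (rule has_derivative_transform_within_open[OF _ open_interior that(1)])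
        (simp add: pderiv_on_def)
    have cont: "continuous_on (interior D) (\<lambda>x. frechet_derivative (pderiv_on D v f) (at x) u)"
      if "u \<in> Basis" "v \<in> Basis" for u v
      using Fun_continuous[OF Fun_pderiv[OF Fun_pderiv[OF f that(2)] that(1)]]
      by (rule continuous_on_eq) (simp add: pderiv_on_def)
    have "frechet_derivative (pderiv_on D b f) (at p) a = frechet_derivative (pderiv_on D a f) (at p) b"
      by (rule mixed_partials_commute[OF open_interior True Fun_has_derivative[OF f]])
        (use der cont ab in auto)
    then show ?thesis using True by (simp add: pderiv_on_def)
  qed (simp add: pderiv_on_def)
qed

lemma axis_Basis [simp]:
  "(axis i 1 :: real ^ 3, 0 :: real ^ 3) \<in> Basis" "(0 :: real ^ 3, axis i 1 :: real ^ 3) \<in> Basis"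
  by (simp_all add: Basis_prod_def axis_in_Basis_iff image_iff Basis_real_def)

lemma fun_act_Fun:
  assumes "bounded D" "f \<in> Fun D"
  shows "fun_act D g f \<in> Fun D"
proof (cases g)
  case (P i)
  have "(\<lambda>p. eps i j k * (of_real (fst p $ j) * pderiv_on D (0, axis k 1) f p)) \<in> Fun D" for j k
    by (intro Fun_scale Fun_coord_mult bounded_linear_fst_component Fun_pderiv assms axis_Basis)
  then have "(\<lambda>p. (1/2) * (\<Sum>j\<in>UNIV. \<Sum>k\<in>UNIV. eps i j k * (of_real (fst p $ j) * pderiv_on D (0, axis k 1) f p))) \<in> Fun D"
    by (intro Fun_scale[of _ _ "1/2"] Fun_sum)
  then show ?thesis using P Fun_add[OF Fun_pderiv[OF assms(2), of "(axis i 1, 0)"]]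
    by (simp add: mult.assoc)
qed (use assms Fun_zero[of D] in \<open>auto simp: zero_fun_def intro!: Fun_coord_mult Fun_pderiv bounded_linear_fst_component
      bounded_linear_snd_component\<close>)

lemma fun_act_lincomb:
  assumes "f \<in> Fun D" "h \<in> Fun D"
  shows "fun_act D g (\<lambda>p. f p + k * h p) = (\<lambda>p. fun_act D g f p + k * fun_act D g h p)"
  by (cases g) (auto simp: pderiv_lincomb[OF assms] fun_eq_iff algebra_simps sum.distrib sum_distrib_left)

text \<open>The exponential is an eigenfunction of every directional derivative, so its scalar
  multiples form a stable set for \<open>Fun_coinduct\<close>.\<close>

lemma exp_fun_Fun_pderiv:
  assumes D: "bounded D"
  shows "exp_fun D w \<in> Fun D"
    and "pderiv_on D b (exp_fun D w) = (\<lambda>p. of_real (\<Sum>j\<in>UNIV. of_int (w $ j) * snd b $ j) * exp_fun D w p)"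
proof -
  define c :: "pt \<Rightarrow> real" where "c p = (\<Sum>j\<in>UNIV. of_int (w $ j) * snd p $ j)" for p
  have c: "bounded_linear c" unfolding c_def
    by (intro bounded_linear_sum bounded_linear_const_mult bounded_linear_snd_component)
  have der: "(exp_fun D w has_derivative (\<lambda>v. of_real (c v) * exp_fun D w p)) (at p)"
    if p: "p \<in> interior D" for p
  proof -
    have "((\<lambda>p. exp (of_real (c p)) :: complex) has_derivative (\<lambda>v. of_real (c v) * exp (of_real (c p)))) (at p)"
      using has_derivative_compose[OF has_derivative_of_real[OF bounded_linear_imp_has_derivative[OF c]]
          DERIV_exp[unfolded has_field_derivative_def]]
      by (simp add: mult.commute)
    then have "(exp_fun D w has_derivative (\<lambda>v. of_real (c v) * exp (of_real (c p)))) (at p)"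
      by (rule has_derivative_transform_within_open[OF _ open_interior p]) (simp add: exp_fun_def c_def)
    then show ?thesis using p by (simp add: exp_fun_def c_def)
  qed
  have bd: "bounded (exp_fun D w ` interior D)"
  proof -
    have "bounded (c ` interior D)"
      by (rule bounded_linear_image) (use c D bounded_interior in auto)
    then obtain B where B: "\<And>p. p \<in> interior D \<Longrightarrow> \<bar>c p\<bar> \<le> B" by (auto simp: bounded_iff)
    have "norm (exp_fun D w p) \<le> exp B" if "p \<in> interior D" for p
      using that B[OF that] by (simp add: exp_fun_def c_def flip: of_real_sum of_real_mult)
    then show ?thesis by (intro boundedI) blast
  qed
  have pd: "pderiv_on D b (\<lambda>p. k * exp_fun D w p) = (\<lambda>p. k * of_real (c b) * exp_fun D w p)" for b k
    by (rule pderiv_onI[OF has_derivative_mult_right[OF der]]) (simp_all add: exp_fun_def)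
  show "exp_fun D w \<in> Fun D"
  proof (rule Fun_coinduct[of _ "range (\<lambda>k p. k * exp_fun D w p)"])
    show "exp_fun D w \<in> range (\<lambda>k p. k * exp_fun D w p)" by (rule image_eqI[of _ _ 1]) auto
    fix f :: "pt \<Rightarrow> complex" assume "f \<in> range (\<lambda>k p. k * exp_fun D w p)"
    then obtain k where f: "f = (\<lambda>p. k * exp_fun D w p)" by auto
    show "f p = 0" if "p \<notin> interior D" for p using that by (simp add: f exp_fun_def)
    show "f differentiable (at p)" if "p \<in> interior D" for p
      unfolding f using der[OF that] by (intro derivative_intros) (auto simp: differentiable_def)
    show "pderiv_on D b f \<in> range (\<lambda>k p. k * exp_fun D w p)" for b
      unfolding f pd by (rule image_eqI[of _ _ "k * of_real (c b)"]) auto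
    show "bounded (f ` interior D)"
      using bounded_linear_image[OF bd bounded_linear_mult_right[of k]] by (simp add: f image_image)
  qed
  show "pderiv_on D b (exp_fun D w) = (\<lambda>p. of_real (\<Sum>j\<in>UNIV. of_int (w $ j) * snd b $ j) * exp_fun D w p)"
    using pd[of b 1] by (simp add: c_def)
qed

section \<open>The Jacobi identity\<close>

lemma eps_values:
  "eps 1 2 3 = (1::'a::ring_1)" "eps 2 3 1 = (1::'a)" "eps 3 1 2 = (1::'a)"
  "eps 2 1 3 = (-1::'a)" "eps 1 3 2 = (-1::'a)" "eps 3 2 1 = (-1::'a)"
  "eps i i k = (0::'a)" "eps i k k = (0::'a)" "eps k i k = (0::'a)"
  by (auto simp: eps_def)

lemma eps_perms:
  "eps j k i = (eps i j k :: 'a::ring_1)" "eps k i j = (eps i j k :: 'a)"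
  "eps j i k = (- eps i j k :: 'a)" "eps i k j = (- eps i j k :: 'a)" "eps k j i = (- eps i j k :: 'a)"
  using exhaust_3[of i] exhaust_3[of j] exhaust_3[of k] by (auto simp: eps_values)

lemmas eps_swap = eps_perms(3)

text \<open>
  Functionals \<open>v\<close> on the Lie algebra are given by their values on the generators: \<open>lin v t\<close> is the value
  at the vector \<open>t\<close>, and \<open>brv v g h\<close> the value at the bracket of \<open>g\<close> and \<open>h\<close>.
\<close>

definition lin :: "(gen \<Rightarrow> 'p \<Rightarrow> complex) \<Rightarrow> (gen \<Rightarrow>\<^sub>0 complex) \<Rightarrow> 'p \<Rightarrow> complex" where
  "lin v t = (\<lambda>p. \<Sum>k\<in>Poly_Mapping.keys t. Poly_Mapping.lookup t k * v k p)"

lemma lin_superset: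
  "finite A \<Longrightarrow> Poly_Mapping.keys t \<subseteq> A \<Longrightarrow> lin v t p = (\<Sum>k\<in>A. Poly_Mapping.lookup t k * v k p)"
  unfolding lin_def by (rule sum.mono_neutral_left) (auto simp: in_keys_iff)

lemma lin_single: "lin v (Poly_Mapping.single k c) = (\<lambda>p. c * v k p)"
  by (rule ext, subst lin_superset[of "{k}"]) auto

lemma lin_zero: "lin v 0 = (\<lambda>p. 0)"
  by (simp add: lin_def)

lemma lin_add: "lin v (s + t) = (\<lambda>p. lin v s p + lin v t p)"
proof
  fix p
  let ?A = "Poly_Mapping.keys s \<union> Poly_Mapping.keys t"
  have "lin v u p = (\<Sum>k\<in>?A. Poly_Mapping.lookup u k * v k p)" if "Poly_Mapping.keys u \<subseteq> ?A" for u
    by (rule lin_superset) (use that in auto)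
  then show "lin v (s + t) p = lin v s p + lin v t p"
    by (simp add: Poly_Mapping.keys_add lookup_add algebra_simps sum.distrib)
qed

lemma lin_sum: "lin v (\<Sum>i\<in>I. t i) = (\<lambda>p. \<Sum>i\<in>I. lin v (t i) p)"
  by (induction I rule: infinite_finite_induct) (auto simp: lin_zero lin_add)

definition brv :: "(gen \<Rightarrow> 'p \<Rightarrow> complex) \<Rightarrow> gen \<Rightarrow> gen \<Rightarrow> 'p \<Rightarrow> complex" where
  "brv v g h = lin v (bracket g h)"

lemma brv_simps:
  "brv v Hbar g = (\<lambda>p. 0)"
  "brv v g Hbar = (\<lambda>p. 0)"
  "brv v (W i) (W j) = (\<lambda>p. 0)"
  "brv v (W i) (P j) = (\<lambda>p. 0)"
  "brv v (P j) (W i) = (\<lambda>p. 0)"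
  "brv v (W i) (X n j) = (\<lambda>p. 0)"
  "brv v (X n j) (W i) = (\<lambda>p. 0)"
  "brv v (X n j) (X m i) = (\<lambda>p. 0)"
  "brv v (P i) (X n j) = (\<lambda>p. if n = 0 \<and> i = j then v Hbar p else 0)"
  "brv v (X n j) (P i) = (\<lambda>p. if n = 0 \<and> i = j then - v Hbar p else 0)"
  "brv v (W j) (Xs n i) = (\<lambda>p. if n = 0 \<and> i = j then v Hbar p else 0)"
  "brv v (Xs n i) (W j) = (\<lambda>p. if n = 0 \<and> i = j then - v Hbar p else 0)"
  "brv v (Xs n i) (X m j) = (\<lambda>p. if m \<noteq> 0 \<and> m = - n \<and> i = j then v Hbar p / of_int m else 0)"
  "brv v (X m j) (Xs n i) = (\<lambda>p. if m \<noteq> 0 \<and> m = - n \<and> i = j then - v Hbar p / of_int m else 0)"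
  "brv v (P i) (P j) = (\<lambda>p. \<Sum>k\<in>UNIV. (- 1) * eps i j k * v (W k) p)"
  "brv v (P i) (Xs n j) = (\<lambda>p. \<Sum>k\<in>UNIV. - (1/2) * eps i j k * v (X n k) p)"
  "brv v (Xs n j) (P i) = (\<lambda>p. \<Sum>k\<in>UNIV. (1/2) * eps i j k * v (X n k) p)"
  by (cases g; auto simp: brv_def lin_zero lin_single lin_sum)+

lemma brv_Xs_Xs:
  "brv v (Xs m i) (Xs n j) = (\<lambda>p.
     if m \<noteq> 0 \<and> n \<noteq> 0 then
        (\<Sum>k\<in>UNIV. of_int (m + n) / (2 * of_int m * of_int n) * eps i j k * v (X (m + n) k) p) +
        (if m = - n then \<Sum>k\<in>UNIV. 1 / (of_int m)\<^sup>2 * eps i j k * v (W k) p else 0)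
      else if m \<noteq> 0 then \<Sum>k\<in>UNIV. 1 / (2 * of_int m) * eps i j k * v (X m k) p
      else if n \<noteq> 0 then \<Sum>k\<in>UNIV. - (1 / (2 * of_int n)) * eps j i k * v (X n k) p
      else 0)"
  by (simp add: brv_def lin_zero lin_single lin_sum lin_add fun_eq_iff)

lemma brv_Xs_Xs_antisym: "brv v (Xs n j) (Xs m i) p = - brv v (Xs m i) (Xs n j) p"
proof -
  note e = eps_perms(3)[where i = i and j = j and 'a = complex]
  show ?thesis
    unfolding brv_Xs_Xs e by (simp add: add.commute[of n m] mult.commute mult.left_commute sum_negf)
qed

lemma brv_antisym: "brv v h g p = - brv v g h p"
proof -
  note e = eps_perms(3)[where 'a = complex]
  show ?thesis
  proof (cases g)
    case (P i)
    then show ?thesis by (cases h) (simp_all add: brv_simps sum_negf e[of _ i])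
  next
    case (Xs n i)
    then show ?thesis by (cases h) (simp_all add: brv_simps sum_negf brv_Xs_Xs_antisym[of v n i])
  qed (cases h; simp add: brv_simps)+
qed

lemma sum_eps_delta:
  fixes c :: complex
  shows "(\<Sum>k\<in>UNIV. c * eps i j k * (if Q \<and> r = k then x else 0)) = (if Q then c * eps i j r * x else 0)"
    and "(\<Sum>k\<in>UNIV. c * eps i j k * (if Q \<and> k = r then x else 0)) = (if Q then c * eps i j r * x else 0)"
    and "(\<Sum>k\<in>UNIV. c * eps i j k * (if Q \<and> Q' \<and> r = k then x else 0)) =
      (if Q \<and> Q' then c * eps i j r * x else 0)"
    and "(\<Sum>k\<in>UNIV. c * eps i j k * (if Q \<and> Q' \<and> k = r then x else 0)) =
      (if Q \<and> Q' then c * eps i j r * x else 0)"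
  by (auto simp: if_distrib[of "\<lambda>x. _ * x"] cong: if_cong)

lemma Jacobi_P_P_Xs:
  "brv (brv v (P i)) (P j) (Xs n r) p + brv (brv v (P j)) (Xs n r) (P i) p
    + brv (brv v (Xs n r)) (P i) (P j) p = 0"
proof -
  note e = eps_perms[where i = i and j = j and k = r and 'a = complex]
  show ?thesis unfolding brv_simps sum_eps_delta e by simp
qed

lemma Jacobi_P_Xs_Xs:
  "brv (brv v (P i)) (Xs m j) (Xs n r) p + brv (brv v (Xs m j)) (Xs n r) (P i) p
    + brv (brv v (Xs n r)) (P i) (Xs m j) p = 0"
proof -
  note e = eps_perms[where i = i and j = j and k = r and 'a = complex]
  show ?thesis unfolding brv_simps brv_Xs_Xs sum_eps_delta e by (simp add: divide_simps)
qed

text \<open>In the generic case the bracket of \<open>Xs m j\<close> and \<open>Xs n r\<close> has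
  coefficient \<open>(m + n) / (2 m n)\<close> at \<open>X (m + n)\<close>, and contracting with
  \<open>Xs l i\<close> divides by \<open>m + n\<close>. The cases \<open>m = 0\<close>,
  \<open>n = 0\<close> and \<open>m + n = 0\<close> have brackets of their own and hence separate
  coefficients.\<close>

lemma brv_Xs_Xs_Xs:
  "brv (brv v (Xs l i)) (Xs m j) (Xs n r) p =
    (if l + m + n = 0 \<and> (m \<noteq> 0 \<or> n \<noteq> 0) then
       (if m = 0 then 1 / (2 * of_int n ^ 2) else if n = 0 then 1 / (2 * of_int m ^ 2)
        else if l = 0 then - 1 / of_int m ^ 2 else 1 / (2 * of_int m * of_int n)) * eps i j r * v Hbar p
     else 0)"
proof -
  note e = eps_perms[where i = i and j = j and k = r and 'a = complex]
  show ?thesis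
  proof (cases "m = 0 \<or> n = 0")
    case True
    then show ?thesis unfolding brv_simps brv_Xs_Xs sum_eps_delta e
      by (auto simp: power2_eq_square)
  next
    case False
    show ?thesis
    proof (cases "m + n = 0")
      case True
      then have "m = - n" by simp
      then show ?thesis unfolding brv_simps brv_Xs_Xs sum_eps_delta e using False
        by auto
    next
      case nz: False
      then have c: "of_int m + of_int n \<noteq> (0 :: complex)" by (simp flip: of_int_add)
      from nz have "m \<noteq> - n" by simp
      moreover have "l + m + n = 0 \<longleftrightarrow> m + n = - l" "m + n = - l \<longrightarrow> l \<noteq> 0" using nz by auto
      ultimately show ?thesis unfolding brv_simps brv_Xs_Xs sum_eps_delta e using False nz c
        by simp
    qed
  qed
qed

text \<open>For nonzero modes the three coefficients add up to
  \<open>(l + m + n) / (2 l m n) = 0\<close>. If exactly one mode vanishes they are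
  \<open>1/2\<close>, \<open>1/2\<close> and \<open>- 1\<close> times the inverse square of a
  nonzero mode: the brackets with zero modes balance the term in \<open>W\<close>.\<close>

lemma Jacobi_Xs_Xs_Xs:
  "brv (brv v (Xs l i)) (Xs m j) (Xs n r) p + brv (brv v (Xs m j)) (Xs n r) (Xs l i) p
    + brv (brv v (Xs n r)) (Xs l i) (Xs m j) p = 0"
proof (cases "l + m + n = 0")
  case True
  then have l: "l = - m - n" by simp
  note e = eps_perms[where i = i and j = j and k = r and 'a = complex]
  consider "m = 0" "n = 0" | "m = 0" "n \<noteq> 0" | "n = 0" "m \<noteq> 0" | "m = - n" "n \<noteq> 0"
    | "m \<noteq> 0" "n \<noteq> 0" "m + n \<noteq> 0" by linarith
  then show ?thesis
  proof cases
    case 5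
    then have "of_int m + of_int n \<noteq> (0 :: complex)" "- of_int m - of_int n \<noteq> (0 :: complex)"
      "- m - n \<noteq> 0"
      by (simp_all flip: of_int_add of_int_minus of_int_diff)
    with 5 show ?thesis
      unfolding brv_Xs_Xs_Xs l e by (simp add: divide_simps) (simp add: algebra_simps)
  qed (simp_all add: brv_Xs_Xs_Xs l e)
qed (simp add: brv_Xs_Xs_Xs add.commute add.left_commute)

text \<open>A nested bracket can be nonzero only for letters of the kinds \<open>P\<close> and
  \<open>Xs\<close>, at least one of them \<open>Xs\<close>; for all other triples the three terms
  vanish separately. With only two kinds of letters, cyclic rotation reaches every
  arrangement.\<close>

lemma Jacobi_cyclic: "brv (brv v a) g h p + brv (brv v g) h a p + brv (brv v h) a g p = 0"
proof -
  have rot: "y + z + x = 0" if "x + y + z = 0" for x y z :: complex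
    using that by (simp add: ac_simps)
  note J = Jacobi_P_P_Xs Jacobi_P_Xs_Xs Jacobi_Xs_Xs_Xs
  note J' = J J[THEN rot] J[THEN rot, THEN rot]
  show ?thesis
    by (cases a; cases g; cases h; hypsubst; (rule J' | simp add: brv_simps brv_Xs_Xs))
qed

text \<open>The form used from here on: bracketing with \<open>a\<close> is a derivation of the
  bracket.\<close>

lemma Jacobi: "brv (brv v a) g h p = brv (\<lambda>k. brv v k h) a g p + brv (brv v g) a h p"
proof -
  have sw: "brv (\<lambda>k. brv v k h) a g p = - brv (brv v h) a g p"
    unfolding brv_def[of "\<lambda>k. brv v k h"] brv_def[of "brv v h"] lin_def
    by (simp add: brv_antisym[of v _ h] sum_negf)
  show ?thesis
    using Jacobi_cyclic[of v a g h p] brv_antisym[of "brv v g" h a p] sw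
    by (simp add: algebra_simps)
qed

lemma deg_bracket: "k \<in> Poly_Mapping.keys (bracket g h) \<Longrightarrow> deg k = deg g + deg h"
proof -
  assume k: "k \<in> Poly_Mapping.keys (bracket g h)"
  show ?thesis
  proof (rule ccontr)
    assume d: "deg k \<noteq> deg g + deg h"
    have "Poly_Mapping.lookup (bracket g h) k = 0"
      using d by (cases g; cases h; cases k)
        (auto simp: lookup_single lookup_sum lookup_add when_def)
    then show False using k by (simp add: in_keys_iff)
  qed
qed

section \<open>Vacuum expectations of words\<close>

lemma pderiv_P:
  assumes f: "f \<in> Fun D" and D: "bounded D"
  shows "pderiv_on D b (fun_act D (P j) f) = (\<lambda>p. pderiv_on D b (pderiv_on D (axis j 1, 0) f) p
    + (1/2) * (\<Sum>l\<in>UNIV. \<Sum>m\<in>UNIV. eps j l m *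
       (of_real (fst p $ l) * pderiv_on D b (pderiv_on D (0, axis m 1) f) p
         + of_real (fst b $ l) * pderiv_on D (0, axis m 1) f p)))"
proof -
  note W = Fun_pderiv[OF f axis_Basis(2)]
  note xW = Fun_coord_mult[OF D bounded_linear_fst_component W]
  have eq: "fun_act D (P j) f = (\<lambda>p. pderiv_on D (axis j 1, 0) f p + (1/2) *
     (\<Sum>l\<in>UNIV. \<Sum>m\<in>UNIV. eps j l m * (of_real (fst p $ l) * pderiv_on D (0, axis m 1) f p)))"
    by (simp add: mult.assoc)
  have inner: "(\<lambda>p. \<Sum>m\<in>UNIV. eps j l m * (of_real (fst p $ l) * pderiv_on D (0, axis m 1) f p)) \<in> Fun D" for l
    by (intro Fun_sum Fun_scale xW)
  show ?thesis
    unfolding eq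
    by (subst pderiv_lincomb)
      (simp_all add: Fun_pderiv f Fun_sum inner pderiv_sum Fun_scale xW pderiv_scale
        pderiv_coord[OF bounded_linear_fst_component W])
qed

text \<open>The second-order parts are symmetric in \<open>i\<close> and \<open>j\<close> because
  partial derivatives commute. What survives is the term where one operator differentiates the
  coefficient \<open>x\<close> of the other; each of the two orders gives half of the right-hand
  side.\<close>

lemma fun_act_P_P:
  assumes f: "f \<in> Fun D" and D: "bounded D"
  shows "fun_act D (P i) (fun_act D (P j) f) p - fun_act D (P j) (fun_act D (P i) f) p =
    (\<Sum>k\<in>UNIV. - 1 * eps i j k * pderiv_on D (0, axis k 1) f p)"
proof -
  define x where "x l = complex_of_real (fst p $ l)" for l
  define d where "d i j = pderiv_on D (axis i 1, 0) (pderiv_on D (axis j 1, 0) f) p" for i j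
  define w where "w m = pderiv_on D (0, axis m 1) f p" for m
  define dw where "dw i m = pderiv_on D (axis i 1, 0) (pderiv_on D (0, axis m 1) f) p" for i m
  define ww where "ww l m = pderiv_on D (0, axis l 1) (pderiv_on D (0, axis m 1) f) p" for l m
  have d: "d j i = d i j" and ww: "ww l m = ww m l" for l m i j
    unfolding d_def ww_def by (subst pderiv_commute[OF f]; simp)+
  have wd: "pderiv_on D (0, axis m 1) (pderiv_on D (axis i 1, 0) f) p = dw i m" for i m
    unfolding dw_def by (subst pderiv_commute[OF f]; simp)
  define A where "A i j = (\<Sum>l\<in>UNIV. \<Sum>m\<in>UNIV. eps i l m * (x l * dw j m))" for i j
  define B where "B i j = (\<Sum>r\<in>UNIV. \<Sum>s\<in>UNIV. \<Sum>l\<in>UNIV. \<Sum>m\<in>UNIV.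
     eps i r s * x r * (eps j l m * (x l * ww s m)))" for i j
  have PP: "fun_act D (P i) (fun_act D (P j) f) p =
     d i j + (1/2) * A j i + (1/2) * (\<Sum>m\<in>UNIV. eps j i m * w m) + (1/2) * A i j + (1/4) * B i j" for i j
  proof -
    have "(\<Sum>l\<in>UNIV. \<Sum>m\<in>UNIV. eps j l m * (of_real ((axis i 1 :: real ^ 3) $ l) * w m)) =
        (\<Sum>m\<in>UNIV. eps j i m * w m)"
      by (subst sum.swap, intro sum.cong refl)
        (simp add: axis_def if_distrib[of of_real] if_distrib[of "\<lambda>x. x * _"] if_distrib[of "\<lambda>x. _ * x"]
          cong: if_cong)
    then have 1: "pderiv_on D (axis i 1, 0) (fun_act D (P j) f) p =
      d i j + (1/2) * A j i + (1/2) * (\<Sum>m\<in>UNIV. eps j i m * w m)"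
      unfolding pderiv_P[OF f D] d_def A_def x_def dw_def w_def
      by (simp add: distrib_left sum.distrib)
    have 2: "pderiv_on D (0, axis s 1) (fun_act D (P j) f) p =
      dw j s + (1/2) * (\<Sum>l\<in>UNIV. \<Sum>m\<in>UNIV. eps j l m * (x l * ww s m))" for s
      unfolding pderiv_P[OF f D] x_def ww_def wd by simp
    have "(\<Sum>r\<in>UNIV. \<Sum>s\<in>UNIV. eps i r s * x r * pderiv_on D (0, axis s 1) (fun_act D (P j) f) p)
      = A i j + (1/2) * B i j"
      unfolding 2 A_def B_def by (simp add: distrib_left sum.distrib sum_distrib_left mult_ac)
    with 1 show ?thesis by (simp add: x_def)
  qed
  \<comment> \<open>The two operators enter through the index pairs \<open>(r, s)\<close> and
    \<open>(l, m)\<close>. Exchanging the pairs and using the symmetry of \<open>ww\<close>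
    exchanges \<open>i\<close> and \<open>j\<close>.\<close>
  have "B j i = B i j"
  proof -
    have "B j i = (\<Sum>r\<in>UNIV. \<Sum>s\<in>UNIV. \<Sum>l\<in>UNIV. \<Sum>m\<in>UNIV.
       eps i l m * x l * (eps j r s * (x r * ww m s)))"
      unfolding B_def by (simp add: mult_ac ww)
    also have "\<dots> = (\<Sum>r\<in>UNIV. \<Sum>l\<in>UNIV. \<Sum>s\<in>UNIV. \<Sum>m\<in>UNIV.
       eps i l m * x l * (eps j r s * (x r * ww m s)))"
      by (rule sum.cong[OF refl], rule sum.swap)
    also have "\<dots> = (\<Sum>l\<in>UNIV. \<Sum>r\<in>UNIV. \<Sum>s\<in>UNIV. \<Sum>m\<in>UNIV.
       eps i l m * x l * (eps j r s * (x r * ww m s)))"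
      by (rule sum.swap)
    also have "\<dots> = (\<Sum>l\<in>UNIV. \<Sum>r\<in>UNIV. \<Sum>m\<in>UNIV. \<Sum>s\<in>UNIV.
       eps i l m * x l * (eps j r s * (x r * ww m s)))"
      by (rule sum.cong[OF refl], rule sum.cong[OF refl], rule sum.swap)
    also have "\<dots> = B i j"
      unfolding B_def by (rule sum.cong[OF refl], rule sum.swap)
    finally show ?thesis .
  qed
  then show ?thesis
    unfolding PP w_def[symmetric] d[of j i]
    by (simp add: eps_swap[of j i] sum_negf)
qed

lemma fun_act_W_P:
  assumes f: "f \<in> Fun D" and D: "bounded D"
  shows "fun_act D (W i) (fun_act D (P j) f) = fun_act D (P j) (fun_act D (W i) f)"
  unfolding fun_act.simps(2)
  by (subst pderiv_P[OF f D]) (simp add: pderiv_commute[OF f axis_Basis(2), of "(axis _ 1, 0)" i]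
      pderiv_commute[OF f axis_Basis(2) axis_Basis(2), of i] mult.assoc fun_eq_iff)

lemma fun_act_P_coord:
  fixes c :: "pt \<Rightarrow> real"
  assumes f: "f \<in> Fun D" and c: "bounded_linear c"
  shows "fun_act D (P i) (\<lambda>p. of_real (c p) * f p) p = of_real (c p) * fun_act D (P i) f p +
    (of_real (c (axis i 1, 0)) + (1/2) * (\<Sum>j\<in>UNIV. \<Sum>k\<in>UNIV. eps i j k * of_real (fst p $ j)
       * of_real (c (0, axis k 1)))) * f p"
  unfolding fun_act.simps pderiv_coord[OF c f]
  by (simp add: algebra_simps sum.distrib sum_distrib_left)

lemma fun_act_P_X:
  assumes f: "f \<in> Fun D"
  shows "fun_act D (P i) (fun_act D (X 0 j) f) p =
    fun_act D (X 0 j) (fun_act D (P i) f) p + (if i = j then f p else 0)"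
  using fun_act_P_coord[OF f bounded_linear_fst_component, of i j p] by (simp add: axis_def)

lemma fun_act_P_Xs:
  assumes f: "f \<in> Fun D"
  shows "fun_act D (P i) (fun_act D (Xs 0 j) f) p =
    fun_act D (Xs 0 j) (fun_act D (P i) f) p + (\<Sum>k\<in>UNIV. - (1/2) * eps i j k * fun_act D (X 0 k) f p)"
proof -
  have 1: "(\<Sum>k\<in>UNIV. eps i l k * of_real (fst p $ l) * of_real (snd (0 :: real ^ 3, axis k 1 :: real ^ 3) $ j))
      = - (eps i j l * complex_of_real (fst p $ l))" for l
  proof -
    have "(\<Sum>k\<in>UNIV. eps i l k * of_real (fst p $ l) * of_real (snd (0 :: real ^ 3, axis k 1 :: real ^ 3) $ j))
      = (\<Sum>k\<in>UNIV. if k = j then eps i l k * complex_of_real (fst p $ l) else 0)"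
      by (intro sum.cong refl) (simp add: axis_def)
    then show ?thesis by (simp add: eps_perms(4)[of i j l])
  qed
  have "(\<Sum>k\<in>UNIV. - (1/2) * eps i j k * fun_act D (X 0 k) f p) =
     (1/2) * (\<Sum>l\<in>UNIV. - (eps i j l * complex_of_real (fst p $ l))) * f p"
    by (simp add: sum_distrib_left sum_distrib_right mult.assoc)
  then show ?thesis
    using fun_act_P_coord[OF f bounded_linear_snd_component, of i j p] unfolding 1 by simp
qed

lemma fun_act_W_X:
  assumes f: "f \<in> Fun D"
  shows "fun_act D (W i) (fun_act D (X 0 j) f) p = fun_act D (X 0 j) (fun_act D (W i) f) p"
  by (simp add: pderiv_coord[OF bounded_linear_fst_component f])

lemma fun_act_W_Xs:
  assumes f: "f \<in> Fun D"
  shows "fun_act D (W i) (fun_act D (Xs 0 j) f) p =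
    fun_act D (Xs 0 j) (fun_act D (W i) f) p + (if i = j then f p else 0)"
  by (simp add: pderiv_coord[OF bounded_linear_snd_component f] axis_def)

lemma fun_act_bracket:
  assumes f: "f \<in> Fun D" and D: "bounded D" and deg: "deg g = 0" "deg h = 0"
  shows "fun_act D g (fun_act D h f) p - fun_act D h (fun_act D g f) p =
    brv (\<lambda>k. fun_act D k f) g h p"
proof -
  note acts = fun_act_P_P[OF f D] fun_act_W_P[OF f D] fun_act_P_X[OF f] fun_act_P_Xs[OF f]
    fun_act_W_X[OF f] fun_act_W_Xs[OF f]
  have WW: "fun_act D (W i) (fun_act D (W j) f) = fun_act D (W j) (fun_act D (W i) f)" for i j
    unfolding fun_act.simps by (rule pderiv_commute[OF f]) simp_all

  have H: "fun_act D Hbar f = f" for f by simp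
  have XX: "fun_act D (X 0 i) (fun_act D (X 0 j) f) p = fun_act D (X 0 j) (fun_act D (X 0 i) f) p"
    "fun_act D (Xs 0 i) (fun_act D (Xs 0 j) f) p = fun_act D (Xs 0 j) (fun_act D (Xs 0 i) f) p"
    "fun_act D (Xs 0 i) (fun_act D (X 0 j) f) p = fun_act D (X 0 j) (fun_act D (Xs 0 i) f) p" for i j
    by simp_all
  show ?thesis
  proof (cases g)
    case Hbar
    then show ?thesis by (simp only: H brv_simps diff_self)
  next
    case (W i)
    then show ?thesis
      using deg by (cases h) (simp_all add: H WW[of _ i] acts(2,5,6) brv_simps del: fun_act.simps)
  next
    case (P i)
    show ?thesis
    proof (cases h)
      case (P j)
      then show ?thesis using acts(1)[of i j p] \<open>g = P i\<close> by (simp only: brv_simps fun_act.simps)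
    qed (use P deg in \<open>simp_all add: H acts(2-4) brv_simps del: fun_act.simps\<close>)
  next
    case (X n i)
    then have "g = X 0 i" using deg by simp
    then show ?thesis
      using deg by (cases h) (simp_all add: H acts(3,5) XX(1)[of i] XX(3) brv_simps del: fun_act.simps)
  next
    case (Xs n i)
    then have "g = Xs 0 i" using deg by simp
    then show ?thesis
      using deg by (cases h) (simp_all add: H acts(4,6) XX(2)[of i] XX(3) brv_simps brv_Xs_Xs sum_negf
          del: fun_act.simps)
  qed
qed

text \<open>
  \<open>dvn g u v\<close> is the value of the functional \<open>v\<close> at the image of the word \<open>u\<close> under the derivation of the
  tensor algebra that extends \<open>ad g\<close>.
\<close>

primrec dvn :: "gen \<Rightarrow> gen list \<Rightarrow> (gen list \<Rightarrow> 'p \<Rightarrow> complex) \<Rightarrow> 'p \<Rightarrow> complex" where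
  "dvn g [] v = (\<lambda>p. 0)"
| "dvn g (h # u) v = (\<lambda>p. brv (\<lambda>k. v (k # u)) g h p + dvn g u (\<lambda>w. v (h # w)) p)"

text \<open>\<open>dvn g u v\<close> evaluates \<open>v\<close> only at words as long as
  \<open>u\<close>. As a congruence rule this tells the termination proof of \<open>phi\<close> that
  the words in the recursive calls under \<open>dvn\<close> have the length of the tail.\<close>

lemma dvn_cong [fundef_cong]:
  "g = g' \<Longrightarrow> u = u' \<Longrightarrow> (\<And>w. length w = length u' \<Longrightarrow> v w = v' w) \<Longrightarrow> dvn g u v = dvn g' u' v'"
proof (induction u arbitrary: u' g' v v')
  case (Cons h u)
  have "dvn g u (\<lambda>w. v (h # w)) = dvn g u (\<lambda>w. v' (h # w))"
    by (rule Cons.IH) (use Cons.prems in auto)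
  moreover have "v (k # u) = v' (k # u)" for k
    by (rule Cons.prems) (use Cons.prems(2) in auto)
  ultimately show ?case using Cons.prems(1) by (simp flip: Cons.prems(2))
qed auto

text \<open>The vacuum component of \<open>u|f\<rangle>\<close>.\<close>

function phi :: "pt set \<Rightarrow> gen list \<Rightarrow> (pt \<Rightarrow> complex) \<Rightarrow> pt \<Rightarrow> complex" where
  "phi D [] f = f"
| "phi D (g # u) f =
     (if deg g < 0 then (\<lambda>p. 0) else if deg g = 0 then fun_act D g (phi D u f)
      else dvn g u (\<lambda>w. phi D w f))"
  by pat_completeness auto
termination by (relation "Wellfounded.measure (\<lambda>(D, u, f). length u)") auto

lemma brv_lincomb:
  "brv (\<lambda>k p. v k p + c * v' k p) g h = (\<lambda>p. brv v g h p + c * brv v' g h p)"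
  by (simp add: brv_def lin_def fun_eq_iff algebra_simps sum.distrib sum_distrib_left)

lemma brv_zero [simp]: "brv (\<lambda>k p. 0) g h = (\<lambda>p. 0)"
  by (simp add: brv_def lin_def)

lemma brv_cong:
  "(\<And>k. deg k = deg g + deg h \<Longrightarrow> v k = v' k) \<Longrightarrow> brv v g h = brv v' g h"
  unfolding brv_def lin_def by (intro ext sum.cong refl) (simp add: deg_bracket)

lemma brv_brv_swap:
  "brv (\<lambda>l. brv (\<lambda>k. V l k) g x) h y = brv (\<lambda>k. brv (\<lambda>l. V l k) h y) g x"
  unfolding brv_def lin_def sum_distrib_left
  by (rule ext, subst sum.swap) (simp add: mult.left_commute)

lemma dvn_lincomb:
  "dvn g u (\<lambda>w p. v w p + c * v' w p) = (\<lambda>p. dvn g u v p + c * dvn g u v' p)"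
  by (induction u arbitrary: v v') (simp_all add: brv_lincomb fun_eq_iff algebra_simps)

lemma dvn_add: "dvn g u (\<lambda>w p. v w p + v' w p) = (\<lambda>p. dvn g u v p + dvn g u v' p)"
  using dvn_lincomb[of g u v 1 v'] by simp

lemma dvn_zero [simp]: "dvn g u (\<lambda>w p. 0) = (\<lambda>p. 0)"
  by (induction u) simp_all

lemma dvn_append:
  "dvn g (u @ u') v = (\<lambda>p. dvn g u (\<lambda>w. v (w @ u')) p + dvn g u' (\<lambda>w. v (u @ w)) p)"
  by (induction u arbitrary: v) (simp_all add: fun_eq_iff)

lemma brv_dvn_swap:
  "dvn h u (\<lambda>w. brv (\<lambda>k. V k w) g x) = brv (\<lambda>k. dvn h u (V k)) g x"
proof (induction u arbitrary: V)
  case (Cons y u)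
  have "brv (\<lambda>k. dvn h (y # u) (V k)) g x =
    (\<lambda>p. brv (\<lambda>k. brv (\<lambda>l. V k (l # u)) h y) g x p + brv (\<lambda>k. dvn h u (\<lambda>w. V k (y # w))) g x p)"
    using brv_lincomb[of "\<lambda>k. brv (\<lambda>l. V k (l # u)) h y" 1 "\<lambda>k. dvn h u (\<lambda>w. V k (y # w))" g x]
    by simp
  also have "\<dots> = dvn h (y # u) (\<lambda>w. brv (\<lambda>k. V k w) g x)"
    by (simp add: Cons.IH brv_brv_swap[of "\<lambda>k l. V k (l # u)" h y g x])
  finally show ?case by simp
qed simp

lemma brv_add: "brv (\<lambda>k p. v k p + v' k p) g h p = brv v g h p + brv v' g h p"
  using brv_lincomb[of v "1" v' g h] by simp

text \<open>The commutator of two derivations extending \<open>ad\<close> extends \<open>ad\<close>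
  of the bracket: terms on different letters cancel, terms on the same letter give the Jacobi
  identity. Functionals compose contravariantly, which is why \<open>g\<close> and \<open>h\<close>
  are exchanged on the right.\<close>

lemma dvn_commutator:
  "dvn g u (\<lambda>w. dvn h w v) p - dvn h u (\<lambda>w. dvn g w v) p = brv (\<lambda>k. dvn k u v) h g p"
proof (induction u arbitrary: v)
  case (Cons x u)
  have expand: "dvn g (x # u) (\<lambda>w. dvn h w v) p =
     brv (brv (\<lambda>l. v (l # u)) h) g x p + brv (\<lambda>k. dvn h u (\<lambda>w. v (k # w))) g x p
     + brv (\<lambda>l. dvn g u (\<lambda>w. v (l # w))) h x p + dvn g u (\<lambda>w. dvn h w (\<lambda>w. v (x # w))) p" for g h
    by (simp add: brv_add dvn_add brv_dvn_swap)
  have "brv (\<lambda>k. dvn k (x # u) v) h g p =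
    brv (\<lambda>k. brv (\<lambda>l. v (l # u)) k x) h g p + brv (\<lambda>k. dvn k u (\<lambda>w. v (x # w))) h g p"
    by (simp add: brv_add)
  then show ?case
    unfolding expand
    using Cons.IH[of "\<lambda>w. v (x # w)"] Jacobi[of "\<lambda>l. v (l # u)" h g x p] by simp
qed simp

lemma Fun_lin: "(\<And>k. v k \<in> Fun D) \<Longrightarrow> lin v t \<in> Fun D"
  unfolding lin_def by (intro Fun_sum Fun_scale)

lemma Fun_brv: "(\<And>k. v k \<in> Fun D) \<Longrightarrow> brv v g h \<in> Fun D"
  unfolding brv_def by (rule Fun_lin)

lemma fun_act_sum:
  assumes "\<And>i. i \<in> I \<Longrightarrow> v i \<in> Fun D"
  shows "fun_act D g (\<lambda>p. \<Sum>i\<in>I. c i * v i p) = (\<lambda>p. \<Sum>i\<in>I. c i * fun_act D g (v i) p)"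
  using assms
proof (induction I rule: infinite_finite_induct)
  case (insert i I)
  then show ?case
    using fun_act_lincomb[of "\<lambda>p. \<Sum>i\<in>I. c i * v i p" D "v i" g "c i"]
    by (simp add: Fun_sum Fun_scale add.commute)
qed (use fun_act_lincomb[OF Fun_zero Fun_zero, of D g 1] in \<open>auto simp: fun_eq_iff\<close>)

lemma fun_act_lin: "(\<And>k. v k \<in> Fun D) \<Longrightarrow> fun_act D g (lin v t) = lin (\<lambda>k. fun_act D g (v k)) t"
  unfolding lin_def by (rule fun_act_sum)

lemma fun_act_brv: "(\<And>k. v k \<in> Fun D) \<Longrightarrow> fun_act D g (brv v a b) = brv (\<lambda>k. fun_act D g (v k)) a b"
  unfolding brv_def by (rule fun_act_lin)

lemma fun_act_add:
  "f \<in> Fun D \<Longrightarrow> h \<in> Fun D \<Longrightarrow> fun_act D g (\<lambda>p. f p + h p) = (\<lambda>p. fun_act D g f p + fun_act D g h p)"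
  using fun_act_lincomb[of f D h g 1] by simp

lemma fun_act_zero: "fun_act D g (\<lambda>p. 0) = (\<lambda>p. 0)"
  using fun_act_sum[of "{}" _ D g] by simp

lemma Fun_dvn: "(\<And>w. v w \<in> Fun D) \<Longrightarrow> dvn g u v \<in> Fun D"
  by (induction u arbitrary: v) (simp_all add: Fun_zero Fun_add Fun_brv)

lemma fun_act_dvn:
  "(\<And>w. v w \<in> Fun D) \<Longrightarrow> fun_act D g (dvn h u v) = dvn h u (\<lambda>w. fun_act D g (v w))"
proof (induction u arbitrary: v)
  case (Cons x u)
  then show ?case
    by (simp add: fun_act_add Fun_brv Fun_dvn fun_act_brv)
qed (simp add: fun_act_zero)

lemma Fun_dvn_length:
  "(\<And>w. length w = length u \<Longrightarrow> v w \<in> Fun D) \<Longrightarrow> dvn g u v \<in> Fun D"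
  by (induction u arbitrary: v) (simp_all add: Fun_zero Fun_add Fun_brv)

lemma Fun_phi:
  assumes D: "bounded D" and f: "f \<in> Fun D"
  shows "phi D u f \<in> Fun D"
proof (induction "length u" arbitrary: u rule: less_induct)
  case less
  show ?case
  proof (cases u)
    case (Cons g u')
    have "phi D w f \<in> Fun D" if "length w \<le> length u'" for w
      by (rule less) (use that Cons in simp)
    then show ?thesis using Cons D by (auto simp: Fun_zero fun_act_Fun intro!: Fun_dvn_length)
  qed (use f in simp)
qed

lemma phi_lincomb:
  assumes D: "bounded D" and f: "f \<in> Fun D" and h: "h \<in> Fun D"
  shows "phi D u (\<lambda>p. f p + c * h p) = (\<lambda>p. phi D u f p + c * phi D u h p)"
proof (induction "length u" arbitrary: u rule: less_induct)
  case less
  show ?case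
  proof (cases u)
    case (Cons g u')
    have IH: "phi D w (\<lambda>p. f p + c * h p) = (\<lambda>p. phi D w f p + c * phi D w h p)"
      if "length w = length u'" for w
      by (rule less) (use that Cons in simp)
    have "dvn g u' (\<lambda>w. phi D w (\<lambda>p. f p + c * h p)) =
      dvn g u' (\<lambda>w p. phi D w f p + c * phi D w h p)"
      by (rule dvn_cong) (auto simp: IH)
    then show ?thesis
      using Cons IH[of u']
      by (auto simp: dvn_lincomb fun_act_lincomb Fun_phi D f h)
  qed simp
qed

lemma phi_neg [simp]: "deg g < 0 \<Longrightarrow> phi D (g # u) f = (\<lambda>p. 0)"
  by simp

lemma phi_zero_mode: "deg g = 0 \<Longrightarrow> phi D (g # u) f = fun_act D g (phi D u f)"
  by simp

lemma phi_pos: "deg g > 0 \<Longrightarrow> phi D (g # u) f = dvn g u (\<lambda>w. phi D w f)"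
  by simp

declare phi.simps(2) [simp del]

text \<open>Compatibility with the relations \<open>induce\<close>, by which the last letter acts on
  the function. The recursion of \<open>phi\<close> consumes a word from the left, so this is an
  induction over all words of smaller length.\<close>

lemma phi_snoc:
  assumes D: "bounded D" and f: "f \<in> Fun D" and g: "deg g \<ge> 0"
  shows "phi D (u @ [g]) f = phi D u (fun_act D g f)"
  using g
proof (induction "length u" arbitrary: u g rule: less_induct)
  case less
  note D[simp] f[simp]
  have fz: "fun_act D g f = (\<lambda>p. 0)" if "deg g > 0" for g
    using that by (cases g) (auto simp: zero_fun_def)
  have p0: "phi D u (\<lambda>p. 0) = (\<lambda>p. 0)" for u
    using phi_lincomb[OF D Fun_zero f, of u "0"] phi_lincomb[OF D Fun_zero Fun_zero, of u "-1"] by simp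
  show ?case
  proof (cases u)
    case Nil
    then show ?thesis
      using less.prems fz by (cases "deg g = 0") (auto simp: phi_zero_mode phi_pos)
  next
    case (Cons a v)
    have IH: "phi D (w @ [k]) f = phi D w (fun_act D k f)" if "length w = length v" "deg k \<ge> 0" for w k
      by (rule less.hyps) (use that Cons in auto)
    consider "deg a < 0" | "deg a = 0" | "deg a > 0" by linarith
    then show ?thesis
    proof cases
      case 3
      \<comment> \<open>The bracket of \<open>a\<close> with the last letter has positive degree; by
        the induction hypothesis it acts at the end of the word by zero.\<close>
      have "brv (\<lambda>k. phi D (v @ [k]) f) a g = brv (\<lambda>k p. 0) a g"
        by (rule brv_cong) (use IH[of v] 3 less.prems in \<open>simp add: fz p0\<close>)
      moreover have "dvn a v (\<lambda>w. phi D (w @ [g]) f) = dvn a v (\<lambda>w. phi D w (fun_act D g f))"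
        by (rule dvn_cong) (auto simp: IH less.prems)
      ultimately show ?thesis using 3 Cons by (simp add: phi_pos dvn_append)
    qed (use Cons IH[of v g] less.prems in \<open>simp_all add: phi_zero_mode\<close>)
  qed
qed

text \<open>The signs of the degrees decide what is needed: \<open>fun_act_bracket\<close> for two
  zero modes, \<open>dvn_commutator\<close> for two annihilation operators, linearity of the action
  for an annihilation operator and a zero mode. With a creation operator, every word that it leads
  vanishes and the rest is the definition of \<open>dvn\<close>.\<close>

lemma phi_comm_Nil:
  assumes D: "bounded D" and f: "f \<in> Fun D"
  shows "phi D (g # h # w) f p - phi D (h # g # w) f p = brv (\<lambda>k. phi D (k # w) f) g h p"
proof -
  note D[simp] f[simp]
  have main: "phi D (g # h # w) f p - phi D (h # g # w) f p = brv (\<lambda>k. phi D (k # w) f) g h p"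
    if le: "deg h \<le> deg g" for g h
  proof -
    consider "deg g < 0" | "deg g = 0" "deg h < 0" | "deg g = 0" "deg h = 0" | "deg g > 0" "deg h < 0"
      | "deg g > 0" "deg h = 0" | "deg g > 0" "deg h > 0" using le by linarith
    then show ?thesis
    proof cases
      case 1
      then have "brv (\<lambda>k. phi D (k # w) f) g h = brv (\<lambda>k p. 0) g h"
        by (intro brv_cong) (use le in simp)
      then show ?thesis using 1 le by simp
    next
      case 2
      then have "brv (\<lambda>k. phi D (k # w) f) g h = brv (\<lambda>k p. 0) g h"
        by (intro brv_cong) simp
      then show ?thesis using 2 by (simp add: phi_zero_mode fun_act_zero)
    next
      case 3
      then have "brv (\<lambda>k. phi D (k # w) f) g h = brv (\<lambda>k. fun_act D k (phi D w f)) g h"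
        by (intro brv_cong) (simp add: phi_zero_mode)
      then show ?thesis using 3 fun_act_bracket[OF Fun_phi[OF D f] D 3]
        by (simp add: phi_zero_mode)
    next
      case 4
      then show ?thesis by (simp add: phi_pos)
    next
      case 5
      then show ?thesis by (simp add: phi_pos phi_zero_mode fun_act_dvn Fun_phi)
    next
      case 6
      have "brv (\<lambda>k. phi D (k # w) f) g h = brv (\<lambda>k. dvn k w (\<lambda>w. phi D w f)) g h"
        by (intro brv_cong) (use 6 in \<open>simp add: phi_pos\<close>)
      moreover have "phi D (g # h # w) f p = brv (\<lambda>k. phi D (k # w) f) g h p +
         dvn g w (\<lambda>w. dvn h w (\<lambda>w. phi D w f)) p" if "deg g > 0" "deg h > 0" for g h
        using that by (simp add: phi_pos)
      ultimately show ?thesis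
        using 6 dvn_commutator[of g w h "\<lambda>w. phi D w f" p]
          brv_antisym[of "\<lambda>k. phi D (k # w) f" h g p] brv_antisym[of "\<lambda>k. dvn k w (\<lambda>w. phi D w f)" h g p]
        by simp
    qed
  qed
  show ?thesis
  proof (cases "deg h \<le> deg g")
    case False
    then show ?thesis
      using main[of g h] brv_antisym[of "\<lambda>k. phi D (k # w) f" h g p] by (simp add: algebra_simps)
  qed (rule main)
qed

text \<open>Induction on the number of letters around the pair. A leading annihilation operator acts
  as a derivation on prefix, pair and suffix. The terms on prefix and suffix are instances of the
  induction hypothesis; those on the pair need in addition the Jacobi identity.\<close>

lemma phi_comm:
  assumes D: "bounded D" and f: "f \<in> Fun D"
  shows "phi D (u @ g # h # w) f p - phi D (u @ h # g # w) f p = brv (\<lambda>k. phi D (u @ k # w) f) g h p"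
proof (induction "length u + length w" arbitrary: u g h w p rule: less_induct)
  case less
  note D[simp] f[simp]
  show ?case
  proof (cases u)
    case Nil then show ?thesis using phi_comm_Nil[OF D f] by simp
  next
    case (Cons a v)
    have IH: "phi D (x @ g # h # y) f = (\<lambda>p. phi D (x @ h # g # y) f p + brv (\<lambda>k. phi D (x @ k # y) f) g h p)"
      if "length x + length y = length v + length w" for x y g h
    proof
      fix p
      show "phi D (x @ g # h # y) f p = phi D (x @ h # g # y) f p + brv (\<lambda>k. phi D (x @ k # y) f) g h p"
        using less.hyps[of x y g h p] that Cons by (simp add: diff_eq_eq add.commute)
    qed
    consider "deg a < 0" | "deg a = 0" | "deg a > 0" by linarith
    then show ?thesis
    proof cases
      case 2
      then show ?thesis
        using Cons by (simp add: phi_zero_mode IH[of v w g h] fun_act_add Fun_phi Fun_brv fun_act_brv)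
    next
      case 3
      have 1: "dvn a v (\<lambda>x. phi D (x @ g # h # w) f) p = dvn a v (\<lambda>x. phi D (x @ h # g # w) f) p
          + brv (\<lambda>k. dvn a v (\<lambda>x. phi D (x @ k # w) f)) g h p"
      proof -
        have "dvn a v (\<lambda>x. phi D (x @ g # h # w) f) =
          dvn a v (\<lambda>x p. phi D (x @ h # g # w) f p + brv (\<lambda>k. phi D (x @ k # w) f) g h p)"
          by (rule dvn_cong) (auto intro!: IH)
        then show ?thesis by (simp add: dvn_add brv_dvn_swap[of a v "\<lambda>k x. phi D (x @ k # w) f" g h])
      qed
      have 2: "dvn a w (\<lambda>x. phi D (v @ g # h # x) f) p = dvn a w (\<lambda>x. phi D (v @ h # g # x) f) p
          + brv (\<lambda>k. dvn a w (\<lambda>x. phi D (v @ k # x) f)) g h p"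
      proof -
        have "dvn a w (\<lambda>x. phi D (v @ g # h # x) f) =
          dvn a w (\<lambda>x p. phi D (v @ h # g # x) f p + brv (\<lambda>k. phi D (v @ k # x) f) g h p)"
          by (rule dvn_cong) (auto intro!: IH)
        then show ?thesis by (simp add: dvn_add brv_dvn_swap[of a w "\<lambda>k x. phi D (v @ k # x) f" g h])
      qed
      have 3: "brv (\<lambda>k. phi D (v @ k # h # w) f) a g p = brv (\<lambda>k. phi D (v @ h # k # w) f) a g p
          + brv (\<lambda>k. brv (\<lambda>l. phi D (v @ l # w) f) k h) a g p"
        using brv_add[of "\<lambda>k. phi D (v @ h # k # w) f" "\<lambda>k. brv (\<lambda>l. phi D (v @ l # w) f) k h" a g p]
        by (simp add: IH[of v w _ h])
      have 4: "brv (\<lambda>k. phi D (v @ g # k # w) f) a h p = brv (\<lambda>k. phi D (v @ k # g # w) f) a h p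
          + brv (brv (\<lambda>l. phi D (v @ l # w) f) g) a h p"
        using brv_add[of "\<lambda>k. phi D (v @ k # g # w) f" "brv (\<lambda>l. phi D (v @ l # w) f) g" a h p]
        by (simp add: IH[of v w g])
      have pos: "phi D (u @ r) f p = dvn a v (\<lambda>x. phi D (x @ r) f) p + dvn a r (\<lambda>x. phi D (v @ x) f) p" for r
        using \<open>deg a > 0\<close> Cons by (simp add: phi_pos dvn_append)
      have "brv (\<lambda>k. phi D (u @ k # w) f) g h p = brv (\<lambda>k. dvn a v (\<lambda>x. phi D (x @ k # w) f)) g h p
         + brv (brv (\<lambda>l. phi D (v @ l # w) f) a) g h p
         + brv (\<lambda>k. dvn a w (\<lambda>x. phi D (v @ k # x) f)) g h p"
      proof -
        have "phi D (u @ k # w) f = (\<lambda>p. dvn a v (\<lambda>x. phi D (x @ k # w) f) p +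
           (brv (\<lambda>l. phi D (v @ l # w) f) a k p + dvn a w (\<lambda>x. phi D (v @ k # x) f) p))" for k
          using \<open>deg a > 0\<close> Cons by (simp add: phi_pos dvn_append)
        then show ?thesis by (simp add: brv_add)
      qed
      then show ?thesis
        unfolding pos using 1 2 3 4 Jacobi[of "\<lambda>l. phi D (v @ l # w) f" a g h p] by simp
    qed (use Cons in simp)
  qed
qed

section \<open>The induced module\<close>

abbreviation wdeg :: "gen list \<Rightarrow> int" where "wdeg u \<equiv> sum_list (map deg u)"

lemma dvn_cong_deg:
  "(\<And>w. length w = length u \<Longrightarrow> wdeg w = deg g + wdeg u \<Longrightarrow> v w = v' w) \<Longrightarrow> dvn g u v = dvn g u v'"
proof (induction u arbitrary: v v')
  case (Cons h u)
  have "dvn g u (\<lambda>w. v (h # w)) = dvn g u (\<lambda>w. v' (h # w))"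
    by (rule Cons.IH) (use Cons.prems in auto)
  moreover have "brv (\<lambda>k. v (k # u)) g h = brv (\<lambda>k. v' (k # u)) g h"
    by (rule brv_cong) (use Cons.prems in auto)
  ultimately show ?case by simp
qed simp

lemma phi_wdeg_neg: "wdeg u < 0 \<Longrightarrow> phi D u f = (\<lambda>p. 0)"
proof (induction "length u" arbitrary: u rule: less_induct)
  case less
  then obtain a v where u: "u = a # v" by (cases u) auto
  consider "deg a < 0" | "deg a = 0" | "deg a > 0" by linarith
  then show ?case
  proof cases
    case 2
    then show ?thesis using less u by (simp add: phi_zero_mode fun_act_zero)
  next
    case 3
    have "dvn a v (\<lambda>w. phi D w f) = dvn a v (\<lambda>w p. 0)"
      by (rule dvn_cong_deg) (use less u in auto)
    then show ?thesis using 3 u by (simp add: phi_pos)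
  qed (use u in simp)
qed

lemma Fun_0: "0 \<in> Fun D"
  using Fun_zero[of D] by (simp add: zero_fun_def)

lemma phi_0:
  assumes "bounded D"
  shows "phi D u 0 = 0"
  using phi_lincomb[OF assms Fun_zero Fun_zero, of u "-1"] by (simp add: zero_fun_def)

lemma phi_scale:
  assumes "bounded D" "f \<in> Fun D"
  shows "phi D u (\<lambda>p. c * f p) = (\<lambda>p. c * phi D u f p)"
  using phi_lincomb[OF assms(1) Fun_zero assms(2), of u c] phi_0[OF assms(1), of u]
  by (simp add: zero_fun_def)

lemma phi_diff:
  assumes "bounded D" "f \<in> Fun D" "h \<in> Fun D"
  shows "phi D u (f - h) = phi D u f - phi D u h"
  using phi_lincomb[OF assms, of u "-1"] by (simp add: fun_diff_def)

lemma Tens_single: "f \<in> Fun D \<Longrightarrow> Poly_Mapping.single u f \<in> Tens D"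
  by (auto simp: Tens_def lookup_single when_def Fun_0)

lemma Tens_diff: "s \<in> Tens D \<Longrightarrow> t \<in> Tens D \<Longrightarrow> s - t \<in> Tens D"
  by (auto simp: Tens_def lookup_minus fun_diff_def intro!: Fun_diff)

lemma Tens_zero: "0 \<in> Tens D"
  by (auto simp: Tens_def Fun_0)

lemma Tens_add: "s \<in> Tens D \<Longrightarrow> t \<in> Tens D \<Longrightarrow> s + t \<in> Tens D"
  by (auto simp: Tens_def lookup_add plus_fun_def intro!: Fun_add)

lemma Tens_sum: "(\<And>i. i \<in> I \<Longrightarrow> t i \<in> Tens D) \<Longrightarrow> (\<Sum>i\<in>I. t i) \<in> Tens D"
  by (induction I rule: infinite_finite_induct) (auto intro: Tens_zero Tens_add)

text \<open>The linear extension of \<open>phi\<close> to tensors. It vanishes on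
  \<open>Rels\<close> and recovers \<open>h\<close> from the empty word tensored with
  \<open>h\<close>, so it separates vacuum vectors.\<close>

definition ev :: "pt set \<Rightarrow> (gen list \<Rightarrow>\<^sub>0 (pt \<Rightarrow> complex)) \<Rightarrow> pt \<Rightarrow> complex" where
  "ev D t = (\<Sum>u\<in>Poly_Mapping.keys t. phi D u (Poly_Mapping.lookup t u))"

lemma ev_superset:
  "bounded D \<Longrightarrow> finite A \<Longrightarrow> Poly_Mapping.keys t \<subseteq> A \<Longrightarrow> ev D t = (\<Sum>u\<in>A. phi D u (Poly_Mapping.lookup t u))"
  unfolding ev_def by (rule sum.mono_neutral_left) (auto simp: in_keys_iff phi_0)

lemma ev_diff:
  assumes D: "bounded D" and st: "s \<in> Tens D" "t \<in> Tens D"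
  shows "ev D (s - t) = ev D s - ev D t"
proof -
  let ?A = "Poly_Mapping.keys s \<union> Poly_Mapping.keys t"
  have "ev D u = (\<Sum>w\<in>?A. phi D w (Poly_Mapping.lookup u w))" if "Poly_Mapping.keys u \<subseteq> ?A" for u
    by (rule ev_superset) (use that D in auto)
  moreover have "Poly_Mapping.keys (s - t) \<subseteq> ?A" by (auto simp: in_keys_iff lookup_minus)
  ultimately show ?thesis
    using st by (simp add: lookup_minus phi_diff[OF D] Tens_def sum_subtractf)
qed

lemma ev_single: "bounded D \<Longrightarrow> ev D (Poly_Mapping.single u f) = phi D u f"
  by (subst ev_superset[of _ "{u}"]) auto

lemma ev_zero: "ev D 0 = 0"
  by (simp add: ev_def)

lemma ev_add:
  assumes "bounded D" "s \<in> Tens D" "t \<in> Tens D"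
  shows "ev D (s + t) = ev D s + ev D t"
  using ev_diff[OF assms(1) Tens_add[OF assms(2,3)] assms(3)] by simp

lemma ev_sum:
  assumes "bounded D" "\<And>i. i \<in> I \<Longrightarrow> t i \<in> Tens D"
  shows "ev D (\<Sum>i\<in>I. t i) = (\<Sum>i\<in>I. ev D (t i))"
  using assms(2)
  by (induction I rule: infinite_finite_induct) (auto simp: ev_zero ev_add assms(1) Tens_sum)

lemma sum_fun_apply: "(\<Sum>i\<in>I. f i) p = (\<Sum>i\<in>I. f i p)" for f :: "_ \<Rightarrow> _ \<Rightarrow> _::comm_monoid_add"
  by (induction I rule: infinite_finite_induct) auto

text \<open>The two families of relations are handled by \<open>phi_comm\<close> and
  \<open>phi_snoc\<close>. Membership in \<open>Tens\<close> is carried along because the additivity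
  of \<open>ev\<close> is available only there.\<close>

lemma ev_Rels:
  assumes D: "bounded D"
  shows "t \<in> Rels D \<Longrightarrow> t \<in> Tens D \<and> ev D t = 0"
proof (induction rule: Rels.induct)
  case (comm f u g h v)
  have T: "Poly_Mapping.single w (\<lambda>p. c * f p) \<in> Tens D" for w c
    by (intro Tens_single Fun_scale comm)
  have T': "Poly_Mapping.single w f \<in> Tens D" for w
    by (intro Tens_single comm)
  have "phi D (u @ [g, h] @ v) f - phi D (u @ [h, g] @ v) f =
    (\<Sum>k\<in>Poly_Mapping.keys (bracket g h). phi D (u @ [k] @ v) (\<lambda>p. Poly_Mapping.lookup (bracket g h) k * f p))"
  proof
    fix p
    show "(phi D (u @ [g, h] @ v) f - phi D (u @ [h, g] @ v) f) p =
      (\<Sum>k\<in>Poly_Mapping.keys (bracket g h).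
        phi D (u @ [k] @ v) (\<lambda>p. Poly_Mapping.lookup (bracket g h) k * f p)) p"
      using phi_comm[OF D comm, of u g h v p]
      by (simp add: brv_def lin_def phi_scale[OF D comm] sum_fun_apply)
  qed
  then show ?case
    by (simp add: Tens_diff Tens_sum T T' ev_diff ev_sum ev_single D del: append.simps append_Cons)
next
  case (induce f g u)
  then show ?case
    by (simp add: Tens_diff Tens_single fun_act_Fun D ev_diff ev_single phi_snoc)
qed (auto simp: Tens_zero ev_zero Tens_diff ev_diff D)

lemma Rels_uminus: "t \<in> Rels D \<Longrightarrow> - t \<in> Rels D"
  using Rels.diff[OF Rels.zero] by fastforce

lemma Rels_add: "s \<in> Rels D \<Longrightarrow> t \<in> Rels D \<Longrightarrow> s + t \<in> Rels D"
  using Rels.diff[OF _ Rels_uminus] by fastforce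

section \<open>Grading and action on the quotient by the relations\<close>

lemma lookup_degree_zero_part:
  "Poly_Mapping.lookup (degree_zero_part t) u = (if wdeg u = 0 then Poly_Mapping.lookup t u else 0)"
  by (simp add: degree_zero_part_def lookup_sum lookup_single when_def in_keys_iff)

lemma degree_zero_part_diff: "degree_zero_part (s - t) = degree_zero_part s - degree_zero_part t"
  by (rule poly_mapping_eqI) (simp add: lookup_degree_zero_part lookup_minus)

lemma degree_zero_part_sum: "degree_zero_part (\<Sum>i\<in>I. t i) = (\<Sum>i\<in>I. degree_zero_part (t i))"
  by (rule poly_mapping_eqI) (simp add: lookup_degree_zero_part lookup_sum)

lemma degree_zero_part_zero [simp]: "degree_zero_part 0 = 0"
  by (rule poly_mapping_eqI) (simp add: lookup_degree_zero_part)

lemma degree_zero_part_single: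
  "degree_zero_part (Poly_Mapping.single u f) = (if wdeg u = 0 then Poly_Mapping.single u f else 0)"
  by (rule poly_mapping_eqI) (auto simp: lookup_degree_zero_part lookup_single when_def)

lemma degree_zero_part_Tens: "t \<in> Tens D \<Longrightarrow> degree_zero_part t \<in> Tens D"
  by (auto simp: Tens_def lookup_degree_zero_part Fun_0)

lemma fun_act_pos: "deg g > 0 \<Longrightarrow> fun_act D g f = 0"
  by (cases g) auto

text \<open>The relations are homogeneous: brackets respect the degree, and
  \<open>fun_act D g f\<close> is \<open>0\<close> when \<open>g\<close> has positive degree. Hence
  the projection to degree zero is well defined on classes.\<close>

lemma degree_zero_part_Rels: "t \<in> Rels D \<Longrightarrow> degree_zero_part t \<in> Rels D"
proof (induction rule: Rels.induct)
  case (comm f u g h v)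
  have d: "wdeg (u @ [k] @ v) = wdeg u + deg g + deg h + wdeg v" if "k \<in> Poly_Mapping.keys (bracket g h)" for k
    using deg_bracket[OF that] by simp
  have word: "degree_zero_part (Poly_Mapping.single (u @ [g, h] @ v) f) =
      (if wdeg u + deg g + deg h + wdeg v = 0 then Poly_Mapping.single (u @ [g, h] @ v) f else 0)"
    "degree_zero_part (Poly_Mapping.single (u @ [h, g] @ v) f) =
      (if wdeg u + deg g + deg h + wdeg v = 0 then Poly_Mapping.single (u @ [h, g] @ v) f else 0)"
    by (simp_all add: degree_zero_part_single ac_simps)
  have brk: "degree_zero_part (\<Sum>k\<in>Poly_Mapping.keys (bracket g h). Poly_Mapping.single (u @ [k] @ v) (c k)) =
     (if wdeg u + deg g + deg h + wdeg v = 0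
      then \<Sum>k\<in>Poly_Mapping.keys (bracket g h). Poly_Mapping.single (u @ [k] @ v) (c k) else 0)" for c
    unfolding degree_zero_part_sum degree_zero_part_single by (simp only: d cong: sum.cong) simp
  show ?case
    unfolding degree_zero_part_diff word brk using Rels.comm[OF comm] Rels.zero by simp
next
  case (induce f g u)
  then show ?case
    using Rels.induce[OF induce, of u] fun_act_pos[of g D f]
    by (cases "deg g = 0") (auto simp: degree_zero_part_diff degree_zero_part_single Rels.zero)
qed (auto simp: Rels.zero degree_zero_part_diff Rels.diff)

lemma lookup_prepend:
  "Poly_Mapping.lookup (prepend g t) u = (case u of [] \<Rightarrow> 0 | h # v \<Rightarrow> if h = g then Poly_Mapping.lookup t v else 0)"
  by (auto simp: prepend_def lookup_sum lookup_single when_def in_keys_iff split: list.split)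

lemma prepend_diff: "prepend g (s - t) = prepend g s - prepend g t"
  by (rule poly_mapping_eqI) (simp add: lookup_prepend lookup_minus split: list.split)

lemma prepend_sum: "prepend g (\<Sum>i\<in>I. t i) = (\<Sum>i\<in>I. prepend g (t i))"
  by (rule poly_mapping_eqI) (simp add: lookup_prepend lookup_sum split: list.split)

lemma prepend_zero [simp]: "prepend g 0 = 0"
  by (rule poly_mapping_eqI) (simp add: lookup_prepend split: list.split)

lemma prepend_single: "prepend g (Poly_Mapping.single u f) = Poly_Mapping.single (g # u) f"
  by (rule poly_mapping_eqI) (auto simp: lookup_prepend lookup_single when_def split: list.split)

lemma prepend_Tens: "t \<in> Tens D \<Longrightarrow> prepend g t \<in> Tens D"
  by (auto simp: Tens_def lookup_prepend Fun_0 split: list.split)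

lemma prepend_Rels: "t \<in> Rels D \<Longrightarrow> prepend a t \<in> Rels D"
proof (induction rule: Rels.induct)
  case (comm f u g h v)
  then show ?case
    using Rels.comm[OF comm, of "a # u" g h v]
    by (simp add: prepend_diff prepend_sum prepend_single)
next
  case (induce f g u)
  then show ?case
    using Rels.induce[OF induce, of "a # u"] by (simp add: prepend_diff prepend_single)
qed (auto simp: Rels.zero prepend_diff Rels.diff)

text \<open>Each transposition with the next letter costs only words that are one letter shorter and
  have the same total degree; these lie in \<open>M\<close> by hypothesis. In positive degree
  \<open>M\<close> will be \<open>Rels\<close> itself, in degree zero the tensors equivalent to a
  vacuum vector.\<close>

lemma move_to_end:
  assumes f: "f \<in> Fun D"
    and M: "0 \<in> M" "\<And>s t. s \<in> M \<Longrightarrow> t \<in> M \<Longrightarrow> s - t \<in> M" "Rels D \<subseteq> M"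
    and short: "\<And>w f. length w = length x + length v \<Longrightarrow> wdeg w = wdeg x + deg a + wdeg v \<Longrightarrow>
      f \<in> Fun D \<Longrightarrow> Poly_Mapping.single w f \<in> M"
  shows "Poly_Mapping.single (x @ a # v) f - Poly_Mapping.single (x @ v @ [a]) f \<in> M"
  using short
proof (induction v arbitrary: x)
  case (Cons h v)
  have add: "s + t \<in> M" if "s \<in> M" "t \<in> M" for s t
    using M(2)[OF that(1) M(2)[OF M(1) that(2)]] by simp
  let ?S = "\<Sum>k\<in>Poly_Mapping.keys (bracket a h).
    Poly_Mapping.single (x @ [k] @ v) (\<lambda>p. Poly_Mapping.lookup (bracket a h) k * f p)"
  have sum: "(\<Sum>i\<in>I. t i) \<in> M" if "\<And>i. i \<in> I \<Longrightarrow> t i \<in> M" for I and t :: "gen \<Rightarrow> _"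
    using that by (induction I rule: infinite_finite_induct) (auto intro: add M(1))
  have S: "?S \<in> M"
    by (rule sum, rule Cons.prems) (auto simp: deg_bracket f Fun_scale)
  have "Poly_Mapping.single (x @ [a, h] @ v) f - Poly_Mapping.single (x @ [h, a] @ v) f - ?S \<in> M"
    using Rels.comm[OF f] M(3) by blast
  from add[OF this S]
  have 1: "Poly_Mapping.single (x @ a # h # v) f - Poly_Mapping.single (x @ h # a # v) f \<in> M" by simp
  have "Poly_Mapping.single ((x @ [h]) @ a # v) f - Poly_Mapping.single ((x @ [h]) @ v @ [a]) f \<in> M"
    by (rule Cons.IH) (use Cons.prems in auto)
  from add[OF 1 this] show ?case by simp
qed (use M(1) in simp)

text \<open>The module has no nonzero vector of positive degree: a leading annihilation operator
  moves to the end and kills the function, and any other leading letter leaves a shorter tail of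
  positive degree.\<close>

lemma single_Rels_if_wdeg_pos: "f \<in> Fun D \<Longrightarrow> wdeg u > 0 \<Longrightarrow> Poly_Mapping.single u f \<in> Rels D"
proof (induction "length u" arbitrary: u f rule: less_induct)
  case less
  then obtain a v where u: "u = a # v" by (cases u) auto
  show ?case
  proof (cases "deg a > 0")
    case True
    have "Poly_Mapping.single ([] @ a # v) f - Poly_Mapping.single ([] @ v @ [a]) f \<in> Rels D"
      by (rule move_to_end) (use less u in \<open>auto intro: Rels.zero Rels.diff\<close>)
    moreover have "Poly_Mapping.single (v @ [a]) f \<in> Rels D"
      using Rels.induce[OF less(2), of a v] True by (simp add: fun_act_pos)
    ultimately show ?thesis using Rels_add u by fastforce
  next
    case False
    then have "Poly_Mapping.single v f \<in> Rels D" by (intro less) (use u less in auto)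
    then show ?thesis using prepend_Rels[of _ D a] u by (simp add: prepend_single[symmetric])
  qed
qed

text \<open>A leading creation operator leaves a tail of positive degree, which vanishes; a leading
  zero mode acts on the function found for the tail; a leading annihilation operator moves to the
  end.\<close>

lemma single_reduces_if_wdeg_zero:
  assumes D: "bounded D"
  shows "f \<in> Fun D \<Longrightarrow> wdeg u = 0 \<Longrightarrow>
    \<exists>h\<in>Fun D. Poly_Mapping.single u f - Poly_Mapping.single [] h \<in> Rels D"
proof (induction "length u" arbitrary: u f rule: less_induct)
  case less
  show ?case
  proof (cases u)
    case Nil then show ?thesis using less by (auto intro!: bexI[of _ f] Rels.zero)
  next
    case (Cons a v)
    consider "deg a < 0" | "deg a = 0" | "deg a > 0" by linarith
    then show ?thesis
    proof cases
      case 1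
      then have "Poly_Mapping.single v f \<in> Rels D"
        by (intro single_Rels_if_wdeg_pos) (use less Cons in auto)
      then have "Poly_Mapping.single u f \<in> Rels D"
        using prepend_Rels[of _ D a] Cons by (simp add: prepend_single[symmetric])
      then show ?thesis by (intro bexI[of _ 0]) (auto simp: Fun_0)
    next
      case 2
      then obtain h where h: "h \<in> Fun D" "Poly_Mapping.single v f - Poly_Mapping.single [] h \<in> Rels D"
        using less.hyps[of v f] less.prems Cons by auto
      from prepend_Rels[OF h(2), of a]
      have "Poly_Mapping.single u f - Poly_Mapping.single [a] h \<in> Rels D"
        by (simp add: prepend_diff prepend_single Cons)
      moreover have "Poly_Mapping.single [a] h - Poly_Mapping.single [] (fun_act D a h) \<in> Rels D"
        using Rels.induce[OF h(1), of a "[]"] 2 by simp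
      ultimately have "Poly_Mapping.single u f - Poly_Mapping.single [] (fun_act D a h) \<in> Rels D"
        using Rels_add by fastforce
      then show ?thesis using fun_act_Fun[OF D h(1)] by blast
    next
      case 3
      define M where "M = {t. \<exists>h\<in>Fun D. t - Poly_Mapping.single [] h \<in> Rels D}"
      have "Poly_Mapping.single ([] @ a # v) f - Poly_Mapping.single ([] @ v @ [a]) f \<in> M"
      proof (rule move_to_end)
        show "0 \<in> M" "Rels D \<subseteq> M" by (auto simp: M_def intro!: bexI[of _ 0] Fun_0 Rels.zero)
        show "s - t \<in> M" if st: "s \<in> M" "t \<in> M" for s t
        proof -
          obtain h k where hk: "h \<in> Fun D" "k \<in> Fun D" "s - Poly_Mapping.single [] h \<in> Rels D"
            "t - Poly_Mapping.single [] k \<in> Rels D" using st unfolding M_def by blast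
          have "s - t - Poly_Mapping.single [] (h - k) \<in> Rels D"
            using Rels.diff[OF hk(3,4)] by (simp add: single_diff algebra_simps)
          moreover have "h - k \<in> Fun D" using Fun_diff[OF hk(1,2)] by (simp add: fun_diff_def)
          ultimately show ?thesis unfolding M_def by blast
        qed
      qed (use less Cons in \<open>auto simp: M_def\<close>)
      then obtain h where h: "h \<in> Fun D"
        "Poly_Mapping.single u f - Poly_Mapping.single (v @ [a]) f - Poly_Mapping.single [] h \<in> Rels D"
        using Cons by (auto simp: M_def)
      have "Poly_Mapping.single (v @ [a]) f \<in> Rels D"
        using Rels.induce[OF less(2), of a v] 3 by (simp add: fun_act_pos)
      from Rels_add[OF h(2) this] h(1) show ?thesis by auto
    qed
  qed
qed

text \<open>The reduction yields a function without a formula. Applying \<open>ev\<close> to the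
  relation identifies it as \<open>phi D u f\<close>.\<close>

lemma single_phi_Rels:
  assumes D: "bounded D" and f: "f \<in> Fun D" and u: "wdeg u = 0"
  shows "Poly_Mapping.single u f - Poly_Mapping.single [] (phi D u f) \<in> Rels D"
proof -
  obtain h where h: "h \<in> Fun D" "Poly_Mapping.single u f - Poly_Mapping.single [] h \<in> Rels D"
    using single_reduces_if_wdeg_zero[OF D f u] by blast
  have "phi D u f - h = 0"
    using ev_Rels[OF D h(2)] by (simp add: ev_diff D Tens_single f h ev_single)
  then show ?thesis using h(2) by simp
qed

lemma phi_wdeg_nonzero:
  assumes "bounded D" "f \<in> Fun D" "wdeg u \<noteq> 0"
  shows "phi D u f = (\<lambda>p. 0)"
proof (cases "wdeg u < 0")
  case False
  then have "Poly_Mapping.single u f \<in> Rels D" using assms single_Rels_if_wdeg_pos[of f D u] by simp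
  then show ?thesis using ev_Rels[OF assms(1)] ev_single[OF assms(1)] by (metis zero_fun_def)
qed (rule phi_wdeg_neg)

lemma mod_rel_class_eq:
  assumes "s \<in> Tens D" "t \<in> Tens D"
  shows "mod_rel D `` {s} = mod_rel D `` {t} \<longleftrightarrow> s - t \<in> Rels D"
proof
  assume "mod_rel D `` {s} = mod_rel D `` {t}"
  moreover have "t \<in> mod_rel D `` {t}" using assms by (auto simp: mod_rel_def Rels.zero)
  ultimately show "s - t \<in> Rels D" by (auto simp: mod_rel_def)
next
  assume st: "s - t \<in> Rels D"
  have "s - u \<in> Rels D \<longleftrightarrow> t - u \<in> Rels D" for u
    using Rels_add[OF st, of "t - u"] Rels.diff[OF _ st, of "s - u"] by auto
  then show "mod_rel D `` {s} = mod_rel D `` {t}" using assms by (auto simp: mod_rel_def)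
qed

text \<open>The unions in \<open>act\<close> and \<open>vac_proj\<close> run over all
  representatives of a class. A map that respects differences and preserves the relations gives the
  same class at each of them, so the union collapses.\<close>

lemma mod_rel_class_Union:
  assumes t: "t \<in> Tens D"
    and F: "\<And>s. s \<in> Tens D \<Longrightarrow> F s \<in> Tens D" "\<And>s. s \<in> Rels D \<Longrightarrow> F s \<in> Rels D"
      "\<And>s t. F (s - t) = F s - F t"
  shows "(\<Union>s\<in>mod_rel D `` {t}. mod_rel D `` {F s}) = mod_rel D `` {F t}"
proof -
  have c: "mod_rel D `` {F s} = mod_rel D `` {F t}" if "s \<in> mod_rel D `` {t}" for s
  proof -
    have s: "s \<in> Tens D" "t - s \<in> Rels D" using that by (auto simp: mod_rel_def)
    have "F t - F s \<in> Rels D" using F(2)[OF s(2)] F(3) by simp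
    then show ?thesis using mod_rel_class_eq[OF F(1)[OF t] F(1)[OF s(1)]] by simp
  qed
  have m: "t \<in> mod_rel D `` {t}" using t by (auto simp: mod_rel_def Rels.zero)
  show ?thesis by (rule UN_constant_eq[OF m], rule ballI, rule c)
qed

lemma act_class:
  "t \<in> Tens D \<Longrightarrow> act D g (mod_rel D `` {t}) = mod_rel D `` {prepend g t}"
  unfolding act_def by (rule mod_rel_class_Union) (auto simp: prepend_Tens prepend_Rels prepend_diff)

lemma foldr_act_vac:
  "f \<in> Fun D \<Longrightarrow> foldr (act D) u (vac D f) = mod_rel D `` {Poly_Mapping.single u f}"
  by (induction u) (auto simp: vac_def act_class Tens_single prepend_single)

text \<open>Existence for the description in \<open>THE\<close> comes from
  \<open>single_phi_Rels\<close>, uniqueness from \<open>ev\<close>. For words of nonzero degree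
  both the degree-zero part and \<open>phi\<close> vanish.\<close>

lemma vac_proj_word:
  assumes D: "bounded D" and f: "f \<in> Fun D"
  shows "vac_proj D (foldr (act D) u (vac D f)) = phi D u f"
proof -
  let ?s = "Poly_Mapping.single u f"
  have s: "?s \<in> Tens D" using f by (rule Tens_single)
  have U: "(\<Union>t\<in>mod_rel D `` {?s}. mod_rel D `` {degree_zero_part t}) = mod_rel D `` {degree_zero_part ?s}"
    using s by (rule mod_rel_class_Union)
      (auto simp: degree_zero_part_Tens degree_zero_part_Rels degree_zero_part_diff)
  have phi: "phi D u f \<in> Fun D" by (rule Fun_phi[OF D f])
  have iff: "vac D h = mod_rel D `` {degree_zero_part ?s} \<longleftrightarrow>
      Poly_Mapping.single [] h - degree_zero_part ?s \<in> Rels D" if "h \<in> Fun D" for h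
    unfolding vac_def by (rule mod_rel_class_eq) (auto intro: Tens_single that degree_zero_part_Tens s)
  have ex: "Poly_Mapping.single [] (phi D u f) - degree_zero_part ?s \<in> Rels D"
  proof (cases "wdeg u = 0")
    case True
    then show ?thesis using Rels_uminus[OF single_phi_Rels[OF D f True]]
      by (simp add: degree_zero_part_single)
  next
    case False
    then have "phi D u f = 0" using phi_wdeg_nonzero[OF D f] by (simp add: zero_fun_def)
    then show ?thesis using False by (simp add: degree_zero_part_single Rels.zero)
  qed
  have un: "h = phi D u f" if h: "h \<in> Fun D" "Poly_Mapping.single [] h - degree_zero_part ?s \<in> Rels D" for h
  proof -
    have "Poly_Mapping.single [] h - Poly_Mapping.single [] (phi D u f) \<in> Rels D"
      using Rels.diff[OF h(2) ex] by simp
    from ev_Rels[OF D this] show ?thesis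
      by (simp add: ev_diff D Tens_single h phi ev_single)
  qed
  show ?thesis
    unfolding vac_proj_def foldr_act_vac[OF f] U
  proof (rule the_equality)
    show "phi D u f \<in> Fun D \<and> vac D (phi D u f) = mod_rel D `` {degree_zero_part ?s}"
      using iff[OF phi] ex phi by simp
    show "h = phi D u f" if "h \<in> Fun D \<and> vac D h = mod_rel D `` {degree_zero_part ?s}" for h
      using that iff[of h] un[of h] by simp
  qed
qed

lemma word_elem_eq:
  "bounded D \<Longrightarrow> f \<in> Fun D \<Longrightarrow> word_elem D \<psi> u f = l2_pairing D \<psi> (phi D u f)"
  by (simp add: word_elem_def bra_def vac_proj_word)

section \<open>Wick contraction\<close>

text \<open>Only additivity is assumed, so that the values may be functions on points with values in
  the formal scalars; the scalars themselves enter the ring as central elements.\<close>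

locale vev =
  fixes lam :: "'r::ring_1 \<Rightarrow> 'v::ab_group_add"
  assumes lam_add: "lam (x + y) = lam x + lam y"
begin

lemma lam_0: "lam 0 = 0"
  using lam_add[of 0 0] by simp

lemma lam_minus: "lam (- x) = - lam x"
  using lam_add[of x "- x"] by (simp add: lam_0 eq_neg_iff_add_eq_0 add.commute)

lemma lam_diff: "lam (x - y) = lam x - lam y"
  using lam_add[of x "- y"] by (simp add: lam_minus)

lemma lam_sum: "lam (\<Sum>i\<in>I. t i) = (\<Sum>i\<in>I. lam (t i))"
  by (induction I rule: infinite_finite_induct) (auto simp: lam_0 lam_add)

text \<open>
  The largest two-sided, left and right ideals on which \<open>lam\<close> vanishes; for vacuum expectations they
  contain the relations of the module, the annihilation and the creation operators, respectively.
\<close>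

definition nul :: "'r \<Rightarrow> bool" where "nul x \<longleftrightarrow> (\<forall>l r. lam (l * x * r) = 0)"
definition ann :: "'r \<Rightarrow> bool" where "ann x \<longleftrightarrow> (\<forall>l. lam (l * x) = 0)"
definition lnul :: "'r \<Rightarrow> bool" where "lnul x \<longleftrightarrow> (\<forall>r. lam (x * r) = 0)"

lemma nul_0 [simp]: "nul 0" by (simp add: nul_def lam_0)
lemma nul_add: "nul x \<Longrightarrow> nul y \<Longrightarrow> nul (x + y)"
  by (simp add: nul_def distrib_left distrib_right lam_add)
lemma nul_minus: "nul x \<Longrightarrow> nul (- x)" by (simp add: nul_def lam_minus)
lemma nul_mult: "nul x \<Longrightarrow> nul (a * x * b)"
  unfolding nul_def by (metis mult.assoc)
lemma nul_mult_left: "nul x \<Longrightarrow> nul (a * x)" using nul_mult[of x a 1] by simp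
lemma nul_mult_right: "nul x \<Longrightarrow> nul (x * b)" using nul_mult[of x 1 b] by simp
lemma nul_lam: "nul (x - y) \<Longrightarrow> lam (l * x * r) = lam (l * y * r)"
proof -
  assume "nul (x - y)"
  then have "lam (l * (x - y) * r) = 0" by (simp add: nul_def)
  then show ?thesis by (simp add: algebra_simps lam_diff)
qed

lemma ann_0 [simp]: "ann 0" by (simp add: ann_def lam_0)
lemma ann_add: "ann x \<Longrightarrow> ann y \<Longrightarrow> ann (x + y)"
  by (simp add: ann_def distrib_left lam_add)
lemma ann_mult: "ann x \<Longrightarrow> ann (a * x)" unfolding ann_def by (metis mult.assoc)
lemma ann_sum: "(\<And>i. i \<in> I \<Longrightarrow> ann (t i)) \<Longrightarrow> ann (\<Sum>i\<in>I. t i)"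
  by (induction I rule: infinite_finite_induct) (auto intro: ann_add)
lemma nul_imp_ann: "nul x \<Longrightarrow> ann x"
  unfolding nul_def ann_def by (metis mult.right_neutral)
lemma ann_cong: "nul (x - y) \<Longrightarrow> ann y \<Longrightarrow> ann x"
  using ann_add[of "x - y" y] nul_imp_ann by simp

lemma lnul_0 [simp]: "lnul 0" by (simp add: lnul_def lam_0)
lemma lnul_add: "lnul x \<Longrightarrow> lnul y \<Longrightarrow> lnul (x + y)"
  by (simp add: lnul_def distrib_right lam_add)
lemma lnul_mult: "lnul x \<Longrightarrow> lnul (x * a)" unfolding lnul_def by (metis mult.assoc)
lemma lnul_sum: "(\<And>i. i \<in> I \<Longrightarrow> lnul (t i)) \<Longrightarrow> lnul (\<Sum>i\<in>I. t i)"
  by (induction I rule: infinite_finite_induct) (auto intro: lnul_add)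

definition central :: "'r \<Rightarrow> bool" where "central s \<longleftrightarrow> (\<forall>x. s * x = x * s)"

text \<open>\<open>cm x y z\<close> says that \<open>[x, y] = z\<close> modulo the two-sided ideal \<open>nul\<close>.\<close>

definition cm :: "'r \<Rightarrow> 'r \<Rightarrow> 'r \<Rightarrow> bool" where "cm x y z \<longleftrightarrow> nul (x * y - y * x - z)"

lemma cm_sym: "cm x y z \<Longrightarrow> cm y x (- z)"
  unfolding cm_def using nul_minus[of "x * y - y * x - z"] by (simp add: algebra_simps)

lemma cm_sym0: "cm x y 0 \<Longrightarrow> cm y x 0"
  using cm_sym[of x y 0] by simp

lemma cm_add_left: "cm x y z \<Longrightarrow> cm x' y z' \<Longrightarrow> cm (x + x') y (z + z')"
  unfolding cm_def using nul_add[of "x * y - y * x - z" "x' * y - y * x' - z'"]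
  by (simp add: algebra_simps)

lemma cm_add_right: "cm x y z \<Longrightarrow> cm x y' z' \<Longrightarrow> cm x (y + y') (z + z')"
  unfolding cm_def using nul_add[of "x * y - y * x - z" "x * y' - y' * x - z'"]
  by (simp add: algebra_simps)

lemma cm_0_left [simp]: "cm 0 y 0" and cm_0_right [simp]: "cm x 0 0"
  by (simp_all add: cm_def)

lemma cm_sum_left: "(\<And>i. i \<in> I \<Longrightarrow> cm (x i) y (z i)) \<Longrightarrow> cm (\<Sum>i\<in>I. x i) y (\<Sum>i\<in>I. z i)"
  by (induction I rule: infinite_finite_induct) (auto intro: cm_add_left)

lemma cm_sum_right: "(\<And>i. i \<in> I \<Longrightarrow> cm x (y i) (z i)) \<Longrightarrow> cm x (\<Sum>i\<in>I. y i) (\<Sum>i\<in>I. z i)"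
  by (induction I rule: infinite_finite_induct) (auto intro: cm_add_right)

lemma cm_scale_left: "central s \<Longrightarrow> cm x y z \<Longrightarrow> cm (s * x) y (s * z)"
  unfolding cm_def central_def using nul_mult_left[of "x * y - y * x - z" s]
  by (simp add: algebra_simps)

lemma cm_scale_right: "central s \<Longrightarrow> cm x y z \<Longrightarrow> cm x (s * y) (s * z)"
  unfolding cm_def central_def using nul_mult_left[of "x * y - y * x - z" s]
  by (simp add: algebra_simps)

lemma cm_mult_left: "cm x y z \<Longrightarrow> cm x' y z' \<Longrightarrow> cm (x * x') y (x * z' + z * x')"
  unfolding cm_def
  using nul_add[OF nul_mult_left[of "x' * y - y * x' - z'" x] nul_mult_right[of "x * y - y * x - z" x']]
  by (simp add: algebra_simps)

lemma cm_mult_right: "cm x y z \<Longrightarrow> cm x y' z' \<Longrightarrow> cm x (y * y') (y * z' + z * y')"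
  unfolding cm_def
  using nul_add[OF nul_mult_left[of "x * y' - y' * x - z'" y] nul_mult_right[of "x * y - y * x - z" y']]
  by (simp add: algebra_simps)

lemma cm_1 [simp]: "cm x 1 0" by (simp add: cm_def)

lemma cm_congr: "cm x y z \<Longrightarrow> nul (z - z') \<Longrightarrow> cm x y z'"
  unfolding cm_def using nul_add[of "x * y - y * x - z" "z - z'"] by (simp add: algebra_simps)

lemma cm_power0: "cm x y 0 \<Longrightarrow> cm x (y ^ n) 0"
proof (induction n)
  case (Suc n)
  then show ?case using cm_mult_right[of x y 0 "y ^ n" 0] by simp
qed simp

lemma cm_power:
  assumes xy: "cm x y z" and zy: "cm z y 0"
  shows "cm x (y ^ n) (of_nat n * y ^ (n - 1) * z)"
proof (induction n)
  case (Suc n)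
  have "cm x (y * y ^ n) (y * (of_nat n * y ^ (n - 1) * z) + z * y ^ n)"
    by (rule cm_mult_right[OF xy Suc])
  moreover have "nul (y * (of_nat n * y ^ (n - 1) * z) + z * y ^ n - of_nat (Suc n) * y ^ n * z)"
  proof -
    have "y * (of_nat n * y ^ (n - 1) * z) = of_nat n * y ^ n * z"
    proof (cases n)
      case (Suc k)
      have "y * (of_nat n * (y ^ k * z)) = of_nat n * (y * (y ^ k * z))"
        by (metis mult.assoc mult_of_nat_commute)
      then show ?thesis by (simp add: Suc mult.assoc)
    qed simp
    moreover have "nul (z * y ^ n - y ^ n * z)"
      using cm_power0[OF zy, of n] by (simp add: cm_def)
    ultimately show ?thesis by (simp add: algebra_simps)
  qed
  ultimately show ?case by (auto intro: cm_congr)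
qed simp

end

text \<open>
  The elements \<open>Y\<^sub>+\<close> and \<open>Y\<^sub>-\<close> of the commutator \<open>[a, b]\<close> drop out of vacuum expectations because
  they can be moved to the right and to the left, respectively.
\<close>

lemma (in vev) lam_contraction:
  assumes a: "ann a" and b: "\<And>i. lnul (e ^ i * b)"
    and C: "cm a e C" "cm C e 0" "cm C b 0" "ann C"
    and Z: "cm a b (s * V + Yp + Ym)" and s: "central s"
    and V: "cm V b 0" "ann (V - d)" "central d"
    and Yp: "cm Yp b 0" "ann Yp"
    and Ym: "cm Ym b 0" "cm Ym e 0" "cm Ym a 0" "lnul Ym"
    and sd_lam: "\<And>x y. lam x = lam y \<Longrightarrow> lam (s * d * x) = lam (s * d * y)"
  shows "lam (a ^ k * e ^ i * b ^ l) = (if k = l then lam (of_nat (fact k) * (s * d) ^ k * e ^ i) else 0)"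
proof -
  have sd: "central (s * d)"
    using s V(3) unfolding central_def by (metis mult.assoc)
  \<comment> \<open>One \<open>a\<close> is moved to the right end. Its commutator \<open>C\<close>
    with \<open>e\<close> passes \<open>b\<close> and is annihilated. Its commutator with
    \<open>b ^ l\<close> produces \<open>l\<close> copies of \<open>?Z\<close>, of which only
    \<open>s * V\<close> survives, with \<open>V\<close> replaced by \<open>d\<close>. At
    \<open>l = 0\<close> the factor \<open>of_nat l\<close> makes the truncated exponent
    \<open>l - 1\<close> harmless.\<close>
  have step: "lam (a ^ Suc k * e ^ i * b ^ l) = lam (of_nat l * (s * d) * (a ^ k * e ^ i * b ^ (l - 1)))" for k l
  proof -
    let ?Z = "s * V + Yp + Ym"
    let ?A = "a ^ k * e ^ i"
    have Zb: "cm ?Z b 0"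
      using cm_add_left[OF cm_add_left[OF cm_scale_left[OF s V(1)] Yp(1)] Ym(1)] by simp
    have "lam (a ^ Suc k * e ^ i * b ^ l) = lam (a ^ k * (a * e ^ i) * b ^ l)"
      by (simp add: mult.assoc power_Suc2 del: power_Suc)
    also have "\<dots> = lam (a ^ k * (e ^ i * a + of_nat i * e ^ (i - 1) * C) * b ^ l)"
      by (rule nul_lam) (use cm_power[OF C(1,2), of i] in \<open>simp add: cm_def algebra_simps\<close>)
    also have "\<dots> = lam (?A * (a * b ^ l) * 1) + lam (a ^ k * of_nat i * e ^ (i - 1) * (C * b ^ l))"
      by (simp add: algebra_simps lam_add)
    also have "lam (a ^ k * of_nat i * e ^ (i - 1) * (C * b ^ l)) = 0"
    proof -
      have "ann (C * b ^ l)"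
        by (rule ann_cong[OF _ ann_mult[OF C(4)]]) (use cm_power0[OF C(3), of l] in \<open>simp add: cm_def\<close>)
      then show ?thesis by (simp add: ann_def)
    qed
    also have "lam (?A * (a * b ^ l) * 1) = lam (?A * (b ^ l * a + of_nat l * b ^ (l - 1) * ?Z) * 1)"
      by (rule nul_lam) (use cm_power[OF Z Zb, of l] in \<open>simp add: cm_def algebra_simps\<close>)
    also have "\<dots> = lam (?A * b ^ l * a) + lam (?A * (of_nat l * b ^ (l - 1)) * (s * V))
        + lam (?A * (of_nat l * b ^ (l - 1)) * Yp) + lam (?A * (of_nat l * b ^ (l - 1)) * Ym)"
      by (simp add: algebra_simps lam_add)
    also have "lam (?A * b ^ l * a) = 0" using a by (simp add: ann_def)
    also have "lam (?A * (of_nat l * b ^ (l - 1)) * Yp) = 0" using Yp(2) by (simp add: ann_def)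
    also have "lam (?A * (of_nat l * b ^ (l - 1)) * Ym) = 0"
    proof -
      have n: "cm Ym (of_nat l) 0" by (simp add: cm_def mult_of_nat_commute)
      have "cm Ym (?A * (of_nat l * b ^ (l - 1))) 0"
        using cm_mult_right[OF cm_mult_right[OF cm_power0[OF Ym(3), of k] cm_power0[OF Ym(2), of i]]
            cm_mult_right[OF n cm_power0[OF Ym(1), of "l - 1"]]] by simp
      then have "nul (?A * (of_nat l * b ^ (l - 1)) * Ym - Ym * (?A * (of_nat l * b ^ (l - 1))))"
        using cm_sym0 by (force simp: cm_def)
      from nul_lam[OF this, of 1 1] show ?thesis using Ym(4) by (simp add: lnul_def)
    qed
    also have "lam (?A * (of_nat l * b ^ (l - 1)) * (s * V)) = lam (?A * (of_nat l * b ^ (l - 1)) * (s * d))"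
    proof -
      have "lam (?A * (of_nat l * b ^ (l - 1)) * s * (V - d)) = 0" using V(2) by (simp add: ann_def)
      then show ?thesis by (simp add: right_diff_distrib lam_diff mult.assoc)
    qed
    also have "?A * (of_nat l * b ^ (l - 1)) * (s * d) = of_nat l * (s * d) * (?A * b ^ (l - 1))"
    proof -
      have "?A * (of_nat l * b ^ (l - 1)) * (s * d) = s * d * (?A * (of_nat l * b ^ (l - 1)))"
        using sd by (simp add: central_def)
      also have "?A * (of_nat l * b ^ (l - 1)) = of_nat l * (?A * b ^ (l - 1))"
        by (metis mult.assoc mult_of_nat_commute)
      finally show ?thesis by (metis mult.assoc mult_of_nat_commute)
    qed
    finally show ?thesis by simp
  qed
  have of_nat_lam: "lam (of_nat n * x) = lam (of_nat n * y)" if "lam x = lam y" for n x y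
    by (induction n) (simp_all add: distrib_right lam_add that)
  show ?thesis
  proof (induction k arbitrary: l)
    case 0
    show ?case
    proof (cases l)
      case (Suc l')
      have "lam (e ^ i * b * b ^ l') = 0" using b by (simp add: lnul_def)
      then show ?thesis by (simp add: Suc mult.assoc)
    qed simp
  next
    case (Suc k)
    show ?case
    proof (cases l)
      case (Suc l')
      let ?x = "a ^ k * e ^ i * b ^ l'" and ?y = "of_nat (fact k) * (s * d) ^ k * e ^ i"
      have "lam ?x = lam (if k = l' then ?y else 0)" using Suc.IH[of l'] by (simp add: lam_0)
      \<comment> \<open>\<open>lam\<close> is merely additive, so an equality of values is
        multiplied by \<open>s * d\<close> through the hypothesis \<open>sd_lam\<close> and by a
        natural number through repeated addition.\<close>
      from of_nat_lam[OF sd_lam[OF this], of l] step[of k l]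
      have 1: "lam (a ^ Suc k * e ^ i * b ^ l) = lam (of_nat l * (s * d * (if k = l' then ?y else 0)))"
        by (simp add: Suc mult.assoc)
      have "of_nat (Suc k) * (s * d * ?y) = of_nat (fact (Suc k)) * (s * d) ^ Suc k * e ^ i"
      proof -
        have "s * d * ?y = (s * d * of_nat (fact k)) * ((s * d) ^ k * e ^ i)"
          by (simp only: mult.assoc)
        also have "s * d * of_nat (fact k) = of_nat (fact k) * (s * d)"
          by (rule mult_of_nat_commute[symmetric])
        finally have "s * d * ?y = of_nat (fact k) * ((s * d) ^ Suc k * e ^ i)"
          by (simp add: mult.assoc)
        then show ?thesis by (simp only: fact_Suc of_nat_mult of_nat_id mult.assoc)
      qed
      then show ?thesis unfolding 1 using Suc by (auto simp: lam_0 simp del: power_Suc of_nat_Suc fact_Suc)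
    qed (use step[of k 0] in \<open>simp add: lam_0\<close>)
  qed
qed

section \<open>The tensor algebra with formal scalars\<close>

lemma const_add: "const (a + b) = const a + const b" by (simp add: const_def single_add)
lemma const_minus: "const (- a) = - const a" by (simp add: const_def single_uminus)
lemma const_diff: "const (a - b) = const a - const b" by (simp add: const_def single_diff)
lemma const_mult: "const (a * b) = const a * const b" by (simp add: const_def mult_single)
lemma const_0 [simp]: "const 0 = 0" by (simp add: const_def)
lemma const_1 [simp]: "const 1 = 1" by (simp add: const_def)
lemma const_sum: "const (\<Sum>i\<in>I. t i) = (\<Sum>i\<in>I. const (t i))"
  by (induction I rule: infinite_finite_induct) (auto simp: const_add)

text \<open>With concatenation of words as addition, finitely supported elements of \<open>ops\<close> form the
  tensor algebra \<open>gen list \<Rightarrow>\<^sub>0 scal\<close>, whose product is a \<open>times\<close> of \<open>Poly_Mapping\<close>.\<close>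

instantiation list :: (type) monoid_add
begin
definition "0 = []"
definition "xs + ys = xs @ ys"
instance by standard (auto simp: zero_list_def plus_list_def)
end

type_synonym tensors = "gen list \<Rightarrow>\<^sub>0 scal"

definition sc :: "scal \<Rightarrow> tensors" where "sc s = Poly_Mapping.single [] s"
definition wd :: "gen list \<Rightarrow> tensors" where "wd u = Poly_Mapping.single u 1"
abbreviation gn :: "gen \<Rightarrow> tensors" where "gn g \<equiv> wd [g]"

lemma sc_mult_single: "sc s * Poly_Mapping.single u t = Poly_Mapping.single u (s * t)"
  by (simp add: sc_def mult_single plus_list_def)

lemma single_mult_sc: "Poly_Mapping.single u t * sc s = Poly_Mapping.single u (s * t)"
  by (simp add: sc_def mult_single plus_list_def mult.commute)

lemma sc_add: "sc (a + b) = sc a + sc b" by (simp add: sc_def single_add)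
lemma sc_diff: "sc (a - b) = sc a - sc b" by (simp add: sc_def single_diff)
lemma sc_mult: "sc (a * b) = sc a * sc b" by (simp add: sc_def mult_single plus_list_def)
lemma sc_0 [simp]: "sc 0 = 0" by (simp add: sc_def)
lemma sc_1 [simp]: "sc 1 = 1" by (simp add: sc_def flip: zero_list_def)
lemma sc_sum: "sc (\<Sum>i\<in>I. t i) = (\<Sum>i\<in>I. sc (t i))"
  by (induction I rule: infinite_finite_induct) (auto simp: sc_add)
lemma sc_power: "sc (a ^ n) = sc a ^ n" by (induction n) (auto simp: sc_mult)

lemma wd_append: "wd (u @ v) = wd u * wd v" by (simp add: wd_def mult_single plus_list_def)
lemma wd_Nil [simp]: "wd [] = 1" by (simp add: wd_def flip: zero_list_def)

lemma tensors_expand: "t = (\<Sum>u\<in>Poly_Mapping.keys t. sc (Poly_Mapping.lookup t u) * wd u)"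
  by (rule poly_mapping_eqI)
    (simp add: wd_def sc_mult_single lookup_sum lookup_single when_def in_keys_iff)

lemma sc_commute: "sc s * t = t * sc s"
proof -
  have "sc s * (sc a * wd u) = sc a * wd u * sc s" for a u
    by (simp add: wd_def sc_mult_single single_mult_sc)
  then have "sc s * (\<Sum>u\<in>Poly_Mapping.keys t. sc (Poly_Mapping.lookup t u) * wd u) =
    (\<Sum>u\<in>Poly_Mapping.keys t. sc (Poly_Mapping.lookup t u) * wd u) * sc s"
    by (simp add: sum_distrib_left sum_distrib_right)
  then show ?thesis by (simp flip: tensors_expand)
qed

lemma sc_pull: "y * (sc b * z) = sc b * (y * z)"
  by (simp only: mult.assoc[symmetric] sc_commute[of b y])

text \<open>The vacuum component with formal coefficients, still a function of the point. The
  pairing with \<open>\<psi>\<close> is postponed until all operators have been evaluated.\<close>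

definition lam :: "pt set \<Rightarrow> (pt \<Rightarrow> complex) \<Rightarrow> tensors \<Rightarrow> pt \<Rightarrow> scal" where
  "lam D f t = (\<lambda>p. \<Sum>u\<in>Poly_Mapping.keys t. Poly_Mapping.lookup t u * const (phi D u f p))"

lemma lam_superset:
  "finite A \<Longrightarrow> Poly_Mapping.keys t \<subseteq> A \<Longrightarrow>
    lam D f t p = (\<Sum>u\<in>A. Poly_Mapping.lookup t u * const (phi D u f p))"
  unfolding lam_def by (rule sum.mono_neutral_left) (auto simp: in_keys_iff)

lemma lam_single: "lam D f (Poly_Mapping.single u s) p = s * const (phi D u f p)"
  by (subst lam_superset[of "{u}"]) auto

lemma lam_plus: "lam D f (s + t) = lam D f s + lam D f t"
proof
  fix p
  let ?A = "Poly_Mapping.keys s \<union> Poly_Mapping.keys t"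
  have "lam D f u p = (\<Sum>k\<in>?A. Poly_Mapping.lookup u k * const (phi D k f p))"
    if "Poly_Mapping.keys u \<subseteq> ?A" for u
    by (rule lam_superset) (use that in auto)
  then show "lam D f (s + t) p = (lam D f s + lam D f t) p"
    by (simp add: Poly_Mapping.keys_add lookup_add distrib_right sum.distrib)
qed

locale vacuum =
  fixes D :: "pt set" and f :: "pt \<Rightarrow> complex"
  assumes D: "bounded D" and f: "f \<in> Fun D"
begin

sublocale vev "lam D f" by unfold_locales (rule lam_plus)

lemma lam_wd: "lam D f (wd u) p = const (phi D u f p)"
  by (simp add: wd_def lam_single)

lemma lam_sc: "lam D f (sc s * t) p = s * lam D f t p"
proof -
  have "lam D f (sc s * (\<Sum>u\<in>Poly_Mapping.keys t. sc (Poly_Mapping.lookup t u) * wd u)) p =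
    s * lam D f (\<Sum>u\<in>Poly_Mapping.keys t. sc (Poly_Mapping.lookup t u) * wd u) p"
    unfolding sum_distrib_left lam_sum sum_fun_apply wd_def sc_mult_single lam_single
    by (simp add: mult.assoc)
  then show ?thesis by (simp flip: tensors_expand)
qed

lemma lam_sc_right: "lam D f (t * sc s) p = s * lam D f t p"
  by (simp flip: sc_commute add: lam_sc)

lemma central_sc [simp]: "central (sc s)"
  by (simp add: central_def sc_commute)

lemma nulI:
  assumes "\<And>u v p. lam D f (wd u * x * wd v) p = 0"
  shows "nul x"
  unfolding nul_def
proof (intro allI)
  fix l r
  have "lam D f ((\<Sum>u\<in>Poly_Mapping.keys l. sc (Poly_Mapping.lookup l u) * wd u) * x *
     (\<Sum>u\<in>Poly_Mapping.keys r. sc (Poly_Mapping.lookup r u) * wd u)) = 0"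
  proof
    fix p
    have "lam D f ((sc a * wd u) * x * (sc b * wd v)) p = 0" for a b u v
    proof -
      have "(sc a * wd u) * x * (sc b * wd v) = sc a * (sc b * (wd u * x * wd v))"
        by (simp only: mult.assoc sc_pull[of "wd u" b] sc_pull[of x b])
      then show ?thesis by (simp add: lam_sc assms)
    qed
    then show "lam D f ((\<Sum>u\<in>Poly_Mapping.keys l. sc (Poly_Mapping.lookup l u) * wd u) * x *
     (\<Sum>u\<in>Poly_Mapping.keys r. sc (Poly_Mapping.lookup r u) * wd u)) p = 0 p"
      by (simp only: sum_distrib_left sum_distrib_right lam_sum sum_fun_apply) simp
  qed
  then show "lam D f (l * x * r) = 0" by (simp flip: tensors_expand)
qed

lemma annI:
  assumes "\<And>u p. lam D f (wd u * x) p = 0"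
  shows "ann x"
  unfolding ann_def
proof
  fix l
  have "lam D f ((\<Sum>u\<in>Poly_Mapping.keys l. sc (Poly_Mapping.lookup l u) * wd u) * x) p = 0" for p
    by (simp only: sum_distrib_right lam_sum sum_fun_apply) (simp add: mult.assoc lam_sc assms)
  then show "lam D f (l * x) = 0" by (simp add: fun_eq_iff flip: tensors_expand)
qed

lemma lnulI:
  assumes "\<And>u p. lam D f (x * wd u) p = 0"
  shows "lnul x"
  unfolding lnul_def
proof
  fix r
  have "lam D f (x * (sc a * wd u)) p = 0" for a u p
  proof -
    have "x * (sc a * wd u) = sc a * (x * wd u)" by (rule sc_pull)
    then show ?thesis by (simp add: lam_sc assms)
  qed
  then have "lam D f (x * (\<Sum>u\<in>Poly_Mapping.keys r. sc (Poly_Mapping.lookup r u) * wd u)) p = 0" for p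
    by (simp only: sum_distrib_left lam_sum sum_fun_apply) simp
  then show "lam D f (x * r) = 0" by (simp add: fun_eq_iff flip: tensors_expand)
qed

text \<open>\<open>Hbar\<close> commutes with every letter up to the relations, so it travels to the
  right end, where it acts as the identity.\<close>

lemma gn_Hbar: "nul (gn Hbar - 1)"
proof (rule nulI)
  fix u v p
  have "phi D (u @ Hbar # v) f = phi D (u @ v) f" for u
  proof (induction v arbitrary: u)
    case Nil
    show ?case using phi_snoc[OF D f, of Hbar u] by simp
  next
    case (Cons h v)
    have "phi D (u @ Hbar # h # v) f = phi D (u @ h # Hbar # v) f"
      using phi_comm[OF D f, of u Hbar h v] by (simp add: brv_simps fun_eq_iff)
    then show ?case using Cons[of "u @ [h]"] by simp
  qed
  then show "lam D f (wd u * (gn Hbar - 1) * wd v) p = 0"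
    by (simp add: right_diff_distrib left_diff_distrib lam_diff lam_wd flip: wd_append)
qed

definition linR :: "(gen \<Rightarrow>\<^sub>0 complex) \<Rightarrow> tensors" where
  "linR t = (\<Sum>k\<in>Poly_Mapping.keys t. sc (const (Poly_Mapping.lookup t k)) * gn k)"

lemma linR_superset:
  "finite A \<Longrightarrow> Poly_Mapping.keys t \<subseteq> A \<Longrightarrow> linR t = (\<Sum>k\<in>A. sc (const (Poly_Mapping.lookup t k)) * gn k)"
  unfolding linR_def by (rule sum.mono_neutral_left) (auto simp: in_keys_iff)

lemma linR_single: "linR (Poly_Mapping.single k c) = sc (const c) * gn k"
  by (subst linR_superset[of "{k}"]) auto

lemma linR_zero: "linR 0 = 0"
  by (simp add: linR_def)

lemma linR_add: "linR (s + t) = linR s + linR t"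
proof -
  let ?A = "Poly_Mapping.keys s \<union> Poly_Mapping.keys t"
  have "linR u = (\<Sum>k\<in>?A. sc (const (Poly_Mapping.lookup u k)) * gn k)" if "Poly_Mapping.keys u \<subseteq> ?A" for u
    by (rule linR_superset) (use that in auto)
  then show ?thesis
    by (simp add: Poly_Mapping.keys_add lookup_add const_add sc_add distrib_right sum.distrib)
qed

lemma linR_sum: "linR (\<Sum>i\<in>I. t i) = (\<Sum>i\<in>I. linR (t i))"
  by (induction I rule: infinite_finite_induct) (auto simp: linR_zero linR_add)

text \<open>\<open>phi_comm\<close> holds between arbitrary surrounding words, which is what
  membership in a two-sided ideal asks for. The commutators of mode sums below all start from this
  rule.\<close>

lemma cm_gen: "cm (gn g) (gn h) (linR (bracket g h))"
  unfolding cm_def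
proof (rule nulI)
  fix u v p
  have "lam D f (wd u * linR (bracket g h) * wd v) p = const (brv (\<lambda>k. phi D (u @ k # v) f) g h p)"
  proof -
    have "wd u * (sc a * gn k) * wd v = sc a * wd (u @ k # v)" for a k
    proof -
      have "wd u * (sc a * gn k) * wd v = sc a * (wd u * gn k * wd v)" by (simp only: mult.assoc sc_pull)
      then show ?thesis by (simp flip: wd_append)
    qed
    then show ?thesis
      by (simp add: linR_def sum_distrib_left sum_distrib_right lam_sum sum_fun_apply lam_sc lam_wd
          brv_def lin_def const_sum const_mult)
  qed
  moreover have "lam D f (wd u * (gn g * gn h - gn h * gn g) * wd v) p =
    const (phi D (u @ g # h # v) f p - phi D (u @ h # g # v) f p)"
    by (simp add: right_diff_distrib left_diff_distrib lam_diff lam_wd const_diff flip: wd_append)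
  ultimately show "lam D f (wd u * (gn g * gn h - gn h * gn g - linR (bracket g h)) * wd v) p = 0"
    by (simp add: right_diff_distrib left_diff_distrib lam_diff phi_comm[OF D f])
qed

lemma linR_Hbar: "nul (linR (Poly_Mapping.single Hbar c) - sc (const c))"
  using nul_mult_left[OF gn_Hbar, of "sc (const c)"] by (simp add: linR_single right_diff_distrib)

lemma cm_W_Xs: "cm (gn (W i)) (gn (Xs n j)) (if n = 0 \<and> i = j then 1 else 0)"
  using cm_gen[of "W i" "Xs n j"] linR_Hbar[of 1] by (auto simp: linR_zero intro: cm_congr)

lemma cm_X_Xs: "cm (gn (X n i)) (gn (Xs m j))
    (if n \<noteq> 0 \<and> n = - m \<and> i = j then sc (const (- (1 / of_int n))) else 0)"
  using cm_gen[of "X n i" "Xs m j"] linR_Hbar[of "- (1 / of_int n)"]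
  by (auto simp: linR_zero intro: cm_congr)

lemma cm_commuting:
  "cm (gn (W i)) (gn (W j)) 0" "cm (gn (W i)) (gn (X n j)) 0" "cm (gn (X m i)) (gn (X n j)) 0"
  "cm (gn (X n j)) (gn (W i)) 0" "cm (gn (P i)) (gn (W j)) 0" "n \<noteq> 0 \<Longrightarrow> cm (gn (P i)) (gn (X n j)) 0"
  using cm_gen[of "W i" "W j"] cm_gen[of "W i" "X n j"] cm_gen[of "X m i" "X n j"]
    cm_gen[of "X n j" "W i"] cm_gen[of "P i" "W j"] cm_gen[of "P i" "X n j"]
  by (simp_all add: linR_zero)

lemma cm_P_Xs: "cm (gn (P i)) (gn (Xs n j)) (\<Sum>k\<in>UNIV. sc (const (- (1/2) * eps i j k)) * gn (X n k))"
  using cm_gen[of "P i" "Xs n j"] by (simp add: linR_sum linR_single)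

lemma cm_Xs_Xs: "m \<noteq> 0 \<Longrightarrow> n \<noteq> 0 \<Longrightarrow> cm (gn (Xs m i)) (gn (Xs n j))
   ((\<Sum>k\<in>UNIV. sc (const (of_int (m + n) / (2 * of_int m * of_int n) * eps i j k)) * gn (X (m + n) k)) +
    (if m = - n then \<Sum>k\<in>UNIV. sc (const (1 / (of_int m)\<^sup>2 * eps i j k)) * gn (W k) else 0))"
  using cm_gen[of "Xs m i" "Xs n j"] by (auto simp add: linR_sum linR_single linR_add linR_zero)

lemma cm_Xs_Xs0: "m \<noteq> 0 \<Longrightarrow> cm (gn (Xs m i)) (gn (Xs 0 j))
   (\<Sum>k\<in>UNIV. sc (const (1 / (2 * of_int m) * eps i j k)) * gn (X m k))"
  using cm_gen[of "Xs m i" "Xs 0 j"] by (auto simp add: linR_sum linR_single linR_add linR_zero)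

end

section \<open>Commutators of mode sums\<close>

definition lc :: "(3 \<Rightarrow> complex) \<Rightarrow> (3 \<Rightarrow> tensors) \<Rightarrow> tensors" where
  "lc c G = (\<Sum>i\<in>UNIV. sc (const (c i)) * G i)"

abbreviation xv :: "(3 \<Rightarrow> complex) \<Rightarrow> int \<Rightarrow> tensors" where "xv c n \<equiv> lc c (\<lambda>i. gn (X n i))"
abbreviation xsv :: "(3 \<Rightarrow> complex) \<Rightarrow> int \<Rightarrow> tensors" where "xsv c n \<equiv> lc c (\<lambda>i. gn (Xs n i))"
abbreviation Wv :: "(3 \<Rightarrow> complex) \<Rightarrow> tensors" where "Wv c \<equiv> lc c (\<lambda>i. gn (W i))"

definition cross :: "(3 \<Rightarrow> complex) \<Rightarrow> (3 \<Rightarrow> complex) \<Rightarrow> 3 \<Rightarrow> complex" where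
  "cross c d k = (\<Sum>i\<in>UNIV. \<Sum>j\<in>UNIV. eps i j k * c i * d j)"

definition dot :: "(3 \<Rightarrow> complex) \<Rightarrow> (3 \<Rightarrow> complex) \<Rightarrow> complex" where
  "dot c d = (\<Sum>i\<in>UNIV. c i * d i)"

text \<open>The scalar triple product of \<open>c\<close>, the \<open>W\<close> and the modes
  \<open>x_m\<close>: one mode of the logarithmic part of the field, without the factor
  \<open>log z / 2\<close>.\<close>

definition wx :: "(3 \<Rightarrow> complex) \<Rightarrow> int \<Rightarrow> tensors" where
  "wx c m = lc c (\<lambda>i. \<Sum>j\<in>UNIV. \<Sum>k\<in>UNIV. sc (const (eps i j k)) * (gn (W j) * gn (X m k)))"

definition Qr :: "3 \<Rightarrow> tensors" where
  "Qr i = gn (P i) - sc (const (1/2)) *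
     (\<Sum>j\<in>UNIV. \<Sum>k\<in>UNIV. sc (const (eps i j k)) * (gn (X 0 j) * gn (W k)))"

text \<open>The mode sum \<open>c\<^sup>i x\<^sup>*\<^sub>i(z)\<close> restricted to the modes in \<open>S\<close>, with its logarithmic part.\<close>

definition modes :: "int set \<Rightarrow> (int \<Rightarrow> scal) \<Rightarrow> scal \<Rightarrow> (3 \<Rightarrow> complex) \<Rightarrow> tensors" where
  "modes S zp lg c = (\<Sum>n\<in>S. sc (zp (- n)) * (xsv c n + sc (const (1/2) * lg) * wx c n))"

lemma sc_minus: "sc (- a) = - sc a" by (simp add: sc_def single_uminus)

lemma cross_swap: "cross d c k = - cross c d k"
proof -
  have e: "eps i j k * d i * c j = - (eps j i k * c j * d i)" for i j
    by (simp add: eps_perms(3)[of j i k])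
  have "cross d c k = (\<Sum>j\<in>UNIV. \<Sum>i\<in>UNIV. eps i j k * d i * c j)"
    unfolding cross_def by (rule sum.swap)
  then show ?thesis unfolding e by (simp add: cross_def sum_negf)
qed

lemma cross_same: "cross c c k = 0"
  using cross_swap[of c c k] by simp

lemma dot_cross: "dot (cross c d) c = 0" "dot (cross c d) d = 0" "dot c (cross c d) = 0" "dot d (cross c d) = 0"
  by (simp_all add: dot_def cross_def sum_3 eps_values algebra_simps)

lemma lc_zero [simp]: "lc c (\<lambda>i. 0) = 0" by (simp add: lc_def)

lemma lc_minus: "lc (\<lambda>k. - c k) G = - lc c G"
  by (simp add: lc_def const_minus sc_def single_uminus sum_negf flip: minus_mult_left)

lemma lc_lc_delta:
  "lc c (\<lambda>i. lc d (\<lambda>j. if Q \<and> i = j then sc s else 0)) = (if Q then sc (const (dot c d) * s) else 0)"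
proof (cases Q)
  case True
  have "lc d (\<lambda>j. if i = j then sc s else 0) = sc (const (d i) * s)" for i
  proof -
    have "lc d (\<lambda>j. if i = j then sc s else 0) = (\<Sum>j\<in>UNIV. if i = j then sc (const (d j)) * sc s else 0)"
      unfolding lc_def by (intro sum.cong refl) simp
    then show ?thesis by (simp add: sc_mult)
  qed
  moreover have "lc c (\<lambda>i. sc (const (d i) * s)) = sc (const (dot c d) * s)"
    by (simp add: lc_def dot_def const_sum sum_distrib_right sc_sum const_mult mult.assoc flip: sc_mult)
  ultimately show ?thesis using True by simp
qed simp

lemma lc_lc_eps:
  "lc c (\<lambda>i. lc d (\<lambda>j. \<Sum>k\<in>UNIV. sc (const (r * eps i j k)) * G k)) = sc (const r) * lc (cross c d) G"
proof -
  have e: "sc (const (c i)) * (sc (const (d j)) * (sc (const (r * eps i j k)) * G k)) =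
     sc (const (r * (eps i j k * c i * d j))) * G k" for i j k
  proof -
    have "c i * (d j * (r * eps i j k)) = r * (eps i j k * c i * d j)" by simp
    then show ?thesis by (simp only: mult.assoc[symmetric] sc_mult[symmetric] const_mult[symmetric])
  qed
  have "lc c (\<lambda>i. lc d (\<lambda>j. \<Sum>k\<in>UNIV. sc (const (r * eps i j k)) * G k)) =
    (\<Sum>i\<in>UNIV. \<Sum>j\<in>UNIV. \<Sum>k\<in>UNIV. sc (const (r * (eps i j k * c i * d j))) * G k)"
    unfolding lc_def sum_distrib_left e ..
  also have "\<dots> = (\<Sum>i\<in>UNIV. \<Sum>k\<in>UNIV. \<Sum>j\<in>UNIV. sc (const (r * (eps i j k * c i * d j))) * G k)"
    by (rule sum.cong[OF refl], rule sum.swap)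
  also have "\<dots> = (\<Sum>k\<in>UNIV. \<Sum>i\<in>UNIV. \<Sum>j\<in>UNIV. sc (const (r * (eps i j k * c i * d j))) * G k)"
    by (rule sum.swap)
  also have "\<dots> = (\<Sum>k\<in>UNIV. sc (const (r * cross c d k)) * G k)"
    by (simp only: cross_def const_sum sc_sum sum_distrib_left sum_distrib_right)
  also have "\<dots> = sc (const r) * lc (cross c d) G"
    by (simp only: lc_def const_mult sc_mult sum_distrib_left mult.assoc)
  finally show ?thesis .
qed

context vacuum begin

lemma cm_lc_left: "(\<And>i. cm (G i) y (Z i)) \<Longrightarrow> cm (lc c G) y (lc c Z)"
  unfolding lc_def by (intro cm_sum_left cm_scale_left central_sc) auto

lemma cm_lc_right: "(\<And>i. cm x (G i) (Z i)) \<Longrightarrow> cm x (lc c G) (lc c Z)"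
  unfolding lc_def by (intro cm_sum_right cm_scale_right central_sc) auto

lemma cm_xv_xsv: "cm (xv c n) (xsv d m)
    (if n \<noteq> 0 \<and> n = - m then sc (const (- (dot c d / of_int n))) else 0)"
proof -
  have "cm (xv c n) (xsv d m) (lc c (\<lambda>i. lc d (\<lambda>j. if (n \<noteq> 0 \<and> n = - m) \<and> i = j
     then sc (const (- (1 / of_int n))) else 0)))"
    unfolding conj_assoc by (intro cm_lc_left cm_lc_right cm_X_Xs)
  moreover have eq: "const (dot c d) * const (- (1 / of_int n)) = const (- (dot c d / of_int n))"
    by (simp flip: const_mult)
  ultimately show ?thesis unfolding lc_lc_delta eq by -
qed

lemma cm_Wv_xsv: "cm (Wv c) (xsv d n) (if n = 0 then sc (const (dot c d)) else 0)"
proof -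
  have "cm (Wv c) (xsv d n) (lc c (\<lambda>i. lc d (\<lambda>j. if n = 0 \<and> i = j then sc 1 else 0)))"
    unfolding sc_1 by (intro cm_lc_left cm_lc_right cm_W_Xs)
  then show ?thesis unfolding lc_lc_delta mult_1_right .
qed

lemma cm_xsv_xsv: "m \<noteq> 0 \<Longrightarrow> n \<noteq> 0 \<Longrightarrow> cm (xsv c m) (xsv d n)
   (sc (const (of_int (m + n) / (2 * of_int m * of_int n))) * xv (cross c d) (m + n) +
    (if m = - n then sc (const (1 / (of_int m)\<^sup>2)) * Wv (cross c d) else 0))"
proof -
  assume mn: "m \<noteq> 0" "n \<noteq> 0"
  let ?A = "\<lambda>i j. \<Sum>k\<in>UNIV. sc (const (of_int (m + n) / (2 * of_int m * of_int n) * eps i j k)) * gn (X (m + n) k)"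
  let ?B = "\<lambda>i j. \<Sum>k\<in>UNIV. sc (const (1 / (of_int m)\<^sup>2 * eps i j k)) * gn (W k)"
  have "cm (xsv c m) (xsv d n) (lc c (\<lambda>i. lc d (\<lambda>j. ?A i j + (if m = - n then ?B i j else 0))))"
    by (intro cm_lc_left cm_lc_right cm_Xs_Xs mn)
  moreover have "lc c (\<lambda>i. lc d (\<lambda>j. ?A i j + (if m = - n then ?B i j else 0))) =
    lc c (\<lambda>i. lc d (?A i)) + (if m = - n then lc c (\<lambda>i. lc d (?B i)) else 0)"
    by (simp add: lc_def distrib_left sum.distrib)
  ultimately show ?thesis unfolding lc_lc_eps by simp
qed

lemma cm_xsv_xsv0: "m \<noteq> 0 \<Longrightarrow> cm (xsv c m) (xsv d 0) (sc (const (1 / (2 * of_int m))) * xv (cross c d) m)"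
proof -
  assume m: "m \<noteq> 0"
  have "cm (xsv c m) (xsv d 0) (lc c (\<lambda>i. lc d (\<lambda>j. \<Sum>k\<in>UNIV. sc (const (1 / (2 * of_int m) * eps i j k)) * gn (X m k))))"
    by (intro cm_lc_left cm_lc_right cm_Xs_Xs0 m)
  then show ?thesis unfolding lc_lc_eps .
qed

lemma cm_wx:
  assumes "\<And>j k. cm (gn (W j) * gn (X m k)) y (Z j k)"
  shows "cm (wx c m) y (lc c (\<lambda>i. \<Sum>j\<in>UNIV. \<Sum>k\<in>UNIV. sc (const (eps i j k)) * Z j k))"
  unfolding wx_def by (intro cm_lc_left cm_sum_left cm_scale_left central_sc assms)

lemma cm_wx0:
  assumes "\<And>j. cm (gn (W j)) y 0" "\<And>k. cm (gn (X m k)) y 0"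
  shows "cm (wx c m) y 0"
  using cm_wx[of m y "\<lambda>_ _. 0" c] cm_mult_left[OF assms(1) assms(2)] by simp

lemma cm_lc0: "(\<And>i. cm (G i) y 0) \<Longrightarrow> cm (lc c G) y 0"
  using cm_lc_left[of G y "\<lambda>_. 0" c] by simp

lemma cm_lc0': "(\<And>i. cm x (G i) 0) \<Longrightarrow> cm x (lc c G) 0"
  using cm_lc_right[of x G "\<lambda>_. 0" c] by simp

lemma cm_xv_wx: "cm (xv c n) (wx d m) 0" and cm_Wv_wx: "cm (Wv c) (wx d m) 0"
  and cm_wx_wx: "cm (wx c n) (wx d m) 0"
proof -
  have "cm (wx d m) (gn (X n i)) 0" "cm (wx d m) (gn (W i)) 0" for i n
    by (intro cm_wx0 cm_commuting)+
  from this[THEN cm_sym0] have sw: "cm (gn (X n i)) (wx d m) 0" "cm (gn (W i)) (wx d m) 0" for i n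
    by simp_all
  show "cm (xv c n) (wx d m) 0" "cm (Wv c) (wx d m) 0" "cm (wx c n) (wx d m) 0"
    by (intro cm_lc0 cm_wx0 sw)+
qed

lemma sum_eps_cross:
  "lc c (\<lambda>i. \<Sum>j\<in>UNIV. \<Sum>k\<in>UNIV. sc (const (eps i j k)) * (sc (const (d j)) * G k)) = lc (cross c d) G"
proof -
  have "sc (const (eps i j k)) * (sc (const (d j)) * G k) = sc (const (d j)) * (sc (const (1 * eps i j k)) * G k)"
    for i j k unfolding mult_1 by (rule sc_pull)
  then have "lc c (\<lambda>i. \<Sum>j\<in>UNIV. \<Sum>k\<in>UNIV. sc (const (eps i j k)) * (sc (const (d j)) * G k)) =
    lc c (\<lambda>i. lc d (\<lambda>j. \<Sum>k\<in>UNIV. sc (const (1 * eps i j k)) * G k))"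
    unfolding lc_def sum_distrib_left by simp
  then show ?thesis unfolding lc_lc_eps by simp
qed

lemma sum_eps_cross':
  "lc c (\<lambda>i. \<Sum>j\<in>UNIV. \<Sum>k\<in>UNIV. sc (const (eps i j k)) * (sc (const (d k)) * G j)) = - lc (cross c d) G"
proof -
  have e: "sc (const (eps i j k)) * (sc (const (d k)) * G j) = sc (const (d k)) * (sc (const (- 1 * eps i k j)) * G j)"
    for i j k
  proof -
    have eq: "- 1 * eps i k j = (eps i j k :: complex)" by (simp add: eps_perms(4)[of i k j])
    show ?thesis unfolding eq by (rule sc_pull)
  qed
  have "(\<Sum>j\<in>UNIV. \<Sum>k\<in>UNIV. sc (const (eps i j k)) * (sc (const (d k)) * G j)) =
    lc d (\<lambda>k. \<Sum>j\<in>UNIV. sc (const (- 1 * eps i k j)) * G j)" for i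
    unfolding lc_def sum_distrib_left e by (rule sum.swap)
  then have "lc c (\<lambda>i. \<Sum>j\<in>UNIV. \<Sum>k\<in>UNIV. sc (const (eps i j k)) * (sc (const (d k)) * G j)) =
    lc c (\<lambda>i. lc d (\<lambda>k. \<Sum>j\<in>UNIV. sc (const (- 1 * eps i k j)) * G j))"
    by (simp only:)
  also have "\<dots> = sc (const (- 1)) * lc (cross c d) G" by (rule lc_lc_eps)
  also have "sc (const (- 1)) = - 1" by (simp only: const_minus const_1 sc_minus sc_1)
  finally show ?thesis by simp
qed

lemma cm_wx_xsv0:
  assumes m: "m \<noteq> 0"
  shows "cm (wx c m) (xsv d 0) (xv (cross c d) m)"
proof -
  have W: "cm (gn (W j)) (xsv d 0) (sc (const (d j)))" for j
  proof -
    have "cm (gn (W j)) (xsv d 0) (lc d (\<lambda>i. if 0 = (0::int) \<and> j = i then 1 else 0))"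
      by (intro cm_lc_right cm_W_Xs)
    moreover have "lc d (\<lambda>i. if j = i then 1 else 0) = sc (const (d j))"
    proof -
      have "lc d (\<lambda>i. if j = i then 1 else 0) = (\<Sum>i\<in>UNIV. if j = i then sc (const (d i)) else 0)"
        unfolding lc_def by (intro sum.cong refl) simp
      then show ?thesis by simp
    qed
    ultimately show ?thesis by simp
  qed
  have X: "cm (gn (X m k)) (xsv d 0) 0" for k
    by (intro cm_lc0') (use cm_X_Xs[of m k 0] m in simp)
  have "cm (gn (W j) * gn (X m k)) (xsv d 0) (sc (const (d j)) * gn (X m k))" for j k
    using cm_mult_left[OF W X] by simp
  from cm_wx[OF this] show ?thesis unfolding sum_eps_cross .
qed

text \<open>Nonzero modes of \<open>x^*\<close> commute with \<open>W\<close>, so only the factor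
  \<open>x_m\<close> contracts, and only with the opposite mode. One \<open>W\<close> is left over,
  contracted with \<open>c\<close> and \<open>d\<close> through \<open>eps\<close>.\<close>

lemma cm_wx_xsv:
  assumes mn: "m \<noteq> 0" "n \<noteq> 0"
  shows "cm (wx c m) (xsv d n) (if m = - n then sc (const (1 / of_int m)) * Wv (cross c d) else 0)"
proof (cases "m = - n")
  case True
  have W: "cm (gn (W j)) (xsv d n) 0" for j
    by (intro cm_lc0') (use cm_W_Xs[of j n] mn in simp)
  let ?r = "const (- (1 / of_int m))"
  have X: "cm (gn (X m k)) (xsv d n) (sc (?r * const (d k)))" for k
  proof -
    have "cm (gn (X m k)) (xsv d n) (lc d (\<lambda>i. if m \<noteq> 0 \<and> m = - n \<and> k = i then sc ?r else 0))"
      by (intro cm_lc_right cm_X_Xs)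
    moreover have "lc d (\<lambda>i. if m \<noteq> 0 \<and> m = - n \<and> k = i then sc ?r else 0) = sc (?r * const (d k))"
    proof -
      have "lc d (\<lambda>i. if m \<noteq> 0 \<and> m = - n \<and> k = i then sc ?r else 0) =
        (\<Sum>i\<in>UNIV. if k = i then sc (?r * const (d i)) else 0)"
        unfolding lc_def
        by (intro sum.cong refl) (use True mn in \<open>auto simp: mult.commute simp flip: sc_mult\<close>)
      then show ?thesis by simp
    qed
    ultimately show ?thesis by simp
  qed
  have "cm (gn (W j) * gn (X m k)) (xsv d n) (sc ?r * (sc (const (d k)) * gn (W j)))" for j k
  proof -
    have "gn (W j) * sc (?r * const (d k)) = sc ?r * (sc (const (d k)) * gn (W j))"
      unfolding sc_commute[symmetric] by (simp only: sc_mult mult.assoc)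
    then show ?thesis using cm_mult_left[OF W X, of j k] by (simp only: mult_zero_left add_0_right)
  qed
  from cm_wx[OF this, of c]
  have "cm (wx c m) (xsv d n) (sc (const (- (1 / of_int m))) *
     lc c (\<lambda>i. \<Sum>j\<in>UNIV. \<Sum>k\<in>UNIV. sc (const (eps i j k)) * (sc (const (d k)) * gn (W j))))"
    by (simp only: lc_def sum_distrib_left sc_pull[of "sc (const (eps _ _ _))" "const (- (1 / of_int m))"]
        sc_pull[of "sc (const (c _))" "const (- (1 / of_int m))"])
  moreover have "sc (const (- (1 / of_int m))) * - Wv (cross c d) = sc (const (1 / of_int m)) * Wv (cross c d)"
    by (simp add: const_minus sc_minus)
  ultimately show ?thesis using True unfolding sum_eps_cross' by simp
next
  case False
  have "cm (wx c m) (xsv d n) 0"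
    by (intro cm_wx0 cm_lc0') (use cm_W_Xs[of _ n] cm_X_Xs[of m _ n] mn False in simp_all)
  then show ?thesis using False by simp
qed

text \<open>The correction in \<open>Qr\<close> is built from \<open>x_0\<close> and
  \<open>W\<close>, which commute with the nonzero modes of \<open>x^*\<close>; the commutator is
  therefore that of \<open>P\<close>.\<close>

lemma cm_Qr_Xs:
  assumes n: "n \<noteq> 0"
  shows "cm (Qr i) (gn (Xs n j)) (\<Sum>k\<in>UNIV. sc (const (- (1/2) * eps i j k)) * gn (X n k))"
proof -
  have "cm (gn (X 0 l)) (gn (Xs n j)) 0" "cm (gn (W m)) (gn (Xs n j)) 0" for l m
    using cm_X_Xs[of 0 l n j] cm_W_Xs[of m n j] n by simp_all
  from cm_mult_left[OF this]
  have XW: "cm (gn (X 0 l) * gn (W m)) (gn (Xs n j)) 0" for l m by simp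
  have "cm (\<Sum>l\<in>UNIV. \<Sum>m\<in>UNIV. sc (const (eps i l m)) * (gn (X 0 l) * gn (W m))) (gn (Xs n j))
      (\<Sum>l\<in>UNIV. \<Sum>m\<in>UNIV. sc (const (eps i l m)) * 0)"
    by (intro cm_sum_left cm_scale_left central_sc XW)
  from cm_add_left[OF cm_P_Xs cm_scale_left[OF central_sc this, of "const (- (1/2))"]]
  show ?thesis unfolding Qr_def const_minus sc_minus by simp
qed

lemma cm_Qr0:
  assumes "cm (gn (P i)) y 0" "\<And>l. cm (gn (X 0 l)) y 0" "\<And>m. cm (gn (W m)) y 0"
  shows "cm (Qr i) y 0"
proof -
  have XW: "cm (gn (X 0 l) * gn (W m)) y 0" for l m
    using cm_mult_left[OF assms(2,3)] by simp
  have "cm (\<Sum>l\<in>UNIV. \<Sum>m\<in>UNIV. sc (const (eps i l m)) * (gn (X 0 l) * gn (W m))) y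
      (\<Sum>l\<in>UNIV. \<Sum>m\<in>UNIV. sc (const (eps i l m)) * 0)"
    by (intro cm_sum_left cm_scale_left central_sc XW)
  from cm_add_left[OF assms(1) cm_scale_left[OF central_sc this, of "const (- (1/2))"]]
  show ?thesis unfolding Qr_def const_minus sc_minus by simp
qed

lemma cm_Qr_wx:
  assumes n: "n \<noteq> 0"
  shows "cm (lc c Qr) (wx d n) 0"
proof (rule cm_lc0)
  fix i
  have "cm (Qr i) (gn (W j)) 0" "cm (Qr i) (gn (X n j)) 0" for j
    by (intro cm_Qr0 cm_commuting n)+
  from this[THEN cm_sym0] have "cm (wx d n) (Qr i) 0" by (intro cm_wx0)
  then show "cm (Qr i) (wx d n) 0" by (rule cm_sym0)
qed

text \<open>The commutator points in the direction of the cross product of the two coefficient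
  vectors. Inside one vertex operator both are the same \<open>c\<close>, and the cross product
  vanishes.\<close>

lemma cm_Qr_xsv:
  assumes n: "n \<noteq> 0"
  shows "cm (lc c Qr) (xsv c n) 0"
proof -
  have "cm (lc c Qr) (xsv c n) (lc c (\<lambda>i. lc c (\<lambda>j. \<Sum>k\<in>UNIV. sc (const (- (1/2) * eps i j k)) * gn (X n k))))"
    by (intro cm_lc_left cm_lc_right cm_Qr_Xs n)
  then show ?thesis unfolding lc_lc_eps by (simp add: lc_def cross_same)
qed

lemma cm_modes_right:
  assumes "\<And>n. n \<in> S \<Longrightarrow> cm x (xsv c n) 0" "\<And>n. n \<in> S \<Longrightarrow> cm x (wx c n) 0"
  shows "cm x (modes S zp lg c) 0"
proof -
  have "cm x (modes S zp lg c) (\<Sum>n\<in>S. sc (zp (- n)) * (0 + sc (const (1/2) * lg) * 0))"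
    unfolding modes_def by (intro cm_sum_right cm_scale_right cm_add_right central_sc assms)
  then show ?thesis by simp
qed

lemma cm_Q_modes: "0 \<notin> S \<Longrightarrow> cm (lc c Qr) (modes S zp lg c) 0"
  by (intro cm_modes_right cm_Qr_xsv cm_Qr_wx) auto

lemma cm_xv_modes:
  assumes "dot c d = 0"
  shows "cm (xv c n) (modes S zp lg d) 0"
proof (intro cm_modes_right cm_xv_wx)
  show "cm (xv c n) (xsv d m) 0" for m
    using cm_xv_xsv[of c n d m] assms by (cases "n \<noteq> 0 \<and> n = - m") (simp_all only: if_True if_False, simp_all)
qed

lemma cm_Wv_modes: "0 \<notin> S \<Longrightarrow> cm (Wv c) (modes S zp lg d) 0"
proof (intro cm_modes_right cm_Wv_wx)
  show "cm (Wv c) (xsv d n) 0" if "0 \<notin> S" "n \<in> S" for n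
  proof -
    have "n \<noteq> 0" using that by auto
    then show ?thesis using cm_Wv_xsv[of c d n] by simp
  qed
qed

lemma cm_xv_xsv0: "n \<noteq> 0 \<Longrightarrow> cm (xv c n) (xsv d 0) 0"
  using cm_xv_xsv[of c n d 0] by simp

lemma cm_modes_xsv0:
  assumes S: "0 \<notin> S"
  shows "cm (modes S zp lg c) (xsv d 0)
    (\<Sum>n\<in>S. sc (zp (- n)) * (sc (const (1 / (2 * of_int n))) * xv (cross c d) n
        + sc (const (1/2) * lg) * xv (cross c d) n))"
  unfolding modes_def
  by (intro cm_sum_left cm_scale_left cm_add_left central_sc cm_xsv_xsv0 cm_wx_xsv0) (use S in auto)

text \<open>Two sources reach \<open>Wv\<close>: the bracket of opposite \<open>x^*\<close> modes,
  with \<open>1/m^2\<close>, and the contractions of a logarithmic part with an \<open>x^*\<close>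
  mode, with \<open>1/(2m)\<close>. The latter carry opposite signs for the two fields, so the
  logarithms combine to their difference. Two logarithmic parts commute.\<close>

lemma cm_modes_modes:
  assumes S: "0 \<notin> S" "0 \<notin> T"
  shows "cm (modes S zp lg c) (modes T wp lg' d) (\<Sum>m\<in>S. \<Sum>n\<in>T. sc (zp (- m) * wp (- n)) *
     (sc (const (of_int (m + n) / (2 * of_int m * of_int n))) * xv (cross c d) (m + n) +
      (if m = - n then sc (const (1 / (of_int m)\<^sup>2) + const (1 / (2 * of_int m)) * (lg - lg')) * Wv (cross c d)
       else 0)))"
proof -
  let ?u = "\<lambda>m n. sc (const (of_int (m + n) / (2 * of_int m * of_int n))) * xv (cross c d) (m + n)"
  let ?v = "\<lambda>m n. if m = - n then sc (const (1 / (of_int m)\<^sup>2)) * Wv (cross c d) else 0"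
  let ?w = "\<lambda>m n. if m = - n then sc (const (1 / of_int m)) * Wv (cross c d) else 0"
  \<comment> \<open>Obtained from \<open>cm_wx_xsv\<close> with three changes of sign: the order of
    the commutator, the order in the cross product, and \<open>n = - m\<close>.\<close>
  have xw: "cm (xsv c m) (wx d n) (- ?w m n)" if "m \<noteq> 0" "n \<noteq> 0" for m n
  proof -
    have "cm (xsv c m) (wx d n) (- (if n = - m then sc (const (1 / of_int n)) * Wv (cross d c) else 0))"
      by (rule cm_sym, rule cm_wx_xsv) (use that in auto)
    moreover have "cross d c = (\<lambda>k. - cross c d k)" by (rule ext) (rule cross_swap)
    then have "Wv (cross d c) = - Wv (cross c d)" by (simp only: lc_minus)
    ultimately show ?thesis by (cases "m = - n") (simp_all add: const_minus sc_minus)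
  qed
  have "cm (modes S zp lg c) (modes T wp lg' d) (\<Sum>m\<in>S. sc (zp (- m)) *
      ((\<Sum>n\<in>T. sc (wp (- n)) * ((?u m n + ?v m n) + sc (const (1/2) * lg') * - ?w m n)) +
       sc (const (1/2) * lg) * (\<Sum>n\<in>T. sc (wp (- n)) * (?w m n + sc (const (1/2) * lg') * 0))))"
    unfolding modes_def
    by (intro cm_sum_left cm_scale_left cm_add_left central_sc cm_sum_right cm_scale_right cm_add_right
        cm_xsv_xsv xw cm_wx_xsv cm_wx_wx) (use S in auto)
  moreover have "sc (zp (- m)) *
      ((\<Sum>n\<in>T. sc (wp (- n)) * ((?u m n + ?v m n) + sc (const (1/2) * lg') * - ?w m n)) +
       sc (const (1/2) * lg) * (\<Sum>n\<in>T. sc (wp (- n)) * (?w m n + sc (const (1/2) * lg') * 0))) =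
    (\<Sum>n\<in>T. sc (zp (- m) * wp (- n)) * (?u m n +
      (if m = - n then sc (const (1 / (of_int m)\<^sup>2) + const (1 / (2 * of_int m)) * (lg - lg')) * Wv (cross c d)
       else 0)))" for m
  proof -
    have h: "const (1 / (2 * of_int m)) = const (1/2) * const (1 / of_int m)"
      by (simp flip: const_mult)
    have e: "sc (wp (- n)) * ((?u m n + ?v m n) + sc (const (1/2) * lg') * - ?w m n) +
       sc (const (1/2) * lg) * (sc (wp (- n)) * (?w m n + sc (const (1/2) * lg') * 0)) =
      sc (wp (- n)) * (?u m n +
      (if m = - n then sc (const (1 / (of_int m)\<^sup>2) + const (1 / (2 * of_int m)) * (lg - lg')) * Wv (cross c d)
       else 0))" for n
    proof (cases "m = - n")
      case True
      let ?V = "Wv (cross c d)" and ?t = "const (1 / (of_int m)\<^sup>2)" and ?r = "const (1 / of_int m)"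
      have "sc (wp (- n)) * ((?u m n + sc ?t * ?V) + sc (const (1/2) * lg') * - (sc ?r * ?V)) +
          sc (const (1/2) * lg) * (sc (wp (- n)) * (sc ?r * ?V + sc (const (1/2) * lg') * 0)) =
        sc (wp (- n)) * ?u m n + (sc (wp (- n) * ?t) - sc (wp (- n) * (const (1/2) * lg') * ?r)
          + sc (const (1/2) * lg * wp (- n) * ?r)) * ?V"
        by (simp add: sc_mult distrib_left distrib_right left_diff_distrib right_diff_distrib mult.assoc)
      also have "sc (wp (- n) * ?t) - sc (wp (- n) * (const (1/2) * lg') * ?r)
          + sc (const (1/2) * lg * wp (- n) * ?r) =
        sc (wp (- n) * (?t + const (1/2) * ?r * (lg - lg')))"
        by (simp only: sc_diff[symmetric] sc_add[symmetric], rule arg_cong[of _ _ sc], simp only: algebra_simps)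
      also have "sc (wp (- n)) * ?u m n + \<dots> * ?V = sc (wp (- n)) * (?u m n +
          sc (?t + const (1/2) * ?r * (lg - lg')) * ?V)"
        by (simp only: distrib_left[of "sc (wp (- n))"] sc_mult[of "wp (- n)"] mult.assoc[of "sc (wp (- n))"])
      finally show ?thesis unfolding h if_P[OF True] .
    qed (simp add: algebra_simps)
    have "(\<Sum>n\<in>T. sc (wp (- n)) * ((?u m n + ?v m n) + sc (const (1/2) * lg') * - ?w m n)) +
       sc (const (1/2) * lg) * (\<Sum>n\<in>T. sc (wp (- n)) * (?w m n + sc (const (1/2) * lg') * 0)) =
       (\<Sum>n\<in>T. sc (wp (- n)) * (?u m n +
      (if m = - n then sc (const (1 / (of_int m)\<^sup>2) + const (1 / (2 * of_int m)) * (lg - lg')) * Wv (cross c d)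
       else 0)))"
      by (simp only: sum_distrib_left sum.distrib[symmetric] e)
    then show ?thesis by (simp only: sum_distrib_left sc_mult mult.assoc)
  qed
  ultimately show ?thesis by simp
qed

end

section \<open>Annihilation, creation and zero modes\<close>

definition expR :: "nat \<Rightarrow> tensors \<Rightarrow> tensors" where
  "expR N x = (\<Sum>n\<le>N. sc (const (1 / fact n)) * x ^ n)"

lemma expR_split: "expR N x = 1 + (\<Sum>n<N. sc (const (1 / fact (Suc n))) * x ^ Suc n)"
  unfolding expR_def by (subst sum.atMost_shift) simp

lemma lookup_mult_const: "Poly_Mapping.lookup (s * const c) e = Poly_Mapping.lookup s e * c"
proof -
  have "s * const c = Poly_Mapping.map ((*) c) s"
    unfolding mult_map_scale_conv_mult const_def by (simp add: mult.commute)
  then show ?thesis by (simp add: map.rep_eq when_def)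
qed

lemma sum_sum_mult_sum:
  fixes L :: "'u \<Rightarrow> 'a::comm_ring"
  shows "(\<Sum>j\<in>J. \<Sum>k\<in>K. e j k * (\<Sum>u\<in>U. L u * A j k u)) =
    (\<Sum>u\<in>U. L u * (\<Sum>j\<in>J. \<Sum>k\<in>K. e j k * A j k u))"
proof -
  have "(\<Sum>k\<in>K. e j k * (\<Sum>u\<in>U. L u * A j k u)) = (\<Sum>u\<in>U. L u * (\<Sum>k\<in>K. e j k * A j k u))" for j
    by (simp only: sum_distrib_left, subst sum.swap, simp only: mult.left_commute)
  then have "(\<Sum>j\<in>J. \<Sum>k\<in>K. e j k * (\<Sum>u\<in>U. L u * A j k u)) =
    (\<Sum>j\<in>J. \<Sum>u\<in>U. L u * (\<Sum>k\<in>K. e j k * A j k u))" by simp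
  also have "\<dots> = (\<Sum>u\<in>U. L u * (\<Sum>j\<in>J. \<Sum>k\<in>K. e j k * A j k u))"
    by (subst sum.swap) (simp only: sum_distrib_left)
  finally show ?thesis .
qed

context vacuum begin

lemma phi_sum:
  assumes "\<And>i. i \<in> I \<Longrightarrow> v i \<in> Fun D"
  shows "phi D u (\<lambda>p. \<Sum>i\<in>I. c i * v i p) = (\<lambda>p. \<Sum>i\<in>I. c i * phi D u (v i) p)"
  using assms
proof (induction I rule: infinite_finite_induct)
  case (insert i I)
  then show ?case
    using phi_lincomb[OF D, of "\<lambda>p. \<Sum>i\<in>I. c i * v i p" "v i" u "c i"]
    by (simp add: Fun_sum Fun_scale add.commute)
qed (use phi_0[OF D] in \<open>auto simp: zero_fun_def\<close>)

lemma ann_pos: "deg g > 0 \<Longrightarrow> ann (gn g)"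
  by (rule annI) (simp add: lam_wd phi_snoc[OF D f] fun_act_pos phi_0[OF D] flip: wd_append)

lemma ann_lc: "(\<And>i. ann (G i)) \<Longrightarrow> ann (lc c G)"
  unfolding lc_def by (intro ann_sum ann_mult)

lemma ann_wx: "n > 0 \<Longrightarrow> ann (wx c n)"
  unfolding wx_def by (intro ann_lc ann_sum ann_mult ann_pos) simp

lemma ann_modes: "S \<subseteq> {0<..} \<Longrightarrow> ann (modes S zp lg c)"
  unfolding modes_def by (intro ann_sum ann_mult ann_add ann_lc ann_pos ann_wx) auto

lemma lnul_sc: "lnul x \<Longrightarrow> lnul (sc s * x)"
  by (rule lnulI) (simp add: mult.assoc lam_sc, simp add: lnul_def)

lemma lnul_neg: "deg g < 0 \<Longrightarrow> lnul (gn g)"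
  by (rule lnulI) (simp add: lam_wd flip: wd_append)

lemma lnul_lc: "(\<And>i. lnul (G i)) \<Longrightarrow> lnul (lc c G)"
  unfolding lc_def by (intro lnul_sum lnul_sc)

text \<open>Each word here starts with \<open>W j\<close>, a zero mode, but this acts on the value
  of a word led by a creation operator, which is zero.\<close>

lemma lnul_wx:
  assumes "n < 0"
  shows "lnul (wx c n)"
proof -
  have "lnul (gn (W j) * gn (X n k))" for j k
    by (rule lnulI) (simp add: lam_wd phi_zero_mode assms fun_act_zero pderiv_zero flip: wd_append)
  then show ?thesis unfolding wx_def by (intro lnul_lc lnul_sum lnul_sc)
qed

lemma lnul_modes: "S \<subseteq> {..<0} \<Longrightarrow> lnul (modes S zp lg c)"
  unfolding modes_def by (intro lnul_sum lnul_sc lnul_add lnul_lc lnul_neg lnul_wx) auto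

lemma lam_wd_mult:
  "lam D f (wd w * x) p = (\<Sum>u\<in>Poly_Mapping.keys x. Poly_Mapping.lookup x u * const (phi D (w @ u) f p))"
proof -
  have "wd w * x = (\<Sum>u\<in>Poly_Mapping.keys x. sc (Poly_Mapping.lookup x u) * wd (w @ u))"
    by (subst tensors_expand[of x]) (simp add: sum_distrib_left sc_pull wd_append)
  then show ?thesis by (simp only: lam_sum sum_fun_apply lam_sc lam_wd)
qed

lemma lam_xsv0: "lam D f (xsv c 0 * x) p = const (\<Sum>i\<in>UNIV. c i * of_real (snd p $ i)) * lam D f x p"
proof -
  have "lam D f (gn (Xs 0 i) * x) p = const (of_real (snd p $ i)) * lam D f x p" for i
    unfolding lam_wd_mult
    by (simp add: lam_def phi_zero_mode const_mult sum_distrib_left mult.left_commute)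
  then show ?thesis
    by (simp add: lc_def sum_distrib_right mult.assoc lam_sum sum_fun_apply lam_sc const_sum const_mult)
qed

lemma lam_xsv0_power:
  "lam D f (xsv c 0 ^ n * x) p = const ((\<Sum>i\<in>UNIV. c i * of_real (snd p $ i)) ^ n) * lam D f x p"
  by (induction n) (simp_all add: mult.assoc lam_xsv0 const_mult)

text \<open>Leading zero modes of \<open>x^*\<close> are multiplications by functions, so what
  vanishes at the left end still vanishes behind them.\<close>

lemma lnul_xsv0_power: "lnul x \<Longrightarrow> lnul (xsv c 0 ^ n * x)"
  by (rule lnulI) (simp add: mult.assoc lam_xsv0_power, simp add: lnul_def)

text \<open>The \<open>eps\<close> terms of \<open>P i\<close> and of the correction cancel, which
  leaves the plain derivative in \<open>x^i\<close>. It is taken coefficient by coefficient because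
  \<open>lam\<close> has values in the formal scalars.\<close>

lemma lam_Qr:
  "Poly_Mapping.lookup (lam D f (Qr i * x) p) e =
    pderiv_on D (axis i 1, 0) (\<lambda>p. Poly_Mapping.lookup (lam D f x p) e) p"
proof -
  have F: "phi D u f \<in> Fun D" for u by (rule Fun_phi[OF D f])
  have act: "fun_act D (P i) h p - (1/2) * (\<Sum>j\<in>UNIV. \<Sum>k\<in>UNIV. eps i j k *
      fun_act D (X 0 j) (fun_act D (W k) h) p) = pderiv_on D (axis i 1, 0) h p" for h
    by (simp add: mult.assoc)
  have "lam D f (Qr i * x) p = lam D f (wd [P i] * x) p - const (1/2) * (\<Sum>j\<in>UNIV. \<Sum>k\<in>UNIV.
     const (eps i j k) * lam D f (wd [X 0 j, W k] * x) p)"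
    by (simp add: Qr_def left_diff_distrib lam_diff lam_sc mult.assoc sum_distrib_right lam_sum
        sum_fun_apply flip: wd_append)
  also have "\<dots> = (\<Sum>u\<in>Poly_Mapping.keys x. Poly_Mapping.lookup x u *
     (const (fun_act D (P i) (phi D u f) p) - const (1/2) * (\<Sum>j\<in>UNIV. \<Sum>k\<in>UNIV.
       const (eps i j k) * const (fun_act D (X 0 j) (fun_act D (W k) (phi D u f)) p))))"
    unfolding lam_wd_mult sum_sum_mult_sum
    by (simp add: phi_zero_mode right_diff_distrib sum_subtractf sum_distrib_left mult.left_commute)
  also have "\<dots> = (\<Sum>u\<in>Poly_Mapping.keys x. Poly_Mapping.lookup x u *
      const (pderiv_on D (axis i 1, 0) (phi D u f) p))"
    unfolding act[symmetric] const_diff const_mult const_sum ..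
  finally have "Poly_Mapping.lookup (lam D f (Qr i * x) p) e =
    (\<Sum>u\<in>Poly_Mapping.keys x. Poly_Mapping.lookup (Poly_Mapping.lookup x u) e * pderiv_on D (axis i 1, 0) (phi D u f) p)"
    by (simp add: lookup_sum lookup_mult_const)
  moreover have "pderiv_on D (axis i 1, 0) (\<lambda>p. Poly_Mapping.lookup (lam D f x p) e) p =
     (\<Sum>u\<in>Poly_Mapping.keys x. Poly_Mapping.lookup (Poly_Mapping.lookup x u) e * pderiv_on D (axis i 1, 0) (phi D u f) p)"
    unfolding lam_def lookup_sum lookup_mult_const
    by (simp add: pderiv_sum Fun_scale F pderiv_scale)
  ultimately show ?thesis by simp
qed

lemma lam_lc_Qr_mult:
  assumes "\<And>p. lam D f x p = s * const (h p)" "h \<in> Fun D" "\<And>i p. pderiv_on D (axis i 1, 0) h p = 0"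
  shows "lam D f (sc t * lc c Qr * x) p = 0"
proof -
  have "lam D f (Qr i * x) p = 0" for i
  proof (rule poly_mapping_eqI)
    fix e
    show "Poly_Mapping.lookup (lam D f (Qr i * x) p) e = Poly_Mapping.lookup 0 e"
      unfolding lam_Qr assms(1) lookup_mult_const by (simp add: pderiv_scale assms)
  qed
  then show ?thesis
    by (simp add: lc_def mult.assoc sum_distrib_right sum_distrib_left lam_sum sum_fun_apply lam_sc)
qed

text \<open>If the value of what stands to the right does not depend on the \<open>x\<close>
  coordinates, the exponent acts by zero and only the constant term of the exponential
  remains.\<close>

lemma lam_expR_Qr:
  assumes "\<And>p. lam D f x p = s * const (h p)" "h \<in> Fun D" "\<And>i p. pderiv_on D (axis i 1, 0) h p = 0"
  shows "lam D f (expR N (sc t * lc c Qr) * x) = lam D f x"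
proof -
  have z: "lam D f ((sc t * lc c Qr) ^ Suc n * x) p = 0" for n p
  proof (induction n arbitrary: p)
    case 0
    then show ?case using lam_lc_Qr_mult[OF assms] by simp
  next
    case (Suc n)
    \<comment> \<open>After one derivative the value is zero, and zero again has the shape that
      \<open>lam_lc_Qr_mult\<close> asks for.\<close>
    have "lam D f (sc t * lc c Qr * ((sc t * lc c Qr) ^ Suc n * x)) p = 0"
      by (rule lam_lc_Qr_mult[where s = 0 and h = "\<lambda>p. 0"]) (use Suc in \<open>simp_all add: Fun_zero pderiv_zero\<close>)
    then show ?case by (simp add: mult.assoc)
  qed
  show ?thesis
    unfolding expR_split
    by (rule ext) (simp only: distrib_right mult_1_left sum_distrib_right lam_plus plus_fun_apply lam_sum
        sum_fun_apply mult.assoc[of "sc _"] lam_sc z mult_zero_right sum.neutral_const add_0_right)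
qed

text \<open>The right factor \<open>r\<close> is included so that the rule also covers an operator
  that annihilates the vacuum only after passing \<open>r\<close>, as the \<open>Qr\<close> term
  does with the creation exponential.\<close>

lemma lam_expR_ann:
  assumes "ann (y * r)"
  shows "lam D f (x * expR N y * r) = lam D f (x * r)"
proof -
  have "lam D f (x * (sc (const (1 / fact (Suc n))) * y ^ Suc n) * r) = 0" for n
  proof -
    have "x * (sc (const (1 / fact (Suc n))) * y ^ Suc n) * r = (x * sc (const (1 / fact (Suc n))) * y ^ n) * (y * r)"
      by (simp only: power_Suc2 mult.assoc)
    then show ?thesis using assms by (simp only: ann_def)
  qed
  then show ?thesis
    unfolding expR_split
    by (simp only: distrib_left distrib_right mult_1_right sum_distrib_right sum_distrib_left lam_plus lam_sum
        sum.neutral_const add_0_right)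
qed

lemma lam_expR_lnul:
  assumes "lnul y"
  shows "lam D f (expR N y * r) = lam D f r"
proof -
  have "lam D f (sc (const (1 / fact (Suc n))) * y ^ Suc n * r) = 0" for n
  proof -
    have "lnul (sc (const (1 / fact (Suc n))) * (y * (y ^ n)))"
      by (intro lnul_sc lnul_mult assms)
    then show ?thesis by (simp only: lnul_def power_Suc mult.assoc)
  qed
  then show ?thesis
    unfolding expR_split
    by (simp only: distrib_right mult_1_left sum_distrib_right lam_plus lam_sum sum.neutral_const add_0_right)
qed

lemma cm0_sum: "(\<And>i. i \<in> I \<Longrightarrow> cm (x i) y 0) \<Longrightarrow> cm (\<Sum>i\<in>I. x i) y 0"
  using cm_sum_left[of I x y "\<lambda>_. 0"] by simp

lemma cm0_add: "cm x y 0 \<Longrightarrow> cm x' y 0 \<Longrightarrow> cm (x + x') y 0"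
  using cm_add_left[of x y 0 x' 0] by simp

lemma cm0_scale: "cm x y 0 \<Longrightarrow> cm (sc s * x) y 0"
  using cm_scale_left[of "sc s" x y 0] by simp

end

section \<open>Vacuum expectation of the truncated product\<close>

definition lin_fun :: "int ^ 3 \<Rightarrow> pt \<Rightarrow> real" where
  "lin_fun w p = (\<Sum>j\<in>UNIV. of_int (w $ j) * snd p $ j)"

definition cvec :: "int ^ 3 \<Rightarrow> 3 \<Rightarrow> complex" where "cvec w i = of_int (w $ i)"

lemma bounded_linear_lin_fun: "bounded_linear (lin_fun w)"
  unfolding lin_fun_def
  by (intro bounded_linear_sum bounded_linear_const_mult bounded_linear_snd_component)

lemma cvec_lin_fun: "(\<Sum>i\<in>UNIV. cvec w i * of_real (snd p $ i)) = of_real (lin_fun w p)"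
  by (simp add: cvec_def lin_fun_def)

lemma sc_of_nat: "of_nat n = sc (of_nat n)"
  by (induction n) (simp_all add: sc_add)

lemma const_of_nat: "const (of_nat n) = of_nat n"
  by (induction n) (simp_all add: const_add)

text \<open>The truncation of \<open>L(w/z)\<close> at the power \<open>K\<close> of
  \<open>w/z\<close>, in the shape in which it arises from the mode commutator. The logarithmic
  summand is the expansion of \<open>1/2 log (w/z) log (1 - w/z)\<close>.\<close>

definition ratio_series :: "int \<Rightarrow> scal" where
  "ratio_series K = (\<Sum>m\<in>{0<..K}. z_pow (- m) * w_pow m *
     (const (1 / (of_int m)\<^sup>2) + const (1 / (2 * of_int m)) * (log_z - log_w)))"

locale vexp =
  fixes D :: "pt set" and w3 :: "int ^ 3"
  assumes bounded_D: "bounded D"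

sublocale vexp \<subseteq> vacuum D "exp_fun D w3"
  by unfold_locales (rule bounded_D exp_fun_Fun_pderiv(1)[OF bounded_D])+

context vexp begin

lemma fun_act_W_exp: "fun_act D (W k) (exp_fun D w3) = (\<lambda>p. cvec w3 k * exp_fun D w3 p)"
proof -
  have "(\<Sum>j\<in>UNIV. real_of_int (w3 $ j) * (axis k 1 :: real ^ 3) $ j) = of_int (w3 $ k)"
  proof -
    have "(\<Sum>j\<in>UNIV. real_of_int (w3 $ j) * (axis k 1 :: real ^ 3) $ j) =
      (\<Sum>j\<in>UNIV. if k = j then real_of_int (w3 $ j) else 0)"
      by (intro sum.cong refl) (simp add: axis_def)
    then show ?thesis by simp
  qed
  then show ?thesis
    by (simp only: fun_act.simps exp_fun_Fun_pderiv(2)[OF bounded_D] snd_conv cvec_def) simp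
qed

lemma pderiv_x_exp: "pderiv_on D (axis i 1, 0) (exp_fun D w3) = (\<lambda>p. 0)"
  unfolding exp_fun_Fun_pderiv(2)[OF bounded_D] by simp

text \<open>At the right end each \<open>W\<close> takes its eigenvalue on
  \<open>exp_fun D w3\<close>. For \<open>c\<close> the cross product of the first two vectors this
  scalar is the determinant.\<close>

lemma ann_Wv: "ann (Wv c - sc (const (dot c (cvec w3))))"
proof -
  have "ann (gn (W k) - sc (const (cvec w3 k)))" for k
    by (rule annI) (simp add: right_diff_distrib lam_diff lam_wd lam_sc_right phi_snoc[OF D f] fun_act_W_exp
        phi_scale[OF D f] const_mult del: fun_act.simps flip: wd_append)
  then have "ann (\<Sum>k\<in>UNIV. sc (const (c k)) * (gn (W k) - sc (const (cvec w3 k))))"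
    by (intro ann_sum ann_mult)
  then show ?thesis
    by (simp add: lc_def dot_def const_sum sc_sum const_mult sc_mult right_diff_distrib sum_subtractf)
qed

text \<open>\<open>exp_fun D w3\<close> is independent of the \<open>x\<close> coordinates, so on it
  \<open>P i\<close> coincides with the quadratic correction in \<open>Qr i\<close>. The two are
  compared as endings of a word, because an arbitrary \<open>u\<close> stands in front.\<close>

lemma ann_Qr: "ann (lc c Qr)"
proof (intro ann_lc annI)
  fix i u p
  have XW: "phi D (u @ [X 0 j, W k]) (exp_fun D w3) =
      phi D u (fun_act D (X 0 j) (fun_act D (W k) (exp_fun D w3)))" for j k
    using phi_snoc[OF D f, of "W k" "u @ [X 0 j]"]
      phi_snoc[OF D fun_act_Fun[OF D f], of "X 0 j" u "W k"] by simp
  have FX: "fun_act D (X 0 j) (fun_act D (W k) (exp_fun D w3)) \<in> Fun D" for j k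
    by (intro fun_act_Fun D f)
  have P: "fun_act D (P i) (exp_fun D w3) = (\<lambda>p. \<Sum>j\<in>UNIV. \<Sum>k\<in>UNIV.
     (1/2 * eps i j k) * fun_act D (X 0 j) (fun_act D (W k) (exp_fun D w3)) p)"
    by (rule ext) (simp add: pderiv_x_exp mult.assoc sum_distrib_left)
  have "phi D (u @ [P i]) (exp_fun D w3) =
    (\<lambda>p. \<Sum>j\<in>UNIV. \<Sum>k\<in>UNIV. (1/2 * eps i j k) * phi D (u @ [X 0 j, W k]) (exp_fun D w3) p)"
  proof -
    let ?F = "\<lambda>j k. fun_act D (X 0 j) (fun_act D (W k) (exp_fun D w3))"
    have inner: "(\<lambda>p. \<Sum>k\<in>UNIV. (1/2 * eps i j k) * ?F j k p) \<in> Fun D" for j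
      by (intro Fun_sum Fun_scale FX)
    have "phi D (u @ [P i]) (exp_fun D w3) =
      phi D u (\<lambda>p. \<Sum>j\<in>UNIV. 1 * (\<Sum>k\<in>UNIV. (1/2 * eps i j k) * ?F j k p))"
      by (subst phi_snoc[OF D f]) (simp_all only: P mult_1 deg.simps order_refl)
    also have "\<dots> = (\<lambda>p. \<Sum>j\<in>UNIV. 1 * (\<Sum>k\<in>UNIV. (1/2 * eps i j k) * phi D u (?F j k) p))"
      by (subst phi_sum[OF inner]) (simp only: phi_sum[OF FX])
    finally show ?thesis unfolding XW by simp
  qed
  then have P: "const (phi D (u @ [P i]) (exp_fun D w3) p) = (\<Sum>j\<in>UNIV. \<Sum>k\<in>UNIV.
     const (1/2) * (const (eps i j k) * const (phi D (u @ [X 0 j, W k]) (exp_fun D w3) p)))"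
    by (simp only: const_sum const_mult mult.assoc)
  have "wd u * (sc a * (sc b * (gn g * gn h))) = sc a * (sc b * wd (u @ [g, h]))" for a b g h
    by (simp only: sc_pull[of "wd u"] wd_append[symmetric] append_Cons append_Nil)
  then show "lam D (exp_fun D w3) (wd u * Qr i) p = 0"
    unfolding Qr_def right_diff_distrib sum_distrib_left lam_diff lam_sum
    by (simp add: sum_fun_apply lam_sc lam_wd P flip: wd_append)
qed

lemma lam_xsv0_exp:
  "lam D (exp_fun D w3) (xsv (cvec w) 0 ^ n) p = const (of_real (lin_fun w p) ^ n * exp_fun D w3 p)"
  using lam_xsv0_power[of "cvec w" n 1 p] lam_wd[of "[]" p]
  by (simp add: cvec_lin_fun const_mult)

text \<open>The coefficient \<open>(m + n) / (2 m n)\<close> vanishes on the diagonal, so no zero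
  mode of \<open>x\<close> appears. The remaining modes are sorted by the sign of
  \<open>m + n\<close>: annihilation operators into \<open>Yp\<close>, creation operators into
  \<open>Ym\<close>. The diagonal terms in \<open>Wv\<close> add up to
  \<open>ratio_series K\<close>.\<close>

lemma cm_modes_contraction:
  fixes c d :: "3 \<Rightarrow> complex" and K :: int
  defines "a \<equiv> modes {0<..K} z_pow log_z c" and "b \<equiv> modes {- K..<0} w_pow log_w d"
  shows "\<exists>Yp Ym. cm a b (sc (ratio_series K) * Wv (cross c d) + Yp + Ym) \<and>
     cm Yp b 0 \<and> ann Yp \<and> cm Ym b 0 \<and> cm Ym (xsv d 0) 0 \<and> cm Ym a 0 \<and> lnul Ym"
proof -
  let ?cr = "cross c d" and ?S = "{0<..K}" and ?T = "{- K..<0}"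
  let ?zw = "\<lambda>m n. sc (z_pow (- m) * w_pow (- n))"
  let ?U = "\<lambda>m n. ?zw m n * (sc (const (of_int (m + n) / (2 * of_int m * of_int n))) * xv ?cr (m + n))"
  let ?s = "\<lambda>m. const (1 / (of_int m)\<^sup>2) + const (1 / (2 * of_int m)) * (log_z - log_w)"
  define Yp where "Yp = (\<Sum>m\<in>?S. \<Sum>n\<in>?T. if m + n > 0 then ?U m n else 0)"
  define Ym where "Ym = (\<Sum>m\<in>?S. \<Sum>n\<in>?T. if m + n < 0 then ?U m n else 0)"
  have "cm a b (\<Sum>m\<in>?S. \<Sum>n\<in>?T. ?zw m n *
     (sc (const (of_int (m + n) / (2 * of_int m * of_int n))) * xv ?cr (m + n) +
      (if m = - n then sc (?s m) * Wv ?cr else 0)))"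
    unfolding a_def b_def by (rule cm_modes_modes) auto
  moreover have "(\<Sum>m\<in>?S. \<Sum>n\<in>?T. ?zw m n *
     (sc (const (of_int (m + n) / (2 * of_int m * of_int n))) * xv ?cr (m + n) +
      (if m = - n then sc (?s m) * Wv ?cr else 0))) = sc (ratio_series K) * Wv ?cr + Yp + Ym"
  proof -
    have t: "?zw m n * (sc (const (of_int (m + n) / (2 * of_int m * of_int n))) * xv ?cr (m + n) +
      (if m = - n then sc (?s m) * Wv ?cr else 0)) =
      (if n = - m then sc (z_pow (- m) * w_pow m * ?s m) * Wv ?cr else 0)
        + (if m + n > 0 then ?U m n else 0) + (if m + n < 0 then ?U m n else 0)" for m n
    proof -
      consider "m + n > 0" | "m + n < 0" | "n = - m" by linarith
      then show ?thesis
      proof cases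
        case 3
        then show ?thesis by (simp add: sc_mult mult.assoc)
      qed (simp_all add: distrib_left)
    qed
    have diag: "(\<Sum>n\<in>?T. if n = - m then sc (z_pow (- m) * w_pow m * ?s m) * Wv ?cr else 0) =
      sc (z_pow (- m) * w_pow m * ?s m) * Wv ?cr" if "m \<in> ?S" for m
      using that by (simp add: sum.delta)
    have "(\<Sum>m\<in>?S. \<Sum>n\<in>?T. if n = - m then sc (z_pow (- m) * w_pow m * ?s m) * Wv ?cr else 0) =
      sc (ratio_series K) * Wv ?cr"
      unfolding ratio_series_def sc_sum sum_distrib_right by (rule sum.cong[OF refl diag])
    then show ?thesis
      unfolding t sum.distrib Yp_def Ym_def by simp
  qed
  ultimately have "cm a b (sc (ratio_series K) * Wv ?cr + Yp + Ym)" by simp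
  moreover have "cm Yp b 0" "cm Ym b 0" "cm Ym a 0"
  proof -
    have U: "cm (?U m n) b 0" "cm (?U m n) a 0" for m n
      unfolding a_def b_def by (intro cm0_scale cm_xv_modes dot_cross)+
    have if0: "cm (if Q then x else 0) y 0" if "cm x y 0" for Q x y using that by simp
    show "cm Yp b 0" "cm Ym b 0" "cm Ym a 0"
      unfolding Yp_def Ym_def by (intro cm0_sum if0 U)+
  qed
  moreover have "cm (if m + n < 0 then ?U m n else 0) (xsv d 0) 0" for m n
  proof (cases "m + n < 0")
    case True
    then have "cm (?U m n) (xsv d 0) 0" by (intro cm0_scale cm_xv_xsv0) simp
    then show ?thesis using True by simp
  qed simp
  then have "cm Ym (xsv d 0) 0" unfolding Ym_def by (intro cm0_sum)
  moreover have "ann Yp"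
    unfolding Yp_def by (intro ann_sum) (simp add: ann_mult ann_lc ann_pos)
  moreover have "lnul Ym"
    unfolding Ym_def by (intro lnul_sum) (simp add: lnul_sc lnul_lc lnul_neg)
  ultimately show ?thesis by blast
qed

lemma lam_modes_power:
  fixes w1 w2 :: "int ^ 3" and K :: int
  defines "a \<equiv> modes {0<..K} z_pow log_z (cvec w1)" and "b \<equiv> modes {- K..<0} w_pow log_w (cvec w2)"
    and "e \<equiv> xsv (cvec w2) 0" and "\<delta> \<equiv> dot (cross (cvec w1) (cvec w2)) (cvec w3)"
  shows "lam D (exp_fun D w3) (a ^ k * e ^ i * b ^ l) p =
    (if k = l then of_nat (fact k) * (ratio_series K * const \<delta>) ^ k *
       const (of_real (lin_fun w2 p) ^ i * exp_fun D w3 p) else 0)"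
proof -
  let ?cr = "cross (cvec w1) (cvec w2)"
  obtain Yp Ym where Y: "cm a b (sc (ratio_series K) * Wv ?cr + Yp + Ym)"
    "cm Yp b 0" "ann Yp" "cm Ym b 0" "cm Ym e 0" "cm Ym a 0" "lnul Ym"
    using cm_modes_contraction[of K "cvec w1" "cvec w2", folded a_def b_def e_def] by (elim exE conjE)
  \<comment> \<open>The commutator of the annihilation part with the zero modes of
    \<open>x^*\<close> in the second operator. Being a combination of modes of \<open>x\<close>
    along the cross product, it commutes with \<open>e\<close> and \<open>b\<close> and annihilates
    the vacuum.\<close>
  define C where "C = (\<Sum>n\<in>{0<..K}. sc (z_pow (- n)) * (sc (const (1 / (2 * of_int n))) * xv ?cr n
        + sc (const (1/2) * log_z) * xv ?cr n))"
  have aeC: "cm a e C" unfolding a_def e_def C_def by (rule cm_modes_xsv0) simp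
  have Ce: "cm C e 0" unfolding C_def e_def
    by (intro cm0_sum cm0_scale cm0_add cm_xv_xsv0) auto
  have Cb: "cm C b 0" unfolding C_def b_def
    by (intro cm0_sum cm0_scale cm0_add cm_xv_modes dot_cross)
  have annC: "ann C" unfolding C_def
    by (intro ann_sum ann_mult ann_add ann_lc ann_pos) auto
  have anna: "ann a" unfolding a_def by (rule ann_modes) auto
  have lnulb: "lnul (e ^ i * b)" for i
    unfolding e_def b_def by (intro lnul_xsv0_power lnul_modes) auto
  have Wb: "cm (Wv ?cr) b 0" unfolding b_def by (rule cm_Wv_modes) simp
  have annW: "ann (Wv ?cr - sc (const \<delta>))" unfolding \<delta>_def by (rule ann_Wv)
  have lin: "lam D (exp_fun D w3) (sc (ratio_series K) * sc (const \<delta>) * x) =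
     lam D (exp_fun D w3) (sc (ratio_series K) * sc (const \<delta>) * y)"
    if "lam D (exp_fun D w3) x = lam D (exp_fun D w3) y" for x y
    by (rule ext) (simp only: mult.assoc lam_sc that)
  have "lam D (exp_fun D w3) (a ^ k * e ^ i * b ^ l) =
    (if k = l then lam D (exp_fun D w3) (of_nat (fact k) * (sc (ratio_series K) * sc (const \<delta>)) ^ k * e ^ i) else 0)"
    by (rule lam_contraction[OF anna lnulb aeC Ce Cb annC Y(1) central_sc Wb annW central_sc Y(2-7) lin])
  also have "of_nat (fact k) * (sc (ratio_series K) * sc (const \<delta>)) ^ k * e ^ i =
     sc (of_nat (fact k) * (ratio_series K * const \<delta>) ^ k) * e ^ i"
    unfolding sc_of_nat[of "fact k"] by (simp only: sc_mult[symmetric] sc_power[symmetric])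
  finally show ?thesis by (simp add: lam_sc lam_xsv0_exp e_def)
qed

end

definition exp_sum :: "nat \<Rightarrow> int ^ 3 \<Rightarrow> pt \<Rightarrow> complex" where
  "exp_sum N w p = (\<Sum>n\<le>N. 1 / fact n * of_real (lin_fun w p) ^ n)"

context vexp begin

lemma lin_fun_power_exp:
  "(\<lambda>p. of_real (lin_fun w p) ^ n * exp_fun D w3 p) \<in> Fun D"
  "pderiv_on D (axis i 1, 0) (\<lambda>p. of_real (lin_fun w p) ^ n * exp_fun D w3 p) = (\<lambda>p. 0)"
proof (induction n)
  case 0
  { case 1 show ?case using f by simp }
  { case 2 show ?case by (simp add: pderiv_x_exp) }
next
  case (Suc n)
  have eq: "(\<lambda>p. of_real (lin_fun w p) ^ Suc n * exp_fun D w3 p) =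
    (\<lambda>p. complex_of_real (lin_fun w p) * (of_real (lin_fun w p) ^ n * exp_fun D w3 p))"
    by (simp add: mult.assoc)
  { case 1 show ?case unfolding eq by (rule Fun_coord_mult[OF D bounded_linear_lin_fun Suc(1)]) }
  { case 2 show ?case unfolding eq pderiv_coord[OF bounded_linear_lin_fun Suc(1)] Suc(2)
      by (simp add: lin_fun_def) }
qed

lemma exp_sum_exp:
  "(\<lambda>p. exp_sum N w p * exp_fun D w3 p) \<in> Fun D"
  "pderiv_on D (axis i 1, 0) (\<lambda>p. exp_sum N w p * exp_fun D w3 p) = (\<lambda>p. 0)"
proof -
  have eq: "(\<lambda>p. exp_sum N w p * exp_fun D w3 p) =
      (\<lambda>p. \<Sum>n\<le>N. 1 / fact n * (of_real (lin_fun w p) ^ n * exp_fun D w3 p))"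
    by (simp add: exp_sum_def sum_distrib_right mult.assoc)
  have F: "(\<lambda>p. c * (of_real (lin_fun w p) ^ n * exp_fun D w3 p)) \<in> Fun D" for c n
    by (intro Fun_scale lin_fun_power_exp)
  show "(\<lambda>p. exp_sum N w p * exp_fun D w3 p) \<in> Fun D"
    unfolding eq by (intro Fun_sum F)
  show "pderiv_on D (axis i 1, 0) (\<lambda>p. exp_sum N w p * exp_fun D w3 p) = (\<lambda>p. 0)"
    unfolding eq by (simp only: pderiv_sum[OF F] pderiv_scale[OF lin_fun_power_exp(1)] lin_fun_power_exp(2)) simp
qed

text \<open>Only equal powers of \<open>a\<close> and \<open>b\<close> contribute, with a factor
  \<open>fact k\<close>. It cancels one of the two factors \<open>1 / fact k\<close>, so the
  diagonal is again an exponential sum, and the sum over the powers of \<open>e\<close> splits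
  off.\<close>

lemma lam_expR_modes:
  fixes w1 w2 :: "int ^ 3" and K :: int
  defines "a \<equiv> modes {0<..K} z_pow log_z (cvec w1)" and "b \<equiv> modes {- K..<0} w_pow log_w (cvec w2)"
    and "e \<equiv> xsv (cvec w2) 0" and "\<delta> \<equiv> dot (cross (cvec w1) (cvec w2)) (cvec w3)"
  shows "lam D (exp_fun D w3) (expR N a * (expR N e * expR N b)) p =
    (\<Sum>k\<le>N. const (1 / fact k) * (ratio_series K * const \<delta>) ^ k) *
      const (exp_sum N w2 p * exp_fun D w3 p)"
proof -
  let ?c = "\<lambda>n. const (1 / fact n)" and ?s = "ratio_series K * const \<delta>"
  let ?h = "\<lambda>i. of_real (lin_fun w2 p) ^ i * exp_fun D w3 p"
  have t: "sc x * a ^ k * (sc y * e ^ i * (sc u * b ^ l)) = sc x * (sc y * (sc u * (a ^ k * e ^ i * b ^ l)))"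
    for x y u k i l
    by (simp only: mult.assoc sc_pull[of "a ^ k"] sc_pull[of "e ^ i"])
  have "expR N a * (expR N e * expR N b) =
    (\<Sum>k\<le>N. \<Sum>i\<le>N. \<Sum>l\<le>N. sc (?c k) * (sc (?c i) * (sc (?c l) * (a ^ k * e ^ i * b ^ l))))"
    unfolding expR_def sum_product unfolding sum_distrib_left t ..
  then have "lam D (exp_fun D w3) (expR N a * (expR N e * expR N b)) p =
    (\<Sum>k\<le>N. \<Sum>i\<le>N. \<Sum>l\<le>N. ?c k * (?c i * (?c l *
       (if k = l then of_nat (fact k) * ?s ^ k * const (?h i) else 0))))"
    by (simp only: lam_sum sum_fun_apply lam_sc)
      (simp only: a_def b_def e_def \<delta>_def lam_modes_power)
  also have "\<dots> = (\<Sum>k\<le>N. \<Sum>i\<le>N. ?c k * ?s ^ k * (?c i * const (?h i)))"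
  proof (intro sum.cong refl)
    fix k i assume "k \<in> {..N}"
    have one: "?c k * of_nat (fact k) = 1"
      unfolding const_of_nat[symmetric] const_mult[symmetric] by simp
    have "(\<Sum>l\<le>N. ?c k * (?c i * (?c l * (if k = l then of_nat (fact k) * ?s ^ k * const (?h i) else 0)))) =
      (\<Sum>l\<le>N. if k = l then ?c k * (?c i * (?c l * (of_nat (fact k) * ?s ^ k * const (?h i)))) else 0)"
      by (intro sum.cong refl) simp
    also have "\<dots> = ?c k * (?c i * (?c k * (of_nat (fact k) * ?s ^ k * const (?h i))))"
      using \<open>k \<in> {..N}\<close> by simp
    also have "\<dots> = (?c k * of_nat (fact k)) * (?c k * ?s ^ k * (?c i * const (?h i)))"
      by (simp only: ac_simps)
    finally show "(\<Sum>l\<le>N. ?c k * (?c i * (?c l * (if k = l then of_nat (fact k) * ?s ^ k * const (?h i) else 0)))) =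
      ?c k * ?s ^ k * (?c i * const (?h i))" unfolding one by simp
  qed
  also have "\<dots> = (\<Sum>k\<le>N. ?c k * ?s ^ k) * (\<Sum>i\<le>N. ?c i * const (?h i))"
    by (rule sum_product[symmetric])
  also have "(\<Sum>i\<le>N. ?c i * const (?h i)) = const (exp_sum N w2 p * exp_fun D w3 p)"
    unfolding exp_sum_def sum_distrib_right const_sum mult.assoc const_mult[symmetric] ..
  finally show ?thesis .
qed

text \<open>The factors that do not contract are removed from the ends inwards: on the right the
  annihilation part and then the \<open>Qr\<close> exponential, which commutes with the creation
  part; on the left the creation part. The left \<open>Qr\<close> exponential goes only after the
  product behind it has been evaluated, because it needs a value independent of
  \<open>x\<close>.\<close>

lemma lam_vertex_product:
  fixes w1 w2 :: "int ^ 3" and K :: int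
  defines "\<delta> \<equiv> dot (cross (cvec w1) (cvec w2)) (cvec w3)"
  shows "lam D (exp_fun D w3)
     ((expR N (xsv (cvec w1) 0) * expR N (sc log_z * lc (cvec w1) Qr) *
       expR N (modes {- K..<0} z_pow log_z (cvec w1)) * expR N (modes {0<..K} z_pow log_z (cvec w1))) *
      (expR N (xsv (cvec w2) 0) * expR N (sc log_w * lc (cvec w2) Qr) *
       expR N (modes {- K..<0} w_pow log_w (cvec w2)) * expR N (modes {0<..K} w_pow log_w (cvec w2)))) p =
    (\<Sum>k\<le>N. const (1 / fact k) * (ratio_series K * const \<delta>) ^ k) *
      const (exp_sum N w1 p * exp_sum N w2 p * exp_fun D w3 p)"
proof -
  let ?f = "exp_fun D w3"
  define a0 where "a0 = expR N (xsv (cvec w1) 0)"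
  define aQ where "aQ = expR N (sc log_z * lc (cvec w1) Qr)"
  define am where "am = expR N (modes {- K..<0} z_pow log_z (cvec w1))"
  define ap where "ap = expR N (modes {0<..K} z_pow log_z (cvec w1))"
  define b0 where "b0 = expR N (xsv (cvec w2) 0)"
  define bQ where "bQ = expR N (sc log_w * lc (cvec w2) Qr)"
  define bm where "bm = expR N (modes {- K..<0} w_pow log_w (cvec w2))"
  define bp where "bp = expR N (modes {0<..K} w_pow log_w (cvec w2))"
  let ?G = "\<Sum>k\<le>N. const (1 / fact k) * (ratio_series K * const \<delta>) ^ k"
  have annQ: "ann (sc log_w * lc (cvec w2) Qr * bm)"
  proof -
    let ?Q = "sc log_w * lc (cvec w2) Qr" and ?b = "modes {- K..<0} w_pow log_w (cvec w2)"
    have Qb: "cm ?Q ?b 0"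
      by (intro cm0_scale cm_Q_modes) simp
    have "ann (?Q * (sc s * ?b ^ n))" for s n
    proof -
      have "ann (?Q * ?b ^ n)"
        by (rule ann_cong[OF _ ann_mult[OF ann_mult[OF ann_Qr]]]) (use cm_power0[OF Qb, of n] in \<open>simp add: cm_def\<close>)
      then show ?thesis unfolding sc_pull[of ?Q] by (rule ann_mult)
    qed
    then show ?thesis unfolding bm_def expR_def sum_distrib_left by (intro ann_sum)
  qed
  have R: "lam D ?f (ap * (b0 * bQ * bm * bp)) p = ?G * const (exp_sum N w2 p * ?f p)" for p
  proof -
    have "lam D ?f (ap * (b0 * bQ * bm * bp)) = lam D ?f ((ap * b0 * bQ * bm) * bp * 1)"
      by (simp only: mult.assoc mult_1_right)
    also have "\<dots> = lam D ?f (ap * b0 * bQ * bm * 1)"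
      unfolding bp_def by (rule lam_expR_ann, unfold mult_1_right, rule ann_modes) auto
    also have "\<dots> = lam D ?f ((ap * b0) * bQ * bm)" by simp
    also have "\<dots> = lam D ?f (ap * b0 * bm)"
      using annQ unfolding bQ_def by (rule lam_expR_ann)
    also have "\<dots> = lam D ?f (ap * (b0 * bm))" by (simp only: mult.assoc)
    finally show ?thesis
      unfolding ap_def b0_def bm_def \<delta>_def by (simp only: lam_expR_modes)
  qed
  have am: "lam D ?f (am * (ap * (b0 * bQ * bm * bp))) = lam D ?f (ap * (b0 * bQ * bm * bp))"
    unfolding am_def by (rule lam_expR_lnul, rule lnul_modes) auto
  have "lam D ?f (aQ * (am * (ap * (b0 * bQ * bm * bp)))) = lam D ?f (am * (ap * (b0 * bQ * bm * bp)))"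
    unfolding aQ_def
    by (rule lam_expR_Qr[where s = ?G and h = "\<lambda>p. exp_sum N w2 p * ?f p"])
      (simp_all only: am R exp_sum_exp)
  then have r: "lam D ?f (aQ * (am * (ap * (b0 * bQ * bm * bp)))) p = ?G * const (exp_sum N w2 p * ?f p)"
    using am R by simp
  have "lam D ?f (a0 * x) p = const (exp_sum N w1 p) * lam D ?f x p" for x
    unfolding a0_def expR_def sum_distrib_right mult.assoc
    by (simp only: lam_sum sum_fun_apply lam_sc lam_xsv0_power cvec_lin_fun exp_sum_def const_sum const_mult
        sum_distrib_right mult.assoc)
  then have "lam D ?f (a0 * (aQ * (am * (ap * (b0 * bQ * bm * bp))))) p =
    ?G * const (exp_sum N w1 p * exp_sum N w2 p * ?f p)"
    by (simp only: r) (simp only: const_mult mult_ac)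
  then show ?thesis
    unfolding a0_def aQ_def am_def ap_def b0_def bQ_def bm_def bp_def by (simp only: mult.assoc)
qed

end

section \<open>Restriction to finitely many modes\<close>

text \<open>The product of \<open>Poly_Mapping\<close> sums over pairs of words with given
  concatenation. A prefix determines the second word, so this is the sum over cuts that defines
  \<open>op_mult\<close>.\<close>

lemma lookup_tensors_mult:
  fixes s t :: tensors
  shows "Poly_Mapping.lookup (s * t) u =
    (\<Sum>k\<le>length u. Poly_Mapping.lookup s (take k u) * Poly_Mapping.lookup t (drop k u))"
proof -
  have inner: "(\<Sum>q. Poly_Mapping.lookup t q when u = l + q) =
      (if l = take (length l) u \<and> length l \<le> length u then Poly_Mapping.lookup t (drop (length l) u) else 0)" for l
  proof (cases "\<exists>q. u = l @ q")
    case True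
    then obtain q where u: "u = l @ q" by blast
    have "(\<Sum>q'. Poly_Mapping.lookup t q' when u = l + q') = (\<Sum>q'. Poly_Mapping.lookup t q' when q' = q)"
      by (rule Sum_any.cong) (auto simp: u plus_list_def when_def)
    then show ?thesis by (simp add: u)
  next
    case False
    then have "\<not> (l = take (length l) u \<and> length l \<le> length u)"
      by (metis append_take_drop_id)
    moreover have "(Poly_Mapping.lookup t q when u = l + q) = 0" for q
      using False by (auto simp: plus_list_def when_def)
    ultimately show ?thesis by (simp only: Sum_any.neutral if_False)
  qed
  let ?F = "\<lambda>l. Poly_Mapping.lookup s l *
    (if l = take (length l) u \<and> length l \<le> length u then Poly_Mapping.lookup t (drop (length l) u) else 0)"
  have "Poly_Mapping.lookup (s * t) u = (\<Sum>l. ?F l)"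
    unfolding lookup_mult inner ..
  also have "\<dots> = (\<Sum>l\<in>(\<lambda>k. take k u) ` {..length u}. ?F l)"
    by (rule Sum_any.expand_superset) (auto intro!: image_eqI split: if_splits)
  also have "\<dots> = (\<Sum>k\<le>length u. ?F (take k u))"
    by (rule sum.reindex_cong[OF _ refl refl])
      (auto simp: inj_on_def dest!: arg_cong[of _ _ length])
  also have "\<dots> = (\<Sum>k\<le>length u. Poly_Mapping.lookup s (take k u) * Poly_Mapping.lookup t (drop k u))"
    by (rule sum.cong) (auto simp: min_def)
  finally show ?thesis .
qed

definition bnd :: "int \<Rightarrow> gen list \<Rightarrow> bool" where "bnd K u \<longleftrightarrow> (\<forall>g\<in>set u. \<bar>deg g\<bar> \<le> K)"

text \<open>The cut-off concerns each letter and not the length or the total degree: a word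
  satisfies it iff both parts of any cut do, which makes truncation multiplicative. Since finitely
  many modes remain, the mode sums become elements of the tensor algebra.\<close>

definition truncates :: "int \<Rightarrow> ops \<Rightarrow> tensors \<Rightarrow> bool" where
  "truncates K A t \<longleftrightarrow> (\<forall>u. Poly_Mapping.lookup t u = (if bnd K u then A u else 0))"

lemma truncates_mult:
  assumes "truncates K A s" "truncates K B t"
  shows "truncates K (A \<star> B) (s * t)"
  unfolding truncates_def
proof
  fix u
  have b: "bnd K u \<longleftrightarrow> bnd K (take k u) \<and> bnd K (drop k u)" for k
    unfolding bnd_def by (subst append_take_drop_id[of k u, symmetric], subst set_append) blast
  have "Poly_Mapping.lookup s (take k u) * Poly_Mapping.lookup t (drop k u) =
      (if bnd K u then A (take k u) * B (drop k u) else 0)" for k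
    using assms b[of k]
    by (cases "bnd K (take k u)"; cases "bnd K (drop k u)") (simp_all add: truncates_def)
  then show "Poly_Mapping.lookup (s * t) u = (if bnd K u then (A \<star> B) u else 0)"
    unfolding lookup_tensors_mult op_mult_def by simp
qed

lemma truncates_add: "truncates K A s \<Longrightarrow> truncates K B t \<Longrightarrow> truncates K (A + B) (s + t)"
  by (simp add: truncates_def lookup_add)

lemma truncates_diff: "truncates K A s \<Longrightarrow> truncates K B t \<Longrightarrow> truncates K (A - B) (s - t)"
  by (simp add: truncates_def lookup_minus)

lemma truncates_zero: "truncates K 0 0"
  by (simp add: truncates_def)

lemma truncates_sum: "(\<And>i. i \<in> I \<Longrightarrow> truncates K (A i) (t i)) \<Longrightarrow> truncates K (\<Sum>i\<in>I. A i) (\<Sum>i\<in>I. t i)"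
  by (induction I rule: infinite_finite_induct) (auto simp: truncates_zero truncates_add)

lemma lookup_sc_mult: "Poly_Mapping.lookup (sc c * t) u = c * Poly_Mapping.lookup t u"
proof -
  have "sc c * t = Poly_Mapping.map ((*) c) t"
    unfolding mult_map_scale_conv_mult sc_def zero_list_def ..
  then show ?thesis by (simp add: map.rep_eq when_def)
qed

lemma truncates_scale: "truncates K A t \<Longrightarrow> truncates K (c \<cdot>\<^sub>o A) (sc c * t)"
  by (simp add: truncates_def lookup_sc_mult op_scale_def)

lemma truncates_one: "truncates K (\<lambda>u. if u = [] then 1 else 0) 1"
  by (auto simp: truncates_def lookup_one zero_list_def bnd_def when_def)

lemma truncates_power: "truncates K A t \<Longrightarrow> truncates K (op_power A n) (t ^ n)"
  by (induction n) (simp_all add: truncates_one truncates_mult)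

lemma truncates_exp: "truncates K A t \<Longrightarrow> truncates K (op_exp N A) (expR N t)"
  unfolding op_exp_def expR_def by (intro truncates_sum truncates_scale truncates_power)

lemma truncates_gen: "\<bar>deg g\<bar> \<le> K \<Longrightarrow> truncates K (op_gen g) (gn g)"
  by (auto simp: truncates_def wd_def lookup_single op_gen_def bnd_def when_def)

lemma Sum_any_op_gen:
  assumes "\<And>n m. G n = G m \<Longrightarrow> n = m"
  shows "Sum_any (\<lambda>m. if m \<in> S then zp (- m) * op_gen (G m) [G n] else 0) =
    (if n \<in> S then zp (- n) else (0 :: scal))"
proof -
  have eq: "(\<lambda>m. if m \<in> S then zp (- m) * op_gen (G m) [G n] else 0) =
      (\<lambda>m. if m = n then (if n \<in> S then zp (- n) else 0) else 0)"
    using assms by (auto simp: fun_eq_iff op_gen_def)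
  show ?thesis unfolding eq by (rule Sum_any.delta)
qed

lemma Sum_any_op_gen_0:
  assumes "\<And>n. u \<noteq> [G n]"
  shows "Sum_any (\<lambda>m. if m \<in> S then zp (- m) * op_gen (G m) u else 0) = (0 :: scal)"
proof -
  have eq: "(\<lambda>m. if m \<in> S then zp (- m) * op_gen (G m) u else 0) = (\<lambda>m. 0)"
    using assms by (auto simp: fun_eq_iff op_gen_def)
  show ?thesis unfolding eq by (rule Sum_any.neutral)
qed

lemma truncates_modes:
  assumes inj: "\<And>n m. G n = G m \<Longrightarrow> n = m" and deg: "\<And>n. deg (G n) = n"
    and T: "T = S \<inter> {- K..K}"
  shows "truncates K (\<lambda>u. Sum_any (\<lambda>n. if n \<in> S then zp (- n) * op_gen (G n) u else 0))
     (\<Sum>n\<in>T. sc (zp (- n)) * gn (G n))"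
  unfolding truncates_def
proof
  fix u
  have fin: "finite T" unfolding T by simp
  have l: "Poly_Mapping.lookup (\<Sum>n\<in>T. sc (zp (- n)) * gn (G n)) u = (\<Sum>n\<in>T. if u = [G n] then zp (- n) else 0)"
    unfolding lookup_sum lookup_sc_mult by (intro sum.cong refl) (simp add: wd_def lookup_single when_def)
  show "Poly_Mapping.lookup (\<Sum>n\<in>T. sc (zp (- n)) * gn (G n)) u =
    (if bnd K u then Sum_any (\<lambda>n. if n \<in> S then zp (- n) * op_gen (G n) u else 0) else 0)"
  proof (cases "\<exists>n. u = [G n]")
    case True
    then obtain n where u: "u = [G n]" by blast
    have b: "bnd K u \<longleftrightarrow> n \<in> {- K..K}" by (auto simp: u bnd_def deg)
    have "(\<Sum>m\<in>T. if u = [G m] then zp (- m) else 0) = (\<Sum>m\<in>T. if m = n then zp (- n) else 0)"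
      by (intro sum.cong refl) (use inj u in auto)
    then have "Poly_Mapping.lookup (\<Sum>n\<in>T. sc (zp (- n)) * gn (G n)) u = (if n \<in> T then zp (- n) else 0)"
      using l fin by simp
    moreover have "Sum_any (\<lambda>n. if n \<in> S then zp (- n) * op_gen (G n) u else 0) = (if n \<in> S then zp (- n) else 0)"
      unfolding u by (rule Sum_any_op_gen[OF inj])
    ultimately show ?thesis using b by (simp only:) (auto simp: T)
  next
    case False
    then show ?thesis unfolding l using Sum_any_op_gen_0[of u G] by simp
  qed
qed

lemma truncates_x_modes:
  assumes "T = S \<inter> {- K..K}"
  shows "truncates K (x_modes S zp k) (\<Sum>n\<in>T. sc (zp (- n)) * gn (X n k))"
  unfolding x_modes_def by (rule truncates_modes) (use assms in auto)

lemma truncates_xs_modes: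
  assumes K: "0 \<le> K" and T: "T = S \<inter> {- K..K}"
  shows "truncates K (lin_comb w (xs_modes S zp lg)) (modes T zp lg (cvec w))"
proof -
  have "truncates K (lin_comb w (xs_modes S zp lg)) (\<Sum>i\<in>UNIV. sc (const (of_int (w $ i))) *
    ((\<Sum>n\<in>T. sc (zp (- n)) * gn (Xs n i)) + sc (const (1/2) * lg) *
      (\<Sum>j\<in>UNIV. \<Sum>k\<in>UNIV. sc (const (eps i j k)) * (gn (W j) * (\<Sum>n\<in>T. sc (zp (- n)) * gn (X n k))))))"
    unfolding lin_comb_def xs_modes_def
    by (intro truncates_sum truncates_scale truncates_add truncates_mult truncates_gen truncates_x_modes
        truncates_modes T) (use K in auto)
  moreover have "(\<Sum>i\<in>UNIV. sc (const (of_int (w $ i))) *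
    ((\<Sum>n\<in>T. sc (zp (- n)) * gn (Xs n i)) + sc (const (1/2) * lg) *
      (\<Sum>j\<in>UNIV. \<Sum>k\<in>UNIV. sc (const (eps i j k)) * (gn (W j) * (\<Sum>n\<in>T. sc (zp (- n)) * gn (X n k))))))
    = modes T zp lg (cvec w)"
  proof -
    let ?c = "\<lambda>i. sc (const (of_int (w $ i)))" and ?h = "sc (const (1/2) * lg)"
      and ?e = "\<lambda>i j k. sc (const (eps i j k))" and ?z = "\<lambda>n. sc (zp (- n))"
    have "(\<Sum>j\<in>UNIV. \<Sum>k\<in>UNIV. ?e i j k * (gn (W j) * (\<Sum>n\<in>T. ?z n * gn (X n k)))) =
      (\<Sum>n\<in>T. ?z n * (\<Sum>j\<in>UNIV. \<Sum>k\<in>UNIV. ?e i j k * (gn (W j) * gn (X n k))))" for i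
    proof -
      have "?e i j k * (gn (W j) * (\<Sum>n\<in>T. ?z n * gn (X n k))) =
        (\<Sum>n\<in>T. ?z n * (?e i j k * (gn (W j) * gn (X n k))))" for j k
        by (simp only: sum_distrib_left sc_pull[of "gn (W j)"] sc_pull[of "?e i j k"])
      then have "(\<Sum>j\<in>UNIV. \<Sum>k\<in>UNIV. ?e i j k * (gn (W j) * (\<Sum>n\<in>T. ?z n * gn (X n k)))) =
        (\<Sum>j\<in>UNIV. \<Sum>k\<in>UNIV. \<Sum>n\<in>T. ?z n * (?e i j k * (gn (W j) * gn (X n k))))" by simp
      also have "\<dots> = (\<Sum>j\<in>UNIV. \<Sum>n\<in>T. \<Sum>k\<in>UNIV. ?z n * (?e i j k * (gn (W j) * gn (X n k))))"
        by (rule sum.cong[OF refl], rule sum.swap)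
      also have "\<dots> = (\<Sum>n\<in>T. \<Sum>j\<in>UNIV. \<Sum>k\<in>UNIV. ?z n * (?e i j k * (gn (W j) * gn (X n k))))"
        by (rule sum.swap)
      finally show ?thesis by (simp only: sum_distrib_left)
    qed
    then have "(\<Sum>i\<in>UNIV. ?c i * ((\<Sum>n\<in>T. ?z n * gn (Xs n i)) + ?h *
      (\<Sum>j\<in>UNIV. \<Sum>k\<in>UNIV. ?e i j k * (gn (W j) * (\<Sum>n\<in>T. ?z n * gn (X n k)))))) =
      (\<Sum>i\<in>UNIV. ?c i * ((\<Sum>n\<in>T. ?z n * gn (Xs n i)) + ?h *
       (\<Sum>n\<in>T. ?z n * (\<Sum>j\<in>UNIV. \<Sum>k\<in>UNIV. ?e i j k * (gn (W j) * gn (X n k))))))" by simp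
    also have "\<dots> = (\<Sum>i\<in>UNIV. \<Sum>n\<in>T. ?z n * (?c i * (gn (Xs n i) + ?h *
        (\<Sum>j\<in>UNIV. \<Sum>k\<in>UNIV. ?e i j k * (gn (W j) * gn (X n k))))))"
      unfolding sum_distrib_left[of ?h] sc_pull[of ?h] sum.distrib[symmetric] distrib_left[symmetric]
        sum_distrib_left[of "?c _"] sc_pull[of "?c _"] ..
    also have "\<dots> = (\<Sum>n\<in>T. ?z n * (\<Sum>i\<in>UNIV. ?c i * (gn (Xs n i) + ?h *
        (\<Sum>j\<in>UNIV. \<Sum>k\<in>UNIV. ?e i j k * (gn (W j) * gn (X n k))))))"
      by (subst sum.swap) (simp only: sum_distrib_left[of "?z _"])
    also have "\<dots> = modes T zp lg (cvec w)"
      unfolding modes_def lc_def wx_def cvec_def sum_distrib_left[of ?h] sc_pull[of ?h]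
        sum.distrib[symmetric] distrib_left[symmetric] ..
    finally show ?thesis .
  qed
  ultimately show ?thesis by simp
qed

lemma truncates_Q: "0 \<le> K \<Longrightarrow> truncates K (lin_comb w Q_op) (lc (cvec w) Qr)"
  unfolding lin_comb_def lc_def Q_op_def Qr_def cvec_def
  by (intro truncates_sum truncates_scale truncates_diff truncates_mult truncates_gen) auto

lemma truncates_Xs0: "0 \<le> K \<Longrightarrow> truncates K (lin_comb w (\<lambda>i. op_gen (Xs 0 i))) (xsv (cvec w) 0)"
  unfolding lin_comb_def lc_def cvec_def
  by (intro truncates_sum truncates_scale truncates_gen) auto

lemma truncates_vertex_op:
  assumes K: "0 \<le> K"
  shows "truncates K (vertex_op N w zp lg)
    (expR N (xsv (cvec w) 0) * expR N (sc lg * lc (cvec w) Qr) *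
     expR N (modes {- K..<0} zp lg (cvec w)) * expR N (modes {0<..K} zp lg (cvec w)))"
  unfolding vertex_op_def
  by (intro truncates_mult truncates_exp truncates_Xs0 truncates_scale truncates_Q truncates_xs_modes K) auto

section \<open>Powers of the formal variables and degrees of words\<close>

lemma lookup_mult_nonzero:
  fixes s t :: "'a::monoid_add \<Rightarrow>\<^sub>0 'b::semiring_0"
  assumes "Poly_Mapping.lookup (s * t) e \<noteq> 0"
  obtains e1 e2 where "e = e1 + e2" "Poly_Mapping.lookup s e1 \<noteq> 0" "Poly_Mapping.lookup t e2 \<noteq> 0"
  using assms keys_mult[of s t] by (force simp: in_keys_iff)

lemma op_mult_nonzero:
  assumes "Poly_Mapping.lookup ((A \<star> B) u) e \<noteq> 0"
  obtains u1 u2 e1 e2 where "u = u1 @ u2" "e = e1 + e2"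
    "Poly_Mapping.lookup (A u1) e1 \<noteq> 0" "Poly_Mapping.lookup (B u2) e2 \<noteq> 0"
proof -
  have "(\<Sum>k\<le>length u. Poly_Mapping.lookup (A (take k u) * B (drop k u)) e) \<noteq> 0"
    using assms by (simp add: op_mult_def lookup_sum)
  then obtain k where "Poly_Mapping.lookup (A (take k u) * B (drop k u)) e \<noteq> 0"
    by (meson sum.not_neutral_contains_not_neutral)
  then obtain e1 e2 where "e = e1 + e2" "Poly_Mapping.lookup (A (take k u)) e1 \<noteq> 0"
    "Poly_Mapping.lookup (B (drop k u)) e2 \<noteq> 0" by (rule lookup_mult_nonzero)
  then show thesis using that[of "take k u" "drop k u"] by simp
qed

abbreviation z_exp :: "expo \<Rightarrow> int" where "z_exp e \<equiv> fst e"
abbreviation w_exp :: "expo \<Rightarrow> int" where "w_exp e \<equiv> fst (snd (snd e))"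

text \<open>Powers of the variables are tied to the degree of the word: the pair of factors is
  \<open>(- 1, 0)\<close> for fields in \<open>z\<close> and \<open>(0, - 1)\<close> for fields in
  \<open>w\<close>, since the mode \<open>n\<close> comes with the power \<open>- n\<close>.
  \<open>R\<close> restricts the degrees of the letters.\<close>

definition graded_supp :: "(int \<Rightarrow> bool) \<Rightarrow> int \<Rightarrow> int \<Rightarrow> ops \<Rightarrow> bool" where
  "graded_supp R \<alpha> \<beta> A \<longleftrightarrow> (\<forall>u e. Poly_Mapping.lookup (A u) e \<noteq> 0 \<longrightarrow>
     (\<forall>g\<in>set u. R (deg g)) \<and> z_exp e = \<alpha> * wdeg u \<and> w_exp e = \<beta> * wdeg u)"

definition log_only :: "scal \<Rightarrow> bool" where
  "log_only s \<longleftrightarrow> (\<forall>e. Poly_Mapping.lookup s e \<noteq> 0 \<longrightarrow> z_exp e = 0 \<and> w_exp e = 0)"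

lemma log_only_basic: "log_only (const c)" "log_only log_z" "log_only log_w"
  by (auto simp: log_only_def const_def log_z_def log_w_def lookup_single when_def zero_prod_def split: if_splits)

lemma log_only_mult: "log_only s \<Longrightarrow> log_only t \<Longrightarrow> log_only (s * t)"
  unfolding log_only_def
proof (intro allI impI)
  fix e
  assume s: "\<forall>e. Poly_Mapping.lookup s e \<noteq> 0 \<longrightarrow> z_exp e = 0 \<and> w_exp e = 0"
    and t: "\<forall>e. Poly_Mapping.lookup t e \<noteq> 0 \<longrightarrow> z_exp e = 0 \<and> w_exp e = 0"
    and "Poly_Mapping.lookup (s * t) e \<noteq> 0"
  then obtain e1 e2 where "e = e1 + e2" "Poly_Mapping.lookup s e1 \<noteq> 0" "Poly_Mapping.lookup t e2 \<noteq> 0"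
    by (elim lookup_mult_nonzero)
  then show "z_exp e = 0 \<and> w_exp e = 0" using s[rule_format, of e1] t[rule_format, of e2] by simp
qed

lemma graded_supp_mult:
  assumes "graded_supp R \<alpha> \<beta> A" "graded_supp R \<alpha> \<beta> B"
  shows "graded_supp R \<alpha> \<beta> (A \<star> B)"
  unfolding graded_supp_def
proof (intro allI impI)
  fix u e assume "Poly_Mapping.lookup ((A \<star> B) u) e \<noteq> 0"
  then obtain u1 u2 e1 e2 where u: "u = u1 @ u2" "e = e1 + e2"
    and nz: "Poly_Mapping.lookup (A u1) e1 \<noteq> 0" "Poly_Mapping.lookup (B u2) e2 \<noteq> 0" by (rule op_mult_nonzero)
  show "(\<forall>g\<in>set u. R (deg g)) \<and> z_exp e = \<alpha> * wdeg u \<and> w_exp e = \<beta> * wdeg u"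
    using assms(1)[unfolded graded_supp_def, rule_format, OF nz(1)]
      assms(2)[unfolded graded_supp_def, rule_format, OF nz(2)] u
    by (auto simp: distrib_left)
qed

lemma graded_supp_add: "graded_supp R \<alpha> \<beta> A \<Longrightarrow> graded_supp R \<alpha> \<beta> B \<Longrightarrow> graded_supp R \<alpha> \<beta> (A + B)"
  (is "_ \<Longrightarrow> _ \<Longrightarrow> ?thesis")
proof -
  have "Poly_Mapping.lookup (A u) e \<noteq> 0 \<or> Poly_Mapping.lookup (B u) e \<noteq> 0"
    if "Poly_Mapping.lookup ((A + B) u) e \<noteq> 0" for u e
    using that by (auto simp: lookup_add)
  then show "graded_supp R \<alpha> \<beta> A \<Longrightarrow> graded_supp R \<alpha> \<beta> B \<Longrightarrow> ?thesis"
    unfolding graded_supp_def by blast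
qed

lemma graded_supp_diff: "graded_supp R \<alpha> \<beta> A \<Longrightarrow> graded_supp R \<alpha> \<beta> B \<Longrightarrow> graded_supp R \<alpha> \<beta> (A - B)"
  (is "_ \<Longrightarrow> _ \<Longrightarrow> ?thesis")
proof -
  have "Poly_Mapping.lookup (A u) e \<noteq> 0 \<or> Poly_Mapping.lookup (B u) e \<noteq> 0"
    if "Poly_Mapping.lookup ((A - B) u) e \<noteq> 0" for u e
    using that by (auto simp: lookup_minus)
  then show "graded_supp R \<alpha> \<beta> A \<Longrightarrow> graded_supp R \<alpha> \<beta> B \<Longrightarrow> ?thesis"
    unfolding graded_supp_def by blast
qed

lemma graded_supp_sum: "(\<And>i. i \<in> I \<Longrightarrow> graded_supp R \<alpha> \<beta> (A i)) \<Longrightarrow> graded_supp R \<alpha> \<beta> (\<Sum>i\<in>I. A i)"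
proof (induction I rule: infinite_finite_induct)
  case (insert i I) then show ?case by (subst sum.insert) (auto intro: graded_supp_add)
qed (auto simp: graded_supp_def)

lemma graded_supp_scale: "log_only c \<Longrightarrow> graded_supp R \<alpha> \<beta> A \<Longrightarrow> graded_supp R \<alpha> \<beta> (c \<cdot>\<^sub>o A)"
  unfolding graded_supp_def
proof (intro allI impI)
  fix u e
  assume c: "log_only c" and A: "\<forall>u e. Poly_Mapping.lookup (A u) e \<noteq> 0 \<longrightarrow>
     (\<forall>g\<in>set u. R (deg g)) \<and> z_exp e = \<alpha> * wdeg u \<and> w_exp e = \<beta> * wdeg u"
    and "Poly_Mapping.lookup ((c \<cdot>\<^sub>o A) u) e \<noteq> 0"
  then obtain e1 e2 where "e = e1 + e2" "Poly_Mapping.lookup c e1 \<noteq> 0" "Poly_Mapping.lookup (A u) e2 \<noteq> 0"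
    unfolding op_scale_def by (elim lookup_mult_nonzero)
  then show "(\<forall>g\<in>set u. R (deg g)) \<and> z_exp e = \<alpha> * wdeg u \<and> w_exp e = \<beta> * wdeg u"
    using A[rule_format, of u e2] c[unfolded log_only_def, rule_format, of e1] by simp
qed

lemma graded_supp_power: "graded_supp R \<alpha> \<beta> A \<Longrightarrow> graded_supp R \<alpha> \<beta> (op_power A n)"
proof (induction n)
  case 0
  show ?case by (auto simp: graded_supp_def lookup_one when_def zero_prod_def split: if_splits)
qed (simp add: graded_supp_mult)

lemma graded_supp_exp: "graded_supp R \<alpha> \<beta> A \<Longrightarrow> graded_supp R \<alpha> \<beta> (op_exp N A)"
  unfolding op_exp_def by (intro graded_supp_sum graded_supp_scale graded_supp_power log_only_basic)

lemma graded_supp_gen: "R 0 \<Longrightarrow> deg g = 0 \<Longrightarrow> graded_supp R \<alpha> \<beta> (op_gen g)"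
  by (auto simp: graded_supp_def op_gen_def lookup_one when_def zero_prod_def split: if_splits)

lemma graded_supp_mono: "graded_supp R \<alpha> \<beta> A \<Longrightarrow> (\<And>d. R d \<Longrightarrow> R' d) \<Longrightarrow> graded_supp R' \<alpha> \<beta> A"
  unfolding graded_supp_def by blast

definition power_of :: "int \<Rightarrow> int \<Rightarrow> (int \<Rightarrow> scal) \<Rightarrow> bool" where
  "power_of \<alpha> \<beta> zp \<longleftrightarrow> (\<forall>n e. Poly_Mapping.lookup (zp (- n)) e \<noteq> 0 \<longrightarrow> z_exp e = \<alpha> * n \<and> w_exp e = \<beta> * n)"

lemma power_of_basic: "power_of (- 1) 0 z_pow" "power_of 0 (- 1) w_pow"
  by (auto simp: power_of_def z_pow_def w_pow_def lookup_single when_def split: if_splits)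

lemma graded_supp_modes:
  assumes inj: "\<And>n m. G n = G m \<Longrightarrow> n = m" and deg: "\<And>n. deg (G n) = n"
    and S: "\<And>n. n \<in> S \<Longrightarrow> R n" and zp: "power_of \<alpha> \<beta> zp"
  shows "graded_supp R \<alpha> \<beta> (\<lambda>u. Sum_any (\<lambda>n. if n \<in> S then zp (- n) * op_gen (G n) u else 0))"
  unfolding graded_supp_def
proof (intro allI impI)
  fix u e
  assume nz: "Poly_Mapping.lookup (Sum_any (\<lambda>n. if n \<in> S then zp (- n) * op_gen (G n) u else 0)) e \<noteq> 0"
  have "\<exists>n. u = [G n]"
  proof (rule ccontr)
    assume "\<not> (\<exists>n. u = [G n])"
    then have "Sum_any (\<lambda>n. if n \<in> S then zp (- n) * op_gen (G n) u else 0) = (0 :: scal)"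
      by (intro Sum_any_op_gen_0) blast
    then show False using nz by (simp only: lookup_zero)
  qed
  then obtain n where u: "u = [G n]" by blast
  have "Sum_any (\<lambda>n. if n \<in> S then zp (- n) * op_gen (G n) u else 0) = (if n \<in> S then zp (- n) else 0)"
    unfolding u by (rule Sum_any_op_gen[OF inj])
  then have "Poly_Mapping.lookup (if n \<in> S then zp (- n) else 0) e \<noteq> 0"
    using nz by (simp only: not_False_eq_True)
  then have "n \<in> S" "Poly_Mapping.lookup (zp (- n)) e \<noteq> 0" by (auto split: if_splits)
  then show "(\<forall>g\<in>set u. R (deg g)) \<and> z_exp e = \<alpha> * wdeg u \<and> w_exp e = \<beta> * wdeg u"
    using S zp[unfolded power_of_def, rule_format, of n e] by (simp add: u deg)
qed

lemma graded_supp_xs_modes: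
  assumes S: "\<And>n. n \<in> S \<Longrightarrow> R n" and zp: "power_of \<alpha> \<beta> zp" and lg: "log_only lg" and R: "R 0"
  shows "graded_supp R \<alpha> \<beta> (lin_comb w (xs_modes S zp lg))"
  unfolding lin_comb_def xs_modes_def x_modes_def
  by (intro graded_supp_sum graded_supp_scale graded_supp_add graded_supp_mult log_only_mult
      log_only_basic graded_supp_gen graded_supp_modes zp lg R S) auto

lemma graded_supp_zero_modes:
  "log_only lg \<Longrightarrow> graded_supp (\<lambda>d. d = 0) \<alpha> \<beta>
    (op_exp N (lin_comb w (\<lambda>i. op_gen (Xs 0 i))) \<star> op_exp N (lg \<cdot>\<^sub>o lin_comb w Q_op))"
  unfolding lin_comb_def Q_op_def
  by (intro graded_supp_mult graded_supp_exp graded_supp_sum graded_supp_scale graded_supp_diff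
      log_only_basic graded_supp_gen) auto

text \<open>\<open>m\<close> collects the zero modes and the creation part, \<open>p\<close> the
  annihilation part. The inequalities are weak because the logarithmic terms insert the letters
  \<open>W\<close>, of degree zero, into both.\<close>

lemma vertex_op_nonzero:
  assumes nz: "Poly_Mapping.lookup (vertex_op N w zp lg u) e \<noteq> 0"
    and zp: "power_of \<alpha> \<beta> zp" and lg: "log_only lg"
  obtains m p where "u = m @ p" "\<forall>g\<in>set m. deg g \<le> 0" "\<forall>g\<in>set p. deg g \<ge> 0"
    "z_exp e = \<alpha> * wdeg u" "w_exp e = \<beta> * wdeg u"
proof -
  let ?M = "op_exp N (lin_comb w (\<lambda>i. op_gen (Xs 0 i))) \<star> op_exp N (lg \<cdot>\<^sub>o lin_comb w Q_op) \<star>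
     op_exp N (lin_comb w (xs_modes {..<0} zp lg))"
  let ?P = "op_exp N (lin_comb w (xs_modes {0<..} zp lg))"
  have M: "graded_supp (\<lambda>d. d \<le> 0) \<alpha> \<beta> ?M"
    by (intro graded_supp_mult graded_supp_mono[OF graded_supp_zero_modes[OF lg]] graded_supp_exp
        graded_supp_xs_modes zp lg) auto
  have P: "graded_supp (\<lambda>d. d \<ge> 0) \<alpha> \<beta> ?P"
    by (intro graded_supp_exp graded_supp_xs_modes zp lg) auto
  obtain m p e1 e2 where mp: "u = m @ p" "e = e1 + e2"
    "Poly_Mapping.lookup (?M m) e1 \<noteq> 0" "Poly_Mapping.lookup (?P p) e2 \<noteq> 0"
    using nz unfolding vertex_op_def by (rule op_mult_nonzero)
  show thesis
    using that[OF mp(1)] M[unfolded graded_supp_def, rule_format, OF mp(3)]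
      P[unfolded graded_supp_def, rule_format, OF mp(4)] mp(1,2) by (auto simp: distrib_left)
qed

lemma phi_creation_left:
  "\<forall>g\<in>set z. deg g \<le> 0 \<Longrightarrow> \<exists>g\<in>set z. deg g < 0 \<Longrightarrow> phi D (z @ v) f = (\<lambda>p. 0)"
proof (induction z)
  case (Cons g z)
  then show ?case by (cases "deg g < 0") (auto simp: phi_zero_mode fun_act_zero)
qed simp

lemma phi_annihilation_right:
  assumes D: "bounded D"
  shows "f \<in> Fun D \<Longrightarrow> \<forall>g\<in>set z. deg g \<ge> 0 \<Longrightarrow> \<exists>g\<in>set z. deg g > 0 \<Longrightarrow> phi D (x @ z) f = (\<lambda>p. 0)"
proof (induction z arbitrary: f rule: rev_induct)
  case (snoc g z)
  have "phi D (x @ z @ [g]) f = phi D (x @ z) (fun_act D g f)"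
    using phi_snoc[OF D snoc.prems(1), of g "x @ z"] snoc.prems(2) by simp
  then show ?case
    using snoc fun_act_Fun[OF D snoc.prems(1)] fun_act_pos[of g D f] phi_0[OF D, of "x @ z"]
    by (cases "deg g > 0") (auto simp: zero_fun_def)
qed simp

lemma deg_le_wdeg: "\<forall>g\<in>set u. deg g \<ge> 0 \<Longrightarrow> g \<in> set u \<Longrightarrow> deg g \<le> wdeg u"
proof (induction u)
  case (Cons h u)
  have "wdeg u \<ge> 0" by (rule sum_list_nonneg) (use Cons in auto)
  then show ?case using Cons by auto
qed simp

lemma wdeg_le_deg: "\<forall>g\<in>set u. deg g \<le> 0 \<Longrightarrow> g \<in> set u \<Longrightarrow> wdeg u \<le> deg g"
proof (induction u)
  case (Cons h u)
  have "wdeg u \<le> 0" by (rule sum_list_nonpos) (use Cons in auto)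
  then show ?case using Cons by auto
qed simp

text \<open>A contributing word has the blocks \<open>m1\<close>, \<open>p1\<close>,
  \<open>m2\<close>, \<open>p2\<close>. Creation operators in \<open>m1\<close> vanish at the left
  end and annihilation operators in \<open>p2\<close> at the right end. So the exponents of
  \<open>z\<close> and \<open>w\<close> fix the total degrees of \<open>p1\<close> and
  \<open>m2\<close>, and inside a block of one sign the total degree bounds every letter.\<close>

lemma vertex_ops_bnd:
  assumes D: "bounded D" and f: "f \<in> Fun D"
    and nz: "Poly_Mapping.lookup ((vertex_op N w1 z_pow log_z \<star> vertex_op N w2 w_pow log_w) u) e \<noteq> 0"
    and phi: "phi D u f \<noteq> (\<lambda>p. 0)" and K: "\<bar>z_exp e\<bar> \<le> K" "\<bar>w_exp e\<bar> \<le> K"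
  shows "bnd K u"
proof -
  obtain u1 u2 e1 e2 where u: "u = u1 @ u2" and e: "e = e1 + e2"
    and nz1: "Poly_Mapping.lookup (vertex_op N w1 z_pow log_z u1) e1 \<noteq> 0"
    and nz2: "Poly_Mapping.lookup (vertex_op N w2 w_pow log_w u2) e2 \<noteq> 0"
    using nz by (rule op_mult_nonzero)
  obtain m1 p1 where 1: "u1 = m1 @ p1" "\<forall>g\<in>set m1. deg g \<le> 0" "\<forall>g\<in>set p1. deg g \<ge> 0"
    "z_exp e1 = - 1 * wdeg u1" "w_exp e1 = 0 * wdeg u1"
    using nz1 power_of_basic(1) log_only_basic(2) by (rule vertex_op_nonzero)
  obtain m2 p2 where 2: "u2 = m2 @ p2" "\<forall>g\<in>set m2. deg g \<le> 0" "\<forall>g\<in>set p2. deg g \<ge> 0"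
    "z_exp e2 = 0 * wdeg u2" "w_exp e2 = - 1 * wdeg u2"
    using nz2 power_of_basic(2) log_only_basic(3) by (rule vertex_op_nonzero)
  have m1: "deg g = 0" if "g \<in> set m1" for g
  proof (rule ccontr)
    assume "deg g \<noteq> 0"
    then have "\<exists>g\<in>set m1. deg g < 0" using 1(2) that by force
    then show False using phi_creation_left[OF 1(2)] phi u 1(1) by simp
  qed
  have p2: "deg g = 0" if "g \<in> set p2" for g
  proof (rule ccontr)
    assume "deg g \<noteq> 0"
    then have "\<exists>g\<in>set p2. deg g > 0" using 2(3) that by force
    then show False using phi_annihilation_right[OF D f 2(3), of "u1 @ m2"] phi u 2(1) by simp
  qed
  have zero: "wdeg v = 0" if "\<And>g. g \<in> set v \<Longrightarrow> deg g = 0" for v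
    using that by (induction v) auto
  have "wdeg p1 = - z_exp e" "wdeg m2 = - w_exp e"
    using 1 2 e zero[of m1] zero[of p2] m1 p2 by auto
  then have "\<bar>deg g\<bar> \<le> K" if "g \<in> set u" for g
    using that K m1[of g] p2[of g] deg_le_wdeg[OF 1(3), of g] wdeg_le_deg[OF 2(2), of g] 1 2 u by fastforce
  then show ?thesis by (simp add: bnd_def)
qed

section \<open>The exponential of the dilogarithm\<close>

definition log_embed :: "log_poly \<Rightarrow> scal" where
  "log_embed q = (\<Sum>k\<in>Poly_Mapping.keys q. Poly_Mapping.single (0, fst k, 0, snd k) (Poly_Mapping.lookup q k))"

lemma log_embed_superset:
  "finite A \<Longrightarrow> Poly_Mapping.keys q \<subseteq> A \<Longrightarrow>
   log_embed q = (\<Sum>k\<in>A. Poly_Mapping.single (0, fst k, 0, snd k) (Poly_Mapping.lookup q k))"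
  unfolding log_embed_def by (rule sum.mono_neutral_left) (auto simp: in_keys_iff)

lemma log_embed_single: "log_embed (Poly_Mapping.single k c) = Poly_Mapping.single (0, fst k, 0, snd k) c"
  by (subst log_embed_superset[of "{k}"]) auto

lemma log_embed_0 [simp]: "log_embed 0 = 0"
  by (simp add: log_embed_def)

lemma log_embed_add: "log_embed (q + r) = log_embed q + log_embed r"
proof -
  let ?A = "Poly_Mapping.keys q \<union> Poly_Mapping.keys r"
  have "log_embed t = (\<Sum>k\<in>?A. Poly_Mapping.single (0, fst k, 0, snd k) (Poly_Mapping.lookup t k))"
    if "Poly_Mapping.keys t \<subseteq> ?A" for t
    by (rule log_embed_superset) (use that in auto)
  then show ?thesis by (simp add: Poly_Mapping.keys_add lookup_add single_add sum.distrib)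
qed

lemma log_embed_sum: "log_embed (\<Sum>i\<in>I. t i) = (\<Sum>i\<in>I. log_embed (t i))"
  by (induction I rule: infinite_finite_induct) (auto simp: log_embed_add)

lemma poly_mapping_expand: "t = (\<Sum>k\<in>Poly_Mapping.keys t. Poly_Mapping.single k (Poly_Mapping.lookup t k))"
  by (rule poly_mapping_eqI) (simp add: lookup_sum lookup_single when_def in_keys_iff)

lemma log_embed_mult: "log_embed (q * r) = log_embed q * log_embed r"
proof -
  let ?s = "\<lambda>t k. Poly_Mapping.single k (Poly_Mapping.lookup t k) :: log_poly"
  have "log_embed (Poly_Mapping.single k a * Poly_Mapping.single l b) =
    log_embed (Poly_Mapping.single k a) * log_embed (Poly_Mapping.single l b)" for k l a b
    by (simp add: mult_single log_embed_single)
  then have "log_embed ((\<Sum>k\<in>Poly_Mapping.keys q. ?s q k) * (\<Sum>k\<in>Poly_Mapping.keys r. ?s r k)) =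
    log_embed (\<Sum>k\<in>Poly_Mapping.keys q. ?s q k) * log_embed (\<Sum>k\<in>Poly_Mapping.keys r. ?s r k)"
    by (simp add: sum_product log_embed_sum)
  then show ?thesis by (simp flip: poly_mapping_expand)
qed

lemma lookup_log_embed:
  "Poly_Mapping.lookup (log_embed q) (a, b, c, d) = (if a = 0 \<and> c = 0 then Poly_Mapping.lookup q (b, d) else 0)"
proof -
  have "Poly_Mapping.lookup (log_embed q) (a, b, c, d) =
    (\<Sum>k\<in>Poly_Mapping.keys q. if k = (b, d) then (if a = 0 \<and> c = 0 then Poly_Mapping.lookup q (b, d) else 0) else 0)"
    unfolding log_embed_def lookup_sum
    by (intro sum.cong refl) (auto simp: lookup_single when_def)
  then show ?thesis by (simp add: in_keys_iff)
qed

text \<open>Substitution of \<open>w/z\<close> for the variable. As a ring homomorphism it carries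
  powers of polynomials to powers of formal scalars, which makes the coefficientwise
  \<open>i_zw\<close> comparable with products of scalars.\<close>

definition ratio_eval :: "log_poly poly \<Rightarrow> scal" where
  "ratio_eval p = poly (map_poly log_embed p) (z_pow (- 1) * w_pow 1)"

lemma ratio_eval_0 [simp]: "ratio_eval 0 = 0"
  by (simp add: ratio_eval_def)

lemma ratio_eval_pCons: "ratio_eval (pCons c p) = log_embed c + z_pow (- 1) * w_pow 1 * ratio_eval p"
  by (simp add: ratio_eval_def map_poly_pCons)

lemma ratio_eval_add: "ratio_eval (p + q) = ratio_eval p + ratio_eval q"
  by (induction p q rule: poly_induct2) (simp_all add: ratio_eval_pCons log_embed_add algebra_simps)

lemma ratio_eval_smult: "ratio_eval (smult c p) = log_embed c * ratio_eval p"
  by (induction p) (simp_all add: ratio_eval_pCons log_embed_mult algebra_simps)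

lemma ratio_eval_mult: "ratio_eval (p * q) = ratio_eval p * ratio_eval q"
  by (induction p) (simp_all add: ratio_eval_pCons ratio_eval_add ratio_eval_smult algebra_simps)

lemma ratio_eval_1 [simp]: "ratio_eval 1 = 1"
  by (simp add: one_pCons ratio_eval_pCons log_embed_single flip: single_one) (simp add: zero_prod_def)

lemma ratio_eval_power: "ratio_eval (p ^ k) = ratio_eval p ^ k"
  by (induction k) (simp_all add: ratio_eval_mult)

lemma ratio_power: "(z_pow (- 1) * w_pow 1) ^ n = Poly_Mapping.single (- int n, 0, int n, 0) 1"
proof (induction n)
  case 0
  show ?case by (simp flip: single_one) (simp add: zero_prod_def)
qed (simp add: z_pow_def w_pow_def mult_single)

lemma ratio_eval_altdef:
  "degree p \<le> M \<Longrightarrow> ratio_eval p = (\<Sum>n\<le>M. log_embed (coeff p n) * (z_pow (- 1) * w_pow 1) ^ n)"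
proof -
  assume M: "degree p \<le> M"
  have "degree (map_poly log_embed p) \<le> M" using map_poly_degree_leq[of log_embed p] M by simp
  then have "ratio_eval p = (\<Sum>n\<le>M. coeff (map_poly log_embed p) n * (z_pow (- 1) * w_pow 1) ^ n)"
    unfolding ratio_eval_def poly_altdef
    by (intro sum.mono_neutral_left) (auto simp: coeff_eq_0 simp del: coeff_map_poly)
  then show ?thesis by (simp add: coeff_map_poly)
qed

lemma lookup_ratio_eval:
  "Poly_Mapping.lookup (ratio_eval p) (a, b, c, d) =
    (if 0 \<le> c \<and> a = - c then Poly_Mapping.lookup (coeff p (nat c)) (b, d) else 0)"
proof -
  define M where "M = max (degree p) (nat c)"
  have mono: "Poly_Mapping.lookup (log_embed q * Poly_Mapping.single (- int n, 0, int n, 0) 1) (a, b, c, d) =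
    Poly_Mapping.lookup (log_embed q) (a + int n, b, c - int n, d)" for q n
  proof -
    have "log_embed q * Poly_Mapping.single (- int n, 0, int n, 0) 1 =
      (\<Sum>k\<in>Poly_Mapping.keys q. Poly_Mapping.single (- int n, fst k, int n, snd k) (Poly_Mapping.lookup q k))"
      by (simp add: log_embed_def sum_distrib_right mult_single)
    then have "Poly_Mapping.lookup (log_embed q * Poly_Mapping.single (- int n, 0, int n, 0) 1) (a, b, c, d) =
      (\<Sum>k\<in>Poly_Mapping.keys q. if k = (b, d) then (if a = - int n \<and> c = int n then Poly_Mapping.lookup q (b, d) else 0) else 0)"
      by (simp only: lookup_sum) (intro sum.cong refl, auto simp: lookup_single when_def)
    then show ?thesis by (auto simp: lookup_log_embed in_keys_iff)
  qed
  have "Poly_Mapping.lookup (ratio_eval p) (a, b, c, d) =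
    (\<Sum>n\<le>M. if n = nat c then (if 0 \<le> c \<and> a = - c then Poly_Mapping.lookup (coeff p (nat c)) (b, d) else 0) else 0)"
    unfolding ratio_eval_altdef[of p M, unfolded M_def, simplified] ratio_power lookup_sum mono M_def
    by (intro sum.cong refl) (auto simp: lookup_log_embed)
  then show ?thesis by (simp add: M_def)
qed

text \<open>A single coefficient of the expansion is determined by an initial segment of the series,
  so the series may be replaced by a polynomial.\<close>

lemma i_zw_ratio_eval:
  assumes "\<And>n. n \<le> nat (w_exp e) \<Longrightarrow> fps_nth G n = coeff p n"
  shows "i_zw G e = Poly_Mapping.lookup (ratio_eval p) e"
  using assms by (cases e) (auto simp: i_zw_def lookup_ratio_eval)

lemma fps_power_nth_cong:
  fixes F H :: "'a::comm_ring_1 fps"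
  assumes "\<And>i. i \<le> n \<Longrightarrow> fps_nth F i = fps_nth H i" "i \<le> n"
  shows "fps_nth (F ^ k) i = fps_nth (H ^ k) i"
  using assms(2)
proof (induction k arbitrary: i)
  case (Suc k)
  then show ?case by (auto simp: fps_mult_nth assms(1) intro!: sum.cong)
qed simp

lemma fps_power_nth_zero:
  fixes F :: "'a::comm_ring_1 fps"
  assumes "fps_nth F 0 = 0" "n < k"
  shows "fps_nth (F ^ k) n = 0"
  using startsby_zero_power_prefix[OF assms(1)] assms(2) by auto

section \<open>Convergence of the correlator\<close>

lemma Fun_borel_measurable:
  assumes "f \<in> Fun D"
  shows "f \<in> borel_measurable lebesgue"
proof -
  have "(\<lambda>p. if p \<in> interior D then f p else 0) \<in> borel_measurable borel"
    by (rule borel_measurable_continuous_on_if) (use Fun_continuous[OF assms] in auto)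
  moreover have "(\<lambda>p. if p \<in> interior D then f p else 0) = f"
    using Fun_outside[OF assms] by (auto simp: fun_eq_iff)
  ultimately show ?thesis by (simp add: measurable_completion)
qed

lemma Fun_norm_bound:
  assumes "f \<in> Fun D"
  obtains B where "B \<ge> 0" "\<And>p. norm (f p) \<le> B"
proof -
  obtain B where B: "\<And>p. p \<in> interior D \<Longrightarrow> norm (f p) \<le> B"
    using Fun_bounded[OF assms] by (auto simp: bounded_iff)
  have "norm (f p) \<le> max 0 B" for p
    using B[of p] Fun_outside[OF assms, of p] by (cases "p \<in> interior D") auto
  then show thesis using that[of "max 0 B"] by simp
qed

text \<open>Because \<open>|\<psi>| \<le> 1 + |\<psi>|^2\<close> and \<open>D\<close> has finite
  measure, this one function, up to a constant factor, dominates the pairing of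
  \<open>\<psi>\<close> with any bounded function.\<close>

lemma L2_integrable_dominant:
  assumes D: "bounded D" "D \<in> sets lebesgue" and psi: "\<psi> \<in> L2 D"
  shows "integrable lebesgue (\<lambda>p. indicator D p * (1 + (norm (\<psi> p))\<^sup>2))"
proof -
  have "D \<in> lmeasurable" using D by (rule bounded_set_imp_lmeasurable)
  then have "integrable lebesgue (\<lambda>p. indicator D p :: real)"
    by (intro integrable_real_indicator) (auto simp: fmeasurable_def)
  moreover have "integrable lebesgue (\<lambda>p. indicator D p *\<^sub>R (norm (\<psi> p))\<^sup>2)"
    using psi by (simp add: L2_def set_integrable_def)
  ultimately have "integrable lebesgue (\<lambda>p. indicator D p + indicator D p *\<^sub>R (norm (\<psi> p))\<^sup>2)"
    by (rule Bochner_Integration.integrable_add)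
  then show ?thesis by (simp add: distrib_left)
qed

lemma L2_mult_measurable:
  assumes psi: "\<psi> \<in> L2 D" and f: "f \<in> borel_measurable lebesgue"
  shows "(\<lambda>p. indicator D p *\<^sub>R (cnj (\<psi> p) * f p)) \<in> borel_measurable lebesgue"
proof -
  have "(\<lambda>p. indicator D p *\<^sub>R \<psi> p) \<in> borel_measurable lebesgue"
    using psi by (simp add: L2_def set_borel_measurable_def)
  then have "(\<lambda>p. cnj (indicator D p *\<^sub>R \<psi> p) * f p) \<in> borel_measurable lebesgue"
    by (intro borel_measurable_times f borel_measurable_continuous_on[OF continuous_on_cnj[OF continuous_on_id]])
  then show ?thesis by simp
qed

lemma L2_mult_norm_bound:
  fixes z w :: complex
  assumes "norm w \<le> B"
  shows "norm (indicator D p *\<^sub>R (cnj z * w)) \<le> B * (indicator D p * (1 + (norm z)\<^sup>2))"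
proof (cases "p \<in> D")
  case True
  have "2 * norm z \<le> 1 + (norm z)\<^sup>2"
    using zero_le_power2[of "norm z - 1"] by (simp add: power2_eq_square algebra_simps)
  with norm_ge_zero[of z] have "norm z \<le> 1 + (norm z)\<^sup>2" by linarith
  then have "norm z * norm w \<le> (1 + (norm z)\<^sup>2) * B"
    using assms by (intro mult_mono) auto
  then show ?thesis using True by (simp add: norm_mult mult.commute)
qed simp

lemma L2_pairing_integrable:
  assumes D: "bounded D" "D \<in> sets lebesgue" and psi: "\<psi> \<in> L2 D" and f: "f \<in> Fun D"
  shows "integrable lebesgue (\<lambda>p. indicator D p *\<^sub>R (cnj (\<psi> p) * f p))"
proof -
  obtain B where B: "B \<ge> 0" "\<And>p. norm (f p) \<le> B" using Fun_norm_bound[OF f] by blast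
  show ?thesis
  proof (rule Bochner_Integration.integrable_bound)
    show "integrable lebesgue (\<lambda>p. B * (indicator D p * (1 + (norm (\<psi> p))\<^sup>2)))"
      by (intro integrable_mult_right L2_integrable_dominant D psi)
    show "(\<lambda>p. indicator D p *\<^sub>R (cnj (\<psi> p) * f p)) \<in> borel_measurable lebesgue"
      by (rule L2_mult_measurable[OF psi Fun_borel_measurable[OF f]])
    show "AE p in lebesgue. norm (indicator D p *\<^sub>R (cnj (\<psi> p) * f p))
        \<le> norm (B * (indicator D p * (1 + (norm (\<psi> p))\<^sup>2)))"
      using order_trans[OF L2_mult_norm_bound[OF B(2)] abs_ge_self] by (intro AE_I2) simp
  qed
qed

lemma l2_pairing_sum:
  assumes "bounded D" "D \<in> sets lebesgue" "\<psi> \<in> L2 D" "\<And>i. i \<in> I \<Longrightarrow> f i \<in> Fun D"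
  shows "l2_pairing D \<psi> (\<lambda>p. \<Sum>i\<in>I. c i * f i p) = (\<Sum>i\<in>I. c i * l2_pairing D \<psi> (f i))"
proof -
  have "indicator D p *\<^sub>R (cnj (\<psi> p) * (\<Sum>i\<in>I. c i * f i p)) =
    (\<Sum>i\<in>I. c i * (indicator D p *\<^sub>R (cnj (\<psi> p) * f i p)))" for p
    by (simp add: sum_distrib_left scaleR_sum_right mult.left_commute)
  then show ?thesis
    unfolding l2_pairing_def set_lebesgue_integral_def
    by (simp only: Bochner_Integration.integral_sum integrable_mult_right L2_pairing_integrable assms
        integral_mult_right_zero)
qed

lemma l2_pairing_scale:
  assumes "bounded D" "D \<in> sets lebesgue" "\<psi> \<in> L2 D" "f \<in> Fun D"
  shows "l2_pairing D \<psi> (\<lambda>p. c * f p) = c * l2_pairing D \<psi> f"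
  using l2_pairing_sum[of D \<psi> "{()}" "\<lambda>_. f" "\<lambda>_. c"] assms by simp

lemma l2_pairing_0: "l2_pairing D \<psi> (\<lambda>p. 0) = 0"
  by (simp add: l2_pairing_def set_lebesgue_integral_def)

lemma exp_sum_tendsto: "(\<lambda>N. exp_sum N w p) \<longlonglongrightarrow> exp (of_real (lin_fun w p))"
proof -
  have "(\<lambda>n. of_real (lin_fun w p) ^ n /\<^sub>R fact n) sums exp (of_real (lin_fun w p) :: complex)"
    by (rule exp_converges)
  then have "(\<lambda>N. \<Sum>n\<le>N. of_real (lin_fun w p) ^ n /\<^sub>R fact n) \<longlonglongrightarrow> exp (of_real (lin_fun w p) :: complex)"
    by (simp add: sums_def_le)
  moreover have "(\<Sum>n\<le>N. of_real (lin_fun w p) ^ n /\<^sub>R fact n) = exp_sum N w p" for N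
    unfolding exp_sum_def
    by (intro sum.cong refl) (simp add: scaleR_conv_of_real divide_inverse)
  ultimately show ?thesis by simp
qed

lemma norm_exp_sum_le: "norm (exp_sum N w p) \<le> exp \<bar>lin_fun w p\<bar>"
proof -
  have "norm (exp_sum N w p) \<le> (\<Sum>n\<le>N. \<bar>lin_fun w p\<bar> ^ n /\<^sub>R fact n)"
    unfolding exp_sum_def
    by (rule sum_norm_le) (simp add: norm_mult norm_power norm_divide norm_inverse divide_inverse)
  also have "\<dots> \<le> suminf (\<lambda>n. \<bar>lin_fun w p\<bar> ^ n /\<^sub>R fact n)"
    by (rule sum_le_suminf[OF summable_exp_generic]) auto
  finally show ?thesis by (simp add: exp_def)
qed

lemma l2_pairing_exp_sum_tendsto:
  assumes D: "bounded D" "D \<in> sets lebesgue" and psi: "\<psi> \<in> L2 D"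
  shows "(\<lambda>N. l2_pairing D \<psi> (\<lambda>p. exp_sum N w1 p * exp_sum N w2 p * exp_fun D w3 p)) \<longlonglongrightarrow>
    l2_pairing D \<psi> (\<lambda>p. exp_fun D w1 p * exp_fun D w2 p * exp_fun D w3 p)"
proof -
  have expfun: "exp_fun D w p = (if p \<in> interior D then exp (of_real (lin_fun w p)) else 0)" for w p
    by (simp add: exp_fun_def lin_fun_def)
  obtain C where C: "C \<ge> 0" "\<And>p. norm (exp_fun D w3 p) \<le> C"
    using Fun_norm_bound[OF exp_fun_Fun_pderiv(1)[OF D(1)]] by blast
  have bl: "\<exists>B. \<forall>p\<in>D. \<bar>lin_fun w p\<bar> \<le> B" for w
    using bounded_linear_image[OF D(1) bounded_linear_lin_fun[of w]] by (auto simp: bounded_iff)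
  obtain B1 where B1: "\<And>p. p \<in> D \<Longrightarrow> \<bar>lin_fun w1 p\<bar> \<le> B1" using bl by blast
  obtain B2 where B2: "\<And>p. p \<in> D \<Longrightarrow> \<bar>lin_fun w2 p\<bar> \<le> B2" using bl by blast
  \<comment> \<open>A bound uniform in \<open>N\<close>: partial sums of the exponential series are
    at most the exponential of the absolute value, and the linear forms are bounded on
    \<open>D\<close>.\<close>
  define B where "B = exp B1 * exp B2 * C"
  let ?h = "\<lambda>N p. exp_sum N w1 p * exp_sum N w2 p * exp_fun D w3 p"
  have hB: "norm (?h N p) \<le> B" for N p
  proof (cases "p \<in> interior D")
    case True
    then have p: "p \<in> D" using interior_subset by blast
    have "norm (exp_sum N w1 p) \<le> exp B1" "norm (exp_sum N w2 p) \<le> exp B2"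
      using order_trans[OF norm_exp_sum_le] B1[OF p] B2[OF p] by simp_all
    then show ?thesis unfolding B_def norm_mult by (intro mult_mono C) auto
  qed (use C(1) in \<open>simp add: expfun B_def\<close>)
  have meas: "exp_sum N w \<in> borel_measurable lebesgue" for N w
  proof -
    have "lin_fun w \<in> borel_measurable borel"
      using bounded_linear_lin_fun linear_continuous_on borel_measurable_continuous_onI by blast
    then have "exp_sum N w \<in> borel_measurable borel"
      unfolding exp_sum_def by measurable
    then show ?thesis by (simp add: measurable_completion)
  qed
  have expm: "exp_fun D w \<in> borel_measurable lebesgue" for w
    by (rule Fun_borel_measurable[OF exp_fun_Fun_pderiv(1)[OF D(1)]])
  show ?thesis
    unfolding l2_pairing_def set_lebesgue_integral_def
  proof (rule integral_dominated_convergence)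
    show "integrable lebesgue (\<lambda>p. B * (indicator D p * (1 + (norm (\<psi> p))\<^sup>2)))"
      by (intro integrable_mult_right L2_integrable_dominant D psi)
    show "(\<lambda>p. indicator D p *\<^sub>R (cnj (\<psi> p) * (exp_fun D w1 p * exp_fun D w2 p * exp_fun D w3 p)))
        \<in> borel_measurable lebesgue"
      by (intro L2_mult_measurable psi borel_measurable_times expm)
    show "(\<lambda>p. indicator D p *\<^sub>R (cnj (\<psi> p) * ?h N p)) \<in> borel_measurable lebesgue" for N
      by (intro L2_mult_measurable psi borel_measurable_times expm meas)
    show "AE p in lebesgue. norm (indicator D p *\<^sub>R (cnj (\<psi> p) * ?h N p)) \<le> B * (indicator D p * (1 + (norm (\<psi> p))\<^sup>2))" for N
      by (intro AE_I2 L2_mult_norm_bound hB)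
    \<comment> \<open>Outside the interior the sums \<open>exp_sum\<close> need not vanish; there
      both sides are zero because of the factor \<open>exp_fun D w3\<close>.\<close>
    have hlim: "(\<lambda>N. ?h N p) \<longlonglongrightarrow> exp_fun D w1 p * exp_fun D w2 p * exp_fun D w3 p" for p
    proof (cases "p \<in> interior D")
      case True
      have "(\<lambda>N. ?h N p) \<longlonglongrightarrow> exp (of_real (lin_fun w1 p)) * exp (of_real (lin_fun w2 p)) * exp_fun D w3 p"
        by (intro tendsto_mult exp_sum_tendsto tendsto_const)
      then show ?thesis using True by (simp add: expfun[of w1] expfun[of w2])
    qed (simp add: expfun)
    show "AE p in lebesgue. (\<lambda>N. indicator D p *\<^sub>R (cnj (\<psi> p) * ?h N p)) \<longlonglongrightarrow>
        indicator D p *\<^sub>R (cnj (\<psi> p) * (exp_fun D w1 p * exp_fun D w2 p * exp_fun D w3 p))"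
      by (rule AE_I2, rule tendsto_scaleR[OF tendsto_const tendsto_mult[OF tendsto_const hlim]])
  qed
qed

lemma det_cross: "dot (cross (cvec w1) (cvec w2)) (cvec w3) = of_int (vol_E w1 w2 w3)"
  by (simp add: vol_E_def det_3 dot_def cross_def sum_3 eps_values cvec_def algebra_simps)

lemma (in vexp) exp_sum_exp_sum_Fun: "(\<lambda>p. exp_sum N w1 p * exp_sum N w2 p * exp_fun D w3 p) \<in> Fun D"
proof -
  have "(\<lambda>p. of_real (lin_fun w1 p) ^ n * (exp_sum N w2 p * exp_fun D w3 p)) \<in> Fun D" for n
  proof (induction n)
    case (Suc n)
    then show ?case using Fun_coord_mult[OF D bounded_linear_lin_fun Suc, of w1] by (simp add: mult.assoc)
  qed (simp add: exp_sum_exp)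
  then have "(\<lambda>p. \<Sum>n\<le>N. 1 / fact n * (of_real (lin_fun w1 p) ^ n * (exp_sum N w2 p * exp_fun D w3 p))) \<in> Fun D"
    by (intro Fun_sum Fun_scale)
  then show ?thesis by (simp add: exp_sum_def[of N w1] sum_distrib_right mult.assoc)
qed

definition vol_poly :: "int \<Rightarrow> nat \<Rightarrow> log_poly poly" where
  "vol_poly v M = (\<Sum>n\<le>M. monom (fps_nth (fps_const (log_const (of_int v)) * vol_H) n) n)"

lemma coeff_vol_poly: "n \<le> M \<Longrightarrow> coeff (vol_poly v M) n = fps_nth (fps_const (log_const (of_int v)) * vol_H) n"
  by (simp add: vol_poly_def coeff_sum)

lemma log_embed_log_const: "log_embed (log_const c) = const c"
  by (simp add: log_const_def const_def log_embed_single zero_prod_def)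

lemma log_embed_log_ratio: "log_embed log_ratio = log_w - log_z"
proof -
  have "log_embed (Poly_Mapping.single (0, 1) 1 + Poly_Mapping.single (1, 0) (- 1)) = log_w - log_z"
    by (simp only: log_embed_add log_embed_single) (simp add: log_w_def log_z_def single_uminus)
  then show ?thesis by (simp add: log_ratio_def single_uminus)
qed

lemma ratio_eval_monom: "ratio_eval (monom c n) = log_embed c * (z_pow (- 1) * w_pow 1) ^ n"
  by (induction n) (simp_all add: ratio_eval_pCons monom_Suc monom_0 mult_ac)

lemma ratio_eval_sum: "ratio_eval (\<Sum>i\<in>I. t i) = (\<Sum>i\<in>I. ratio_eval (t i))"
  by (induction I rule: infinite_finite_induct) (auto simp: ratio_eval_add)

text \<open>The coefficients of the mode commutator are recognized as those of Rogers' dilogarithm: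
  the negative coefficients of \<open>log_one_minus\<close> turn \<open>log_w - log_z\<close> into
  the difference \<open>log_z - log_w\<close> that the contraction produced.\<close>

lemma ratio_eval_vol_poly: "ratio_eval (vol_poly v M) = ratio_series (int M) * const (of_int v)"
proof -
  let ?t = "z_pow (- 1) * w_pow 1"
  let ?s = "\<lambda>m. const (1 / (of_int m)\<^sup>2) + const (1 / (2 * of_int m)) * (log_z - log_w)"
  have c: "log_embed (fps_nth (fps_const (log_const (of_int v)) * vol_H) n) = const (of_int v) * ?s (int n)" for n
  proof -
    have "fps_nth (fps_const (log_const (of_int v)) * vol_H) n = log_const (of_int v) *
      (log_const (1 / (of_nat n)\<^sup>2) + log_const (1/2) * log_ratio * log_const (- (1 / of_nat n)))"
      by (simp add: vol_H_def lift_fps_def Li2_def log_one_minus_def)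
    then have "log_embed (fps_nth (fps_const (log_const (of_int v)) * vol_H) n) = const (of_int v) *
      (const (1 / (of_nat n)\<^sup>2) + const (1/2) * (log_w - log_z) * const (- (1 / of_nat n)))"
      by (simp only: log_embed_mult log_embed_add log_embed_log_const log_embed_log_ratio)
    also have "const (1/2) * (log_w - log_z) * const (- (1 / of_nat n)) =
      (const (1/2) * const (1 / of_nat n)) * (log_z - log_w)"
      by (simp add: const_minus algebra_simps)
    also have "const (1/2) * const (1 / of_nat n) = const (1 / (2 * of_nat n))"
      by (simp flip: const_mult)
    finally show ?thesis by simp
  qed
  have t: "?t ^ n = z_pow (- int n) * w_pow (int n)" for n
    unfolding ratio_power by (simp add: z_pow_def w_pow_def mult_single)
  have "ratio_eval (vol_poly v M) = (\<Sum>n\<le>M. const (of_int v) * ?s (int n) * ?t ^ n)"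
    by (simp only: vol_poly_def ratio_eval_sum ratio_eval_monom c)
  \<comment> \<open>The summand at \<open>n = 0\<close> vanishes by the convention
    \<open>1 / 0 = 0\<close>.\<close>
  also have "\<dots> = (\<Sum>n\<in>{0<..M}. const (of_int v) * ?s (int n) * ?t ^ n)"
    by (rule sum.mono_neutral_right) (auto simp: Suc_le_eq)
  also have "\<dots> = (\<Sum>m\<in>{0<..int M}. const (of_int v) * ?s m * (z_pow (- m) * w_pow m))"
    by (rule sum.reindex_bij_witness[of _ nat int]) (auto simp: t)
  finally show ?thesis
    by (simp add: ratio_series_def sum_distrib_left sum_distrib_right mult_ac)
qed

text \<open>Neither truncation is visible at the exponent \<open>e\<close>. The series has no
  constant term, so its power \<open>k\<close> starts in degree \<open>k\<close> and large
  \<open>k\<close> do not contribute; and the coefficients up to the exponent of \<open>w\<close>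
  involve only the first \<open>M\<close> modes.\<close>

lemma lookup_exp_ratio_series:
  assumes N: "nat (w_exp e) \<le> N" and K: "nat (w_exp e) \<le> M"
  shows "Poly_Mapping.lookup (\<Sum>k\<le>N. const (1 / fact k) * (ratio_series (int M) * const (of_int v)) ^ k) e =
    i_zw (series_exp (fps_const (log_const (of_int v)) * vol_H)) e"
proof -
  let ?G = "fps_const (log_const (of_int v)) * vol_H" and ?P = "vol_poly v M"
  have G0: "fps_nth ?G 0 = 0"
    by (simp add: vol_H_def lift_fps_def Li2_def log_one_minus_def log_const_def)
  have "(\<Sum>k\<le>N. const (1 / fact k) * (ratio_series (int M) * const (of_int v)) ^ k) =
    ratio_eval (\<Sum>k\<le>N. smult (log_const (1 / fact k)) (?P ^ k))"
    by (simp add: ratio_eval_sum ratio_eval_smult ratio_eval_power ratio_eval_vol_poly log_embed_log_const)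
  moreover have "i_zw (series_exp ?G) e = Poly_Mapping.lookup
      (ratio_eval (\<Sum>k\<le>N. smult (log_const (1 / fact k)) (?P ^ k))) e"
  proof (rule i_zw_ratio_eval)
    fix n assume n: "n \<le> nat (w_exp e)"
    have pow: "coeff (?P ^ k) n = fps_nth (?G ^ k) n" for k
    proof -
      have "fps_nth (fps_of_poly ?P ^ k) n = fps_nth (?G ^ k) n"
        by (rule fps_power_nth_cong[of n]) (use n K coeff_vol_poly in auto)
      then show ?thesis by (simp flip: fps_of_poly_power)
    qed
    have "fps_nth (series_exp ?G) n = (\<Sum>k\<le>n. log_const (1 / fact k) * fps_nth (?G ^ k) n)"
      by (simp add: series_exp_def)
    also have "\<dots> = (\<Sum>k\<le>N. log_const (1 / fact k) * fps_nth (?G ^ k) n)"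
      by (rule sum.mono_neutral_left) (use n N fps_power_nth_zero[OF G0] in auto)
    also have "\<dots> = coeff (\<Sum>k\<le>N. smult (log_const (1 / fact k)) (?P ^ k)) n"
      by (simp add: coeff_sum pow)
    finally show "fps_nth (series_exp ?G) n = coeff (\<Sum>k\<le>N. smult (log_const (1 / fact k)) (?P ^ k)) n" .
  qed
  ultimately show ?thesis by simp
qed

text \<open>With \<open>K\<close> at least the size of both exponents, every word that contributes
  at \<open>e\<close> lies in the support of one finitely supported tensor, the same as on all words
  with modes up to \<open>K\<close>. The sum then moves inside the pairing, where
  \<open>lam_vertex_product\<close> evaluates it.\<close>

lemma matrix_elem_vertex_ops:
  fixes w1 w2 w3 :: "int ^ 3"
  assumes Dm: "bounded D" "D \<in> sets lebesgue" and psi: "\<psi> \<in> L2 D"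
    and K: "\<bar>z_exp e\<bar> \<le> K" "\<bar>w_exp e\<bar> \<le> K"
  defines "A \<equiv> \<lambda>N. vertex_op N w1 z_pow log_z \<star> vertex_op N w2 w_pow log_w"
  shows "finite {u. Poly_Mapping.lookup (A N u) e * word_elem D \<psi> u (exp_fun D w3) \<noteq> 0}"
    and "matrix_elem D \<psi> (A N) (exp_fun D w3) e =
      Poly_Mapping.lookup (\<Sum>k\<le>N. const (1 / fact k) * (ratio_series K * const (of_int (vol_E w1 w2 w3))) ^ k) e *
      l2_pairing D \<psi> (\<lambda>p. exp_sum N w1 p * exp_sum N w2 p * exp_fun D w3 p)"
proof -
  interpret vexp D w3 by unfold_locales (rule Dm)
  let ?f = "exp_fun D w3"
  have K0: "0 \<le> K" using K by linarith
  obtain t where t: "truncates K (A N) t" and lam_t: "\<And>p. lam D ?f t p =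
      (\<Sum>k\<le>N. const (1 / fact k) * (ratio_series K * const (of_int (vol_E w1 w2 w3))) ^ k) *
      const (exp_sum N w1 p * exp_sum N w2 p * ?f p)"
    using truncates_mult[OF truncates_vertex_op[OF K0, of N w1 z_pow log_z]
        truncates_vertex_op[OF K0, of N w2 w_pow log_w]] lam_vertex_product[of N w1 K w2]
    unfolding A_def det_cross by blast
  let ?G = "\<Sum>k\<le>N. const (1 / fact k) * (ratio_series K * const (of_int (vol_E w1 w2 w3))) ^ k"
  have word: "word_elem D \<psi> u ?f = l2_pairing D \<psi> (phi D u ?f)" for u
    by (rule word_elem_eq[OF Dm(1) f])
  have keys: "u \<in> Poly_Mapping.keys t \<and> A N u = Poly_Mapping.lookup t u"
    if nz: "Poly_Mapping.lookup (A N u) e * word_elem D \<psi> u ?f \<noteq> 0" for u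
  proof -
    have "phi D u ?f \<noteq> (\<lambda>p. 0)" using nz by (auto simp: word l2_pairing_0)
    moreover have "Poly_Mapping.lookup (A N u) e \<noteq> 0" using nz by auto
    ultimately have "bnd K u" unfolding A_def using vertex_ops_bnd[OF Dm(1) f] K by blast
    then show ?thesis using t nz by (auto simp: truncates_def in_keys_iff)
  qed
  have AK: "A N u = Poly_Mapping.lookup t u" if "u \<in> Poly_Mapping.keys t" for u
    using t that unfolding truncates_def in_keys_iff by metis
  show fin: "finite {u. Poly_Mapping.lookup (A N u) e * word_elem D \<psi> u ?f \<noteq> 0}"
    by (rule finite_subset[of _ "Poly_Mapping.keys t"]) (use keys in auto)
  have "matrix_elem D \<psi> (A N) ?f e =
    (\<Sum>u\<in>Poly_Mapping.keys t. Poly_Mapping.lookup (A N u) e * word_elem D \<psi> u ?f)"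
    unfolding matrix_elem_def by (rule Sum_any.expand_superset) (use keys in auto)
  also have "\<dots> = (\<Sum>u\<in>Poly_Mapping.keys t. Poly_Mapping.lookup (Poly_Mapping.lookup t u) e * l2_pairing D \<psi> (phi D u ?f))"
    by (intro sum.cong refl) (simp add: AK word)
  also have "\<dots> = l2_pairing D \<psi> (\<lambda>p. \<Sum>u\<in>Poly_Mapping.keys t. Poly_Mapping.lookup (Poly_Mapping.lookup t u) e * phi D u ?f p)"
    by (rule l2_pairing_sum[symmetric]) (use Dm psi Fun_phi[OF Dm(1) f] in auto)
  also have "(\<lambda>p. \<Sum>u\<in>Poly_Mapping.keys t. Poly_Mapping.lookup (Poly_Mapping.lookup t u) e * phi D u ?f p) =
    (\<lambda>p. Poly_Mapping.lookup (lam D ?f t p) e)"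
    by (simp add: lam_def lookup_sum lookup_mult_const)
  also have "\<dots> = (\<lambda>p. Poly_Mapping.lookup ?G e * (exp_sum N w1 p * exp_sum N w2 p * ?f p))"
    unfolding lam_t lookup_mult_const ..
  also have "l2_pairing D \<psi> \<dots> = Poly_Mapping.lookup ?G e * l2_pairing D \<psi> (\<lambda>p. exp_sum N w1 p * exp_sum N w2 p * ?f p)"
    by (rule l2_pairing_scale[OF Dm psi]) (rule exp_sum_exp_sum_Fun)
  finally show "matrix_elem D \<psi> (A N) ?f e = Poly_Mapping.lookup ?G e *
      l2_pairing D \<psi> (\<lambda>p. exp_sum N w1 p * exp_sum N w2 p * ?f p)" .
qed

theorem proposition1:
  fixes D :: "pt set" and \<psi> :: "pt \<Rightarrow> complex" and w1 w2 w3 :: "int ^ 3"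
  assumes "fundamental_domain D" and "\<psi> \<in> L2 D"
  defines "A \<equiv> (\<lambda>N. vertex_op N w1 z_pow log_z \<star> vertex_op N w2 w_pow log_w)"
  shows "correlator_converges D \<psi> A (exp_fun D w3) \<and>
    correlator D \<psi> A (exp_fun D w3) =
      (\<lambda>e. i_zw (series_exp (fps_const (log_const (of_int (vol_E w1 w2 w3))) * vol_H)) e *
           l2_pairing D \<psi> (\<lambda>p. exp_fun D w1 p * exp_fun D w2 p * exp_fun D w3 p))"
proof -
  have D: "bounded D" "D \<in> sets lebesgue" using assms(1) by (auto simp: fundamental_domain_def)
  let ?G = "series_exp (fps_const (log_const (of_int (vol_E w1 w2 w3))) * vol_H)"
  let ?L = "l2_pairing D \<psi> (\<lambda>p. exp_fun D w1 p * exp_fun D w2 p * exp_fun D w3 p)"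
  have lim: "(\<lambda>N. matrix_elem D \<psi> (A N) (exp_fun D w3) e) \<longlonglongrightarrow> i_zw ?G e * ?L" for e
  proof -
    \<comment> \<open>The number of modes depends on \<open>e\<close> but not on \<open>N\<close>,
      so the limit in \<open>N\<close> is taken with finitely many fixed modes.\<close>
    define M where "M = nat (\<bar>z_exp e\<bar> + \<bar>w_exp e\<bar>)"
    have M: "\<bar>z_exp e\<bar> \<le> int M" "\<bar>w_exp e\<bar> \<le> int M" by (auto simp: M_def)
    have "(\<lambda>N. i_zw ?G e * l2_pairing D \<psi> (\<lambda>p. exp_sum N w1 p * exp_sum N w2 p * exp_fun D w3 p))
        \<longlonglongrightarrow> i_zw ?G e * ?L"
      by (intro tendsto_mult tendsto_const l2_pairing_exp_sum_tendsto D assms(2))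
    \<comment> \<open>From this order on the coefficient of the dilogarithm factor is constant in
      \<open>N\<close>; the limit concerns only the two exponentials of zero modes inside the
      pairing.\<close>
    moreover have "\<forall>\<^sub>F N in sequentially. i_zw ?G e *
        l2_pairing D \<psi> (\<lambda>p. exp_sum N w1 p * exp_sum N w2 p * exp_fun D w3 p) =
        matrix_elem D \<psi> (A N) (exp_fun D w3) e"
      using eventually_ge_at_top[of "nat (w_exp e)"]
    proof eventually_elim
      case (elim N)
      have "nat (w_exp e) \<le> M" using M by linarith
      then show ?case
        unfolding A_def matrix_elem_vertex_ops(2)[OF D assms(2) M]
        using lookup_exp_ratio_series[OF elim, of M] by simp
    qed
    ultimately show ?thesis by (rule Lim_transform_eventually)
  qed
  have "finite {u. Poly_Mapping.lookup (A N u) e * word_elem D \<psi> u (exp_fun D w3) \<noteq> 0}" for N e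
    unfolding A_def by (rule matrix_elem_vertex_ops(1)[OF D assms(2), of e "\<bar>z_exp e\<bar> + \<bar>w_exp e\<bar>"]) auto
  moreover have "convergent (\<lambda>N. matrix_elem D \<psi> (A N) (exp_fun D w3) e)" for e
    by (rule convergentI[OF lim])
  ultimately show ?thesis
    using limI[OF lim] by (auto simp: correlator_converges_def correlator_def)
qed

end
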